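(* Let $\mathsf{Meas}$ be the category of measurable spaces and measurable maps, and let $\mathsf{c}\sigma\mathsf{C}^*_\sigma$ be the category of commutative $\sigma C^*$-algebras with $\sigma$-$*$-homomorphisms. The functors $\mathscr{L}^\infty\colon \mathsf{Meas}\to(\mathsf{c}\sigma\mathsf{C}^*_\sigma)^{\mathrm{op}}$ and $\mathrm{Spec}_\sigma\colon (\mathsf{c}\sigma\mathsf{C}^*_\sigma)^{\mathrm{op}}\to\mathsf{Meas}$ form an idempotent adjunction, with $\mathscr{L}^\infty$ left adjoint to $\mathrm{Spec}_\sigma$; that is, there are bijections $\mathsf{Meas}(X,\mathrm{Spec}_\sigma(\mathcal{A}))\cong \mathsf{c}\sigma\mathsf{C}^*_\sigma(\mathcal{A},\mathscr{L}^\infty(X))$ natural in $X$ and $\mathcal{A}$, and the adjunction is idempotent. Moreover, this adjunction restricts to a contravariant equivalence between the full subcategory of sober measurable spaces and the full subcategory of commutative purely $\sigma$-representable $\sigma C^*$-algebras (with $\sigma$-$*$-homomorphisms).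
   Context: All $C^*$-algebras are unital and all $*$-homomorphisms are unital. A $\sigma C^*$-algebra is a $C^*$-algebra $\mathcal{A}$ in which every norm-bounded monotone increasing sequence of self-adjoint elements has a supremum in the poset $(\mathcal{A}_{\mathrm{sa}},\le)$. For $C^*$-algebras $\mathcal{A},\mathcal{B}$, a positive unital map $\phi\colon\mathcal{A}\to\mathcal{B}$ is $\sigma$-normal if $\phi(\sup_n a_n)=\sup_n\phi(a_n)$ for every bounded increasing sequence $(a_n)$ of self-adjoint elements whose supremum $\sup_n a_n$ exists in $\mathcal{A}$; a $\sigma$-$*$-homomorphism is a $\sigma$-normal $*$-homomorphism; a $\sigma$-state is a $\sigma$-normal state; a pure $\sigma$-state is a $\sigma$-state that is an extreme point of the state space. A $\sigma C^*$-algebra is purely $\sigma$-representable if for every positive $x$, $\phi(x)=0$ for all pure $\sigma$-states $\phi$ implies $x=0$. For a measurable space $X$, $\mathscr{L}^\infty(X)$ is the commutative $\sigma C^*$-algebra of bounded complex-valued measurable functions on $X$ (pointwise operations, sup norm); on a measurable map $f\colon X\to Y$ the functor gives $f^*\colon\mathscr{L}^\infty(Y)\to\mathscr{L}^\infty(X)$, $g\mapsto g\circ f$. For a commutative $\sigma C^*$-algebra $\mathcal{A}$, its Gelfand $\sigma$-spectrum $\mathrm{Spec}_\sigma(\mathcal{A})$ is the set of $\sigma$-$*$-homomorphisms $\mathcal{A}\to\mathbb{C}$ with the smallest $\sigma$-algebra making all evaluation maps $\phi\mapsto\phi(a)$, $a\in\mathcal{A}$, measurable; on morphisms it acts by precomposition.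 A measurable space $X$ is sober if the map $x\mapsto\delta_x$ is a bijection between points of $X$ and $\{0,1\}$-valued probability measures on $X$. *)

theory Defs
  imports "HOL-Probability.Probability"
begin

record 'a cstar =
  cs_carrier :: "'a set"
  cs_zero :: 'a
  cs_one :: 'a
  cs_add :: "'a \<Rightarrow> 'a \<Rightarrow> 'a"
  cs_mult :: "'a \<Rightarrow> 'a \<Rightarrow> 'a"
  cs_scale :: "complex \<Rightarrow> 'a \<Rightarrow> 'a"
  cs_star :: "'a \<Rightarrow> 'a"
  cs_norm :: "'a \<Rightarrow> real"

definition cs_sub :: "'a cstar \<Rightarrow> 'a \<Rightarrow> 'a \<Rightarrow> 'a" where
  "cs_sub A x y = cs_add A x (cs_scale A (-1) y)"

definition cstar_alg :: "'a cstar \<Rightarrow> bool" where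
  "cstar_alg A \<longleftrightarrow>
    (     (cs_zero A) \<in> (cs_carrier A) \<and> (cs_one A) \<in> (cs_carrier A) \<and>
     (\<forall>x\<in>cs_carrier A. \<forall>y\<in>cs_carrier A. (cs_add A) x y \<in> (cs_carrier A) \<and> (cs_mult A) x y \<in> (cs_carrier A)) \<and>
     (\<forall>c. \<forall>x\<in>cs_carrier A. (cs_scale A) c x \<in> (cs_carrier A)) \<and> (\<forall>x\<in>cs_carrier A. (cs_star A) x \<in> (cs_carrier A)) \<and>
     \<comment> \<open>complex vector space\<close>
     (\<forall>x\<in>cs_carrier A. \<forall>y\<in>cs_carrier A. \<forall>w\<in>cs_carrier A. (cs_add A) ((cs_add A) x y) w = (cs_add A) x ((cs_add A) y w)) \<and>
     (\<forall>x\<in>cs_carrier A. \<forall>y\<in>cs_carrier A. (cs_add A) x y = (cs_add A) y x) \<and>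
     (\<forall>x\<in>cs_carrier A. (cs_add A) (cs_zero A) x = x) \<and>
     (\<forall>x\<in>cs_carrier A. \<exists>y\<in>cs_carrier A. (cs_add A) x y = (cs_zero A)) \<and>
     (\<forall>c. \<forall>x\<in>cs_carrier A. \<forall>y\<in>cs_carrier A. (cs_scale A) c ((cs_add A) x y) = (cs_add A) ((cs_scale A) c x) ((cs_scale A) c y)) \<and>
     (\<forall>c d. \<forall>x\<in>cs_carrier A. (cs_scale A) (c + d) x = (cs_add A) ((cs_scale A) c x) ((cs_scale A) d x)) \<and>
     (\<forall>c d. \<forall>x\<in>cs_carrier A. (cs_scale A) c ((cs_scale A) d x) = (cs_scale A) (c * d) x) \<and>
     (\<forall>x\<in>cs_carrier A. (cs_scale A) 1 x = x) \<and>
     \<comment> \<open>unital associative algebra\<close>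
     (\<forall>x\<in>cs_carrier A. \<forall>y\<in>cs_carrier A. \<forall>w\<in>cs_carrier A. (cs_mult A) ((cs_mult A) x y) w = (cs_mult A) x ((cs_mult A) y w)) \<and>
     (\<forall>x\<in>cs_carrier A. (cs_mult A) (cs_one A) x = x \<and> (cs_mult A) x (cs_one A) = x) \<and>
     (\<forall>x\<in>cs_carrier A. \<forall>y\<in>cs_carrier A. \<forall>w\<in>cs_carrier A. (cs_mult A) x ((cs_add A) y w) = (cs_add A) ((cs_mult A) x y) ((cs_mult A) x w) \<and> (cs_mult A) ((cs_add A) y w) x = (cs_add A) ((cs_mult A) y x) ((cs_mult A) w x)) \<and>
     (\<forall>c. \<forall>x\<in>cs_carrier A. \<forall>y\<in>cs_carrier A. (cs_scale A) c ((cs_mult A) x y) = (cs_mult A) ((cs_scale A) c x) y \<and> (cs_scale A) c ((cs_mult A) x y) = (cs_mult A) x ((cs_scale A) c y)) \<and>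
     \<comment> \<open>involution\<close>
     (\<forall>x\<in>cs_carrier A. (cs_star A) ((cs_star A) x) = x) \<and>
     (\<forall>x\<in>cs_carrier A. \<forall>y\<in>cs_carrier A. (cs_star A) ((cs_add A) x y) = (cs_add A) ((cs_star A) x) ((cs_star A) y)) \<and>
     (\<forall>c. \<forall>x\<in>cs_carrier A. (cs_star A) ((cs_scale A) c x) = (cs_scale A) (cnj c) ((cs_star A) x)) \<and>
     (\<forall>x\<in>cs_carrier A. \<forall>y\<in>cs_carrier A. (cs_star A) ((cs_mult A) x y) = (cs_mult A) ((cs_star A) y) ((cs_star A) x)) \<and>
     \<comment> \<open>norm, submultiplicativity, C*-identity\<close>
     (\<forall>x\<in>cs_carrier A. (cs_norm A) x = 0 \<longleftrightarrow> x = (cs_zero A)) \<and>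
     (\<forall>x\<in>cs_carrier A. \<forall>y\<in>cs_carrier A. (cs_norm A) ((cs_add A) x y) \<le> (cs_norm A) x + (cs_norm A) y) \<and>
     (\<forall>c. \<forall>x\<in>cs_carrier A. (cs_norm A) ((cs_scale A) c x) = cmod c * (cs_norm A) x) \<and>
     (\<forall>x\<in>cs_carrier A. \<forall>y\<in>cs_carrier A. (cs_norm A) ((cs_mult A) x y) \<le> (cs_norm A) x * (cs_norm A) y) \<and>
     (\<forall>x\<in>cs_carrier A. (cs_norm A) ((cs_mult A) ((cs_star A) x) x) = ((cs_norm A) x)\<^sup>2) \<and>
     \<comment> \<open>completeness\<close>
     (\<forall>u::nat \<Rightarrow> 'a. (\<forall>k. u k \<in> (cs_carrier A)) \<and> (\<forall>\<epsilon>>0. \<exists>N. \<forall>i\<ge>N. \<forall>j\<ge>N. (cs_norm A) (cs_sub A (u i) (u j)) < \<epsilon>)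
        \<longrightarrow> (\<exists>l\<in>cs_carrier A. \<forall>\<epsilon>>0. \<exists>N. \<forall>i\<ge>N. (cs_norm A) (cs_sub A (u i) l) < \<epsilon>)))"

definition complex_cs :: "complex cstar" where
  "complex_cs = \<lparr>cs_carrier = UNIV, cs_zero = 0, cs_one = 1, cs_add = (+), cs_mult = (*),
      cs_scale = (*), cs_star = cnj, cs_norm = cmod\<rparr>"

definition cs_selfadj :: "'a cstar \<Rightarrow> 'a \<Rightarrow> bool" where
  "cs_selfadj A x \<longleftrightarrow> x \<in> cs_carrier A \<and> cs_star A x = x"

definition cs_positive :: "'a cstar \<Rightarrow> 'a \<Rightarrow> bool" where
  "cs_positive A x \<longleftrightarrow> x \<in> cs_carrier A \<and> (\<exists>b\<in>cs_carrier A. x = cs_mult A (cs_star A b) b)"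

definition cs_le :: "'a cstar \<Rightarrow> 'a \<Rightarrow> 'a \<Rightarrow> bool" where
  "cs_le A x y \<longleftrightarrow> cs_selfadj A x \<and> cs_selfadj A y \<and> cs_positive A (cs_sub A y x)"

definition cs_bdd_incseq :: "'a cstar \<Rightarrow> (nat \<Rightarrow> 'a) \<Rightarrow> bool" where
  "cs_bdd_incseq A a \<longleftrightarrow> (\<forall>k. cs_selfadj A (a k) \<and> cs_le A (a k) (a (Suc k)))
      \<and> (\<exists>M. \<forall>k. cs_norm A (a k) \<le> M)"

definition cs_is_sup :: "'a cstar \<Rightarrow> (nat \<Rightarrow> 'a) \<Rightarrow> 'a \<Rightarrow> bool" where
  "cs_is_sup A a s \<longleftrightarrow> cs_selfadj A s \<and> (\<forall>k. cs_le A (a k) s) \<and>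
      (\<forall>t. cs_selfadj A t \<and> (\<forall>k. cs_le A (a k) t) \<longrightarrow> cs_le A s t)"

definition sigma_cstar :: "'a cstar \<Rightarrow> bool" where
  "sigma_cstar A \<longleftrightarrow> cstar_alg A \<and> (\<forall>a. cs_bdd_incseq A a \<longrightarrow> (\<exists>s. cs_is_sup A a s))"

definition comm_sigma_cstar :: "'a cstar \<Rightarrow> bool" where
  "comm_sigma_cstar A \<longleftrightarrow> sigma_cstar A \<and>
      (\<forall>x\<in>cs_carrier A. \<forall>y\<in>cs_carrier A. cs_mult A x y = cs_mult A y x)"

definition cs_linear :: "'a cstar \<Rightarrow> 'b cstar \<Rightarrow> ('a \<Rightarrow> 'b) \<Rightarrow> bool" where
  "cs_linear A B h \<longleftrightarrow> (\<forall>x\<in>cs_carrier A. h x \<in> cs_carrier B) \<and>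
     (\<forall>x\<in>cs_carrier A. \<forall>y\<in>cs_carrier A. h (cs_add A x y) = cs_add B (h x) (h y)) \<and>
     (\<forall>c. \<forall>x\<in>cs_carrier A. h (cs_scale A c x) = cs_scale B c (h x))"

definition pos_unital_map :: "'a cstar \<Rightarrow> 'b cstar \<Rightarrow> ('a \<Rightarrow> 'b) \<Rightarrow> bool" where
  "pos_unital_map A B h \<longleftrightarrow> cs_linear A B h \<and> h (cs_one A) = cs_one B \<and>
     (\<forall>x. cs_positive A x \<longrightarrow> cs_positive B (h x))"

definition sigma_normal :: "'a cstar \<Rightarrow> 'b cstar \<Rightarrow> ('a \<Rightarrow> 'b) \<Rightarrow> bool" where
  "sigma_normal A B h \<longleftrightarrow> pos_unital_map A B h \<and>
     (\<forall>a s. cs_bdd_incseq A a \<and> cs_is_sup A a s \<longrightarrow> cs_is_sup B (h \<circ> a) (h s))"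

definition star_hom :: "'a cstar \<Rightarrow> 'b cstar \<Rightarrow> ('a \<Rightarrow> 'b) \<Rightarrow> bool" where
  "star_hom A B h \<longleftrightarrow> cs_linear A B h \<and> h (cs_one A) = cs_one B \<and>
     (\<forall>x\<in>cs_carrier A. \<forall>y\<in>cs_carrier A. h (cs_mult A x y) = cs_mult B (h x) (h y)) \<and>
     (\<forall>x\<in>cs_carrier A. h (cs_star A x) = cs_star B (h x))"

definition sigma_star_hom :: "'a cstar \<Rightarrow> 'b cstar \<Rightarrow> ('a \<Rightarrow> 'b) \<Rightarrow> bool" where
  "sigma_star_hom A B h \<longleftrightarrow> star_hom A B h \<and> sigma_normal A B h"

definition cs_state :: "'a cstar \<Rightarrow> ('a \<Rightarrow> complex) \<Rightarrow> bool" where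
  "cs_state A \<phi> \<longleftrightarrow> pos_unital_map A complex_cs \<phi>"

definition sigma_state :: "'a cstar \<Rightarrow> ('a \<Rightarrow> complex) \<Rightarrow> bool" where
  "sigma_state A \<phi> \<longleftrightarrow> sigma_normal A complex_cs \<phi>"

definition pure_sigma_state :: "'a cstar \<Rightarrow> ('a \<Rightarrow> complex) \<Rightarrow> bool" where
  "pure_sigma_state A \<phi> \<longleftrightarrow> sigma_state A \<phi> \<and>
     (\<forall>\<psi>1 \<psi>2 (t::real). cs_state A \<psi>1 \<and> cs_state A \<psi>2 \<and> 0 < t \<and> t < 1 \<and>
        (\<forall>x\<in>cs_carrier A. \<phi> x = of_real t * \<psi>1 x + of_real (1 - t) * \<psi>2 x)
        \<longrightarrow> (\<forall>x\<in>cs_carrier A. \<psi>1 x = \<phi> x \<and> \<psi>2 x = \<phi> x))"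

definition purely_sigma_rep :: "'a cstar \<Rightarrow> bool" where
  "purely_sigma_rep A \<longleftrightarrow> sigma_cstar A \<and>
     (\<forall>x. cs_positive A x \<and> (\<forall>\<phi>. pure_sigma_state A \<phi> \<longrightarrow> \<phi> x = 0) \<longrightarrow> x = cs_zero A)"

definition alg_hom :: "'a cstar \<Rightarrow> 'b cstar \<Rightarrow> ('a \<Rightarrow> 'b) set" where
  "alg_hom A B = {h. sigma_star_hom A B h \<and> h \<in> extensional (cs_carrier A)}"

definition meas_hom :: "'x measure \<Rightarrow> 'y measure \<Rightarrow> ('x \<Rightarrow> 'y) set" where
  "meas_hom X Y = measurable X Y \<inter> extensional (space X)"

definition meas_iso :: "'x measure \<Rightarrow> 'y measure \<Rightarrow> ('x \<Rightarrow> 'y) \<Rightarrow> bool" where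
  "meas_iso X Y f \<longleftrightarrow> f \<in> measurable X Y \<and> bij_betw f (space X) (space Y) \<and>
     (\<exists>g\<in>measurable Y X. (\<forall>x\<in>space X. g (f x) = x) \<and> (\<forall>y\<in>space Y. f (g y) = y))"

definition alg_iso :: "'a cstar \<Rightarrow> 'b cstar \<Rightarrow> ('a \<Rightarrow> 'b) \<Rightarrow> bool" where
  "alg_iso A B h \<longleftrightarrow> sigma_star_hom A B h \<and>
     (\<exists>k. sigma_star_hom B A k \<and> (\<forall>a\<in>cs_carrier A. k (h a) = a) \<and> (\<forall>b\<in>cs_carrier B. h (k b) = b))"

definition Linf_set :: "'x measure \<Rightarrow> ('x \<Rightarrow> complex) set" where
  "Linf_set X = {f. f \<in> borel_measurable X \<and> bounded (f ` space X) \<and> (\<forall>x. x \<notin> space X \<longrightarrow> f x = 0)}"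

definition Linf :: "'x measure \<Rightarrow> ('x \<Rightarrow> complex) cstar" where
  "Linf X = \<lparr>cs_carrier = Linf_set X, cs_zero = (\<lambda>x. 0),
      cs_one = (\<lambda>x. if x \<in> space X then 1 else 0),
      cs_add = (\<lambda>f g x. f x + g x), cs_mult = (\<lambda>f g x. f x * g x),
      cs_scale = (\<lambda>c f x. c * f x), cs_star = (\<lambda>f x. cnj (f x)),
      cs_norm = (\<lambda>f. SUP x. cmod (f x))\<rparr>"

definition Linf_map :: "'x measure \<Rightarrow> 'y measure \<Rightarrow> ('x \<Rightarrow> 'y) \<Rightarrow> ('y \<Rightarrow> complex) \<Rightarrow> 'x \<Rightarrow> complex" where
  "Linf_map X Y f = restrict (\<lambda>g x. if x \<in> space X then g (f x) else 0) (Linf_set Y)"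

definition spec_space :: "'a cstar \<Rightarrow> ('a \<Rightarrow> complex) set" where
  "spec_space A = {\<phi>. sigma_star_hom A complex_cs \<phi> \<and> \<phi> \<in> extensional (cs_carrier A)}"

definition Spec :: "'a cstar \<Rightarrow> ('a \<Rightarrow> complex) measure" where
  "Spec A = sigma (spec_space A)
     {{\<phi> \<in> spec_space A. \<phi> a \<in> S} | a S. a \<in> cs_carrier A \<and> S \<in> sets (borel :: complex measure)}"

definition Spec_map :: "'a cstar \<Rightarrow> 'b cstar \<Rightarrow> ('a \<Rightarrow> 'b) \<Rightarrow> ('b \<Rightarrow> complex) \<Rightarrow> 'a \<Rightarrow> complex" where
  "Spec_map A B h = restrict (\<lambda>\<phi>. restrict (\<lambda>a. \<phi> (h a)) (cs_carrier A)) (spec_space B)"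

text \<open>The transposition Meas(X, Spec A) \<rightarrow> c\<sigma>C*(A, L\<infinity>(X)), f \<mapsto> (a \<mapsto> (x \<mapsto> f x a)).\<close>
definition adj_Phi :: "'x measure \<Rightarrow> 'a cstar \<Rightarrow> ('x \<Rightarrow> 'a \<Rightarrow> complex) \<Rightarrow> 'a \<Rightarrow> 'x \<Rightarrow> complex" where
  "adj_Phi X A f = restrict (\<lambda>a x. if x \<in> space X then f x a else 0) (cs_carrier A)"

definition adj_unit :: "'x measure \<Rightarrow> 'x \<Rightarrow> ('x \<Rightarrow> complex) \<Rightarrow> complex" where
  "adj_unit X = restrict (\<lambda>x. restrict (\<lambda>g. g x) (Linf_set X)) (space X)"

definition adj_counit :: "'a cstar \<Rightarrow> 'a \<Rightarrow> ('a \<Rightarrow> complex) \<Rightarrow> complex" where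
  "adj_counit A = adj_Phi (Spec A) A (restrict (\<lambda>\<phi>. \<phi>) (spec_space A))"

definition sober :: "'x measure \<Rightarrow> bool" where
  "sober X \<longleftrightarrow> bij_betw (\<lambda>x. return X x) (space X)
     {\<mu>. sets \<mu> = sets X \<and> prob_space \<mu> \<and> (\<forall>S\<in>sets X. emeasure \<mu> S = 0 \<or> emeasure \<mu> S = 1)}"

end

theory Submission
  imports Defs "HOL-Algebra.Ring"
begin

text \<open>Everything rests on two observations. In a commutative C*-algebra, an iterative square root shows that
  the elements $b^* b$ are exactly the self-adjoint $p$ with $\|t - p\| \le t$ for some $t \ge 0$; this
  makes *-homomorphisms contractive without any spectral theory. On the measurable side, a
  $\sigma$-normal character of $L^\infty(X)$ and a $\{0,1\}$-valued probability measure are the same as a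
  countably complete ultrafilter of measurable sets, along which every measurable function is
  constant. On a spectrum such an ultrafilter is always principal, since each axiom of a character involves
  only countably many elements. This gives idempotency and sobriety. If pure $\sigma$-states separate, they are
  characters, and the image of the counit is closed under bounded monotone limits and contains the indicator
  functions of all measurable sets, hence is everything.\<close>

section \<open>Commutative C*-algebras\<close>

text \<open>Normality concerns only norm-bounded sequences, while homomorphisms visibly respect only
  the algebraic operations and hence the order. So even the composition of two normal homomorphisms
  calls for a dictionary between norm and order. The one used is: for t \<ge> 0, a has norm at most
  t exactly when t^2 1 - a^* a has the form b^* b. It makes homomorphisms contractive, which also
  keeps transposed functions bounded; and it turns a bound valid at all characters into a norm
  bound, which is what the existence of suprema in the algebra demands. Its proof has to build
  square roots without presupposing that norm and order are compatible. Pure states are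
  multiplicative for a convexity reason: if x and 1 - x are positive with nonzero mass, then \<phi>
  is a mixture of the states y \<mapsto> \<phi>(x y) / \<phi>(x) and y \<mapsto> \<phi>((1 - x) y) /
  \<phi>(1 - x). Extremality makes both equal to \<phi>, so \<phi>(x y) = \<phi>(x)
  \<phi>(y).\<close>

context cring begin

text \<open>The algebras are records with an explicit carrier. The identities needed below are
  therefore proved by \<open>algebra\<close> for abstract commutative rings and carried over through
  \<open>cs_ring\<close>.\<close>

lemma square_diff_factor:
  assumes "x \<in> carrier R" "y \<in> carrier R"
  shows "(y \<ominus> x) \<otimes> (y \<oplus> x) = y \<otimes> y \<ominus> x \<otimes> x"
  using assms by algebra

lemma add_diff_add_left:
  assumes "q \<in> carrier R" "x \<in> carrier R" "y \<in> carrier R"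
  shows "(q \<oplus> y) \<ominus> (q \<oplus> x) = y \<ominus> x"
  using assms by algebra

lemma one_minus_square:
  assumes "s \<in> carrier R"
  shows "(\<one> \<ominus> s) \<otimes> (\<one> \<ominus> s) = \<one> \<ominus> ((s \<oplus> s) \<ominus> s \<otimes> s)"
  using assms by algebra

lemma diff_add_diff:
  assumes "x \<in> carrier R" "y \<in> carrier R" "z \<in> carrier R"
  shows "(x \<ominus> y) \<oplus> (y \<ominus> z) = x \<ominus> z"
  using assms by algebra

lemma add_add_diff:
  assumes "x \<in> carrier R" "y \<in> carrier R"
  shows "(x \<oplus> y) \<oplus> (x \<ominus> y) = x \<oplus> x"
  using assms by algebra

lemma diff_diff_self:
  assumes "x \<in> carrier R" "y \<in> carrier R"
  shows "x \<ominus> (x \<ominus> y) = y"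
  using assms by algebra

lemma add_diff_cancel_right:
  assumes "x \<in> carrier R" "y \<in> carrier R"
  shows "(x \<oplus> y) \<ominus> y = x"
  using assms by algebra

lemma diff_add_cancel_right:
  assumes "x \<in> carrier R" "y \<in> carrier R"
  shows "(x \<ominus> y) \<oplus> y = x"
  using assms by algebra

lemma add_diff_interchange:
  assumes "x \<in> carrier R" "y \<in> carrier R" "z \<in> carrier R" "w \<in> carrier R"
  shows "(x \<oplus> y) \<ominus> (z \<oplus> w) = (x \<ominus> z) \<oplus> (y \<ominus> w)"
  using assms by algebra
lemma mult_interchange:
  assumes "x \<in> carrier R" "y \<in> carrier R" "z \<in> carrier R" "w \<in> carrier R"
  shows "(x \<otimes> y) \<otimes> (z \<otimes> w) = (x \<otimes> z) \<otimes> (y \<otimes> w)"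
  using assms by algebra

end

definition cs_ring :: "'a cstar \<Rightarrow> 'a ring" where
  "cs_ring A = \<lparr>carrier = cs_carrier A, mult = cs_mult A, one = cs_one A,
      zero = cs_zero A, add = cs_add A\<rparr>"

locale comm_cstar =
  fixes A :: "'a cstar"
  assumes cstar: "cstar_alg A"
    and comm: "\<And>x y. x \<in> cs_carrier A \<Longrightarrow> y \<in> cs_carrier A \<Longrightarrow> cs_mult A x y = cs_mult A y x"
begin

abbreviation "C \<equiv> cs_carrier A"
abbreviation zero (\<open>\<^bold>0\<close>) where "\<^bold>0 \<equiv> cs_zero A"
abbreviation one (\<open>\<^bold>1\<close>) where "\<^bold>1 \<equiv> cs_one A"
abbreviation add (infixl \<open>\<^bold>+\<close> 65) where "x \<^bold>+ y \<equiv> cs_add A x y"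
abbreviation sub (infixl \<open>\<^bold>-\<close> 65) where "x \<^bold>- y \<equiv> cs_sub A x y"
abbreviation mult (infixl \<open>\<^bold>*\<close> 70) where "x \<^bold>* y \<equiv> cs_mult A x y"
abbreviation scale (infixr \<open>\<^bold>\<cdot>\<close> 75) where "c \<^bold>\<cdot> x \<equiv> cs_scale A c x"
abbreviation star where "star x \<equiv> cs_star A x"
abbreviation nrm where "nrm x \<equiv> cs_norm A x"
abbreviation sa where "sa x \<equiv> cs_selfadj A x"
abbreviation pos where "pos x \<equiv> cs_positive A x"

lemma
  shows zero_mem [simp]: "\<^bold>0 \<in> C" and one_mem [simp]: "\<^bold>1 \<in> C"
    and op_mem: "\<forall>x\<in>C. \<forall>y\<in>C. x \<^bold>+ y \<in> C \<and> x \<^bold>* y \<in> C"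
    and scale_mem_all: "\<forall>c. \<forall>x\<in>C. c \<^bold>\<cdot> x \<in> C"
    and star_mem_all: "\<forall>x\<in>C. star x \<in> C"
    and add_assoc_all: "\<forall>x\<in>C. \<forall>y\<in>C. \<forall>z\<in>C. x \<^bold>+ y \<^bold>+ z = x \<^bold>+ (y \<^bold>+ z)"
    and add_comm_all: "\<forall>x\<in>C. \<forall>y\<in>C. x \<^bold>+ y = y \<^bold>+ x"
    and zero_add_all: "\<forall>x\<in>C. \<^bold>0 \<^bold>+ x = x"
    and scale_add_all: "\<forall>c. \<forall>x\<in>C. \<forall>y\<in>C. c \<^bold>\<cdot> (x \<^bold>+ y) = c \<^bold>\<cdot> x \<^bold>+ c \<^bold>\<cdot> y"
    and add_scale_all: "\<forall>c d. \<forall>x\<in>C. (c + d) \<^bold>\<cdot> x = c \<^bold>\<cdot> x \<^bold>+ d \<^bold>\<cdot> x"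
    and scale_scale_all: "\<forall>c d. \<forall>x\<in>C. c \<^bold>\<cdot> d \<^bold>\<cdot> x = (c * d) \<^bold>\<cdot> x"
    and scale_one_all: "\<forall>x\<in>C. 1 \<^bold>\<cdot> x = x"
    and mult_assoc_all: "\<forall>x\<in>C. \<forall>y\<in>C. \<forall>z\<in>C. x \<^bold>* y \<^bold>* z = x \<^bold>* (y \<^bold>* z)"
    and one_mult_all: "\<forall>x\<in>C. \<^bold>1 \<^bold>* x = x \<and> x \<^bold>* \<^bold>1 = x"
    and mult_add_all: "\<forall>x\<in>C. \<forall>y\<in>C. \<forall>z\<in>C. x \<^bold>* (y \<^bold>+ z) = x \<^bold>* y \<^bold>+ x \<^bold>* z
      \<and> (y \<^bold>+ z) \<^bold>* x = y \<^bold>* x \<^bold>+ z \<^bold>* x"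
    and scale_mult_all: "\<forall>c. \<forall>x\<in>C. \<forall>y\<in>C. c \<^bold>\<cdot> (x \<^bold>* y) = (c \<^bold>\<cdot> x) \<^bold>* y
      \<and> c \<^bold>\<cdot> (x \<^bold>* y) = x \<^bold>* (c \<^bold>\<cdot> y)"
    and star_star_all: "\<forall>x\<in>C. star (star x) = x"
    and star_add_all: "\<forall>x\<in>C. \<forall>y\<in>C. star (x \<^bold>+ y) = star x \<^bold>+ star y"
    and star_scale_all: "\<forall>c. \<forall>x\<in>C. star (c \<^bold>\<cdot> x) = cnj c \<^bold>\<cdot> star x"
    and star_mult_all: "\<forall>x\<in>C. \<forall>y\<in>C. star (x \<^bold>* y) = star y \<^bold>* star x"
    and norm_eq_0_all: "\<forall>x\<in>C. nrm x = 0 \<longleftrightarrow> x = \<^bold>0"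
    and norm_add_all: "\<forall>x\<in>C. \<forall>y\<in>C. nrm (x \<^bold>+ y) \<le> nrm x + nrm y"
    and norm_scale_all: "\<forall>c. \<forall>x\<in>C. nrm (c \<^bold>\<cdot> x) = cmod c * nrm x"
    and norm_mult_all: "\<forall>x\<in>C. \<forall>y\<in>C. nrm (x \<^bold>* y) \<le> nrm x * nrm y"
    and norm_star_mult_all: "\<forall>x\<in>C. nrm (star x \<^bold>* x) = (nrm x)\<^sup>2"
  by (insert cstar, unfold cstar_alg_def, elim conjE, assumption)+

lemmas add_mem [simp] = op_mem[rule_format, THEN conjunct1]
  and mult_mem [simp] = op_mem[rule_format, THEN conjunct2]
  and scale_mem [simp] = scale_mem_all[rule_format]
  and star_mem [simp] = star_mem_all[rule_format]
  and add_assoc' = add_assoc_all[rule_format]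
  and add_comm' = add_comm_all[rule_format]
  and zero_add = zero_add_all[rule_format]
  and scale_add = scale_add_all[rule_format]
  and add_scale = add_scale_all[rule_format]
  and scale_scale [simp] = scale_scale_all[rule_format]
  and scale_one [simp] = scale_one_all[rule_format]
  and mult_assoc' = mult_assoc_all[rule_format]
  and one_mult [simp] = one_mult_all[rule_format, THEN conjunct1] one_mult_all[rule_format, THEN conjunct2]
  and mult_add = mult_add_all[rule_format, THEN conjunct2]
  and scale_mult_left = scale_mult_all[rule_format, THEN conjunct1, symmetric]
  and scale_mult_right = scale_mult_all[rule_format, THEN conjunct2, symmetric]
  and star_star [simp] = star_star_all[rule_format]
  and star_add = star_add_all[rule_format]
  and star_scale = star_scale_all[rule_format]
  and star_mult = star_mult_all[rule_format]
  and norm_eq_0 = norm_eq_0_all[rule_format]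
  and norm_add = norm_add_all[rule_format]
  and norm_scale [simp] = norm_scale_all[rule_format]
  and norm_mult = norm_mult_all[rule_format]
  and norm_star_mult = norm_star_mult_all[rule_format]

lemma complete:
  fixes u :: "nat \<Rightarrow> 'a"
  assumes "\<And>k. u k \<in> C" "\<And>\<epsilon>. \<epsilon> > 0 \<Longrightarrow> \<exists>N. \<forall>i\<ge>N. \<forall>j\<ge>N. nrm (u i \<^bold>- u j) < \<epsilon>"
  obtains l where "l \<in> C" "\<And>\<epsilon>. \<epsilon> > 0 \<Longrightarrow> \<exists>N. \<forall>i\<ge>N. nrm (u i \<^bold>- l) < \<epsilon>"
proof -
  from cstar have "\<forall>u::nat \<Rightarrow> 'a. (\<forall>k. u k \<in> C) \<and> (\<forall>\<epsilon>>0. \<exists>N. \<forall>i\<ge>N. \<forall>j\<ge>N. nrm (u i \<^bold>- u j) < \<epsilon>)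
        \<longrightarrow> (\<exists>l\<in>C. \<forall>\<epsilon>>0. \<exists>N. \<forall>i\<ge>N. nrm (u i \<^bold>- l) < \<epsilon>)"
    unfolding cstar_alg_def by (elim conjE) assumption
  from this[rule_format, of u] assms show thesis
    by (metis that)
qed

text \<open>The norm replaces the usual cancellation argument: an element of norm 0 is zero.\<close>

lemma zero_scale [simp]: assumes "x \<in> C" shows "0 \<^bold>\<cdot> x = \<^bold>0"
proof -
  have "nrm (0 \<^bold>\<cdot> x) = 0" using assms by simp
  then show ?thesis using assms norm_eq_0[of "0 \<^bold>\<cdot> x"] by simp
qed

lemma neg_add [simp]: assumes "x \<in> C" shows "(-1) \<^bold>\<cdot> x \<^bold>+ x = \<^bold>0"
  using add_scale[OF assms, of "-1" 1] assms by simp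

lemma zero_mult [simp]: "x \<in> C \<Longrightarrow> \<^bold>0 \<^bold>* x = \<^bold>0"
  using scale_mult_left[of "\<^bold>1" x 0] by simp

lemma add_zero [simp]: "x \<in> C \<Longrightarrow> x \<^bold>+ \<^bold>0 = x"
  using add_comm'[of x "\<^bold>0"] by (simp add: zero_add)

lemma cring_cs_ring: "cring (cs_ring A)"
proof (intro cringI abelian_groupI comm_monoidI)
  show "\<exists>y\<in>carrier (cs_ring A). y \<oplus>\<^bsub>cs_ring A\<^esub> x = \<zero>\<^bsub>cs_ring A\<^esub>" if "x \<in> carrier (cs_ring A)" for x
    using that by (intro bexI[of _ "(-1) \<^bold>\<cdot> x"]) (auto simp: cs_ring_def)
qed (simp_all add: cs_ring_def zero_add mult_assoc' add_assoc' mult_add, (rule add_comm' comm; assumption)+)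

lemma cs_ring_sel [simp]:
  "carrier (cs_ring A) = C" "monoid.mult (cs_ring A) = cs_mult A" "monoid.one (cs_ring A) = \<^bold>1"
  "ring.zero (cs_ring A) = \<^bold>0" "ring.add (cs_ring A) = cs_add A"
  by (simp_all add: cs_ring_def)

lemma a_minus_cs_ring: assumes "y \<in> C" shows "a_minus (cs_ring A) x y = x \<^bold>- y"
proof -
  interpret R: cring "cs_ring A" by (rule cring_cs_ring)
  have "a_inv (cs_ring A) y = (-1) \<^bold>\<cdot> y"
    using R.minus_equality[of "(-1) \<^bold>\<cdot> y" y] assms by simp
  then show ?thesis by (simp add: a_minus_def cs_sub_def)
qed

lemma sub_mem [simp]: "\<lbrakk>x \<in> C; y \<in> C\<rbrakk> \<Longrightarrow> x \<^bold>- y \<in> C"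
  by (simp add: cs_sub_def)

lemma
  assumes "x \<in> C" "y \<in> C"
  shows square_diff: "(y \<^bold>- x) \<^bold>* (y \<^bold>+ x) = y \<^bold>* y \<^bold>- x \<^bold>* x"
    and one_minus_sq: "(\<^bold>1 \<^bold>- x) \<^bold>* (\<^bold>1 \<^bold>- x) = \<^bold>1 \<^bold>- ((x \<^bold>+ x) \<^bold>- x \<^bold>* x)"
    and add_plus_diff: "(x \<^bold>+ y) \<^bold>+ (x \<^bold>- y) = x \<^bold>+ x"
    and sub_sub_self: "x \<^bold>- (x \<^bold>- y) = y"
    and add_sub: "(x \<^bold>+ y) \<^bold>- y = x"
    and sub_add: "(x \<^bold>- y) \<^bold>+ y = x"
  using cring.square_diff_factor[OF cring_cs_ring, of x y] cring.one_minus_square[OF cring_cs_ring, of x]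
    cring.add_add_diff[OF cring_cs_ring, of x y] cring.diff_diff_self[OF cring_cs_ring, of x y]
    cring.add_diff_cancel_right[OF cring_cs_ring, of x y] cring.diff_add_cancel_right[OF cring_cs_ring, of x y]
    assms
  by (simp_all add: a_minus_cs_ring)

lemma
  assumes "x \<in> C" "y \<in> C" "z \<in> C"
  shows add_sub_add_left: "(z \<^bold>+ y) \<^bold>- (z \<^bold>+ x) = y \<^bold>- x"
    and sub_add_sub: "(x \<^bold>- y) \<^bold>+ (y \<^bold>- z) = x \<^bold>- z"
  using cring.add_diff_add_left[OF cring_cs_ring, of z x y] cring.diff_add_diff[OF cring_cs_ring, of x y z] assms
  by (simp_all add: a_minus_cs_ring)

lemma
  assumes "x \<in> C" "y \<in> C" "z \<in> C" "w \<in> C"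
  shows add_sub_add: "(x \<^bold>+ y) \<^bold>- (z \<^bold>+ w) = (x \<^bold>- z) \<^bold>+ (y \<^bold>- w)"
    and mult_interchange: "(x \<^bold>* y) \<^bold>* (z \<^bold>* w) = (x \<^bold>* z) \<^bold>* (y \<^bold>* w)"
  using cring.add_diff_interchange[OF cring_cs_ring, of x y z w]
    cring.mult_interchange[OF cring_cs_ring, of x y z w] assms
  by (simp_all add: a_minus_cs_ring)

text \<open>Nonnegativity is not among the axioms; the triangle inequality for x and -x gives 0
  \<le> 2 \<open>nrm x\<close>.\<close>

lemma norm_nonneg: assumes "x \<in> C" shows "0 \<le> nrm x"
  using norm_add[of x "(-1) \<^bold>\<cdot> x"] add_comm'[of x "(-1) \<^bold>\<cdot> x"] norm_eq_0[of "\<^bold>0"] assms by simp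

text \<open>Only an inequality: in the zero algebra, which occurs as \<open>Linf X\<close> for an
  empty space, the unit has norm 0.\<close>

lemma norm_one_le: "nrm \<^bold>1 \<le> 1"
proof -
  have *: "star \<^bold>1 = \<^bold>1" using star_mult[of "star \<^bold>1" "\<^bold>1"] by simp
  then have "nrm \<^bold>1 = (nrm \<^bold>1)\<^sup>2" using norm_star_mult[of "\<^bold>1"] by simp
  then have "nrm \<^bold>1 = 0 \<or> nrm \<^bold>1 = 1" by (simp add: power2_eq_square)
  then show ?thesis by auto
qed

lemma sa_mem [simp]: "sa x \<Longrightarrow> x \<in> C" and sa_star: "sa x \<Longrightarrow> star x = x"
  by (auto simp: cs_selfadj_def)

lemma sa_one [simp]: "sa \<^bold>1"
  using star_mult[of "star \<^bold>1" "\<^bold>1"] unfolding cs_selfadj_def by simp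

lemma sa_add [simp]: "\<lbrakk>sa x; sa y\<rbrakk> \<Longrightarrow> sa (x \<^bold>+ y)"
  unfolding cs_selfadj_def by (simp add: star_add)

lemma sa_mult [simp]: "\<lbrakk>sa x; sa y\<rbrakk> \<Longrightarrow> sa (x \<^bold>* y)"
  unfolding cs_selfadj_def by (simp add: star_mult comm)

lemma sa_scale [simp]: "sa x \<Longrightarrow> sa (complex_of_real r \<^bold>\<cdot> x)"
  unfolding cs_selfadj_def by (simp add: star_scale)

lemma sa_sub [simp]: "\<lbrakk>sa x; sa y\<rbrakk> \<Longrightarrow> sa (x \<^bold>- y)"
  using sa_scale[of y "-1"] by (simp add: cs_sub_def)

lemma scale_sub: "\<lbrakk>x \<in> C; y \<in> C\<rbrakk> \<Longrightarrow> c \<^bold>\<cdot> (x \<^bold>- y) = c \<^bold>\<cdot> x \<^bold>- c \<^bold>\<cdot> y"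
  by (simp add: cs_sub_def scale_add)

lemma scale_diff: "x \<in> C \<Longrightarrow> (c - d) \<^bold>\<cdot> x = c \<^bold>\<cdot> x \<^bold>- d \<^bold>\<cdot> x"
  using add_scale[of x c "-d"] by (simp add: cs_sub_def)

lemma sub_self [simp]: "x \<in> C \<Longrightarrow> x \<^bold>- x = \<^bold>0"
  using scale_diff[of x 1 1] by simp

lemma scale_zero [simp]: "c \<^bold>\<cdot> \<^bold>0 = \<^bold>0"
  using scale_scale[of "\<^bold>0" c 0] by simp

lemma add_self: "x \<in> C \<Longrightarrow> x \<^bold>+ x = 2 \<^bold>\<cdot> x"
  using add_scale[of x 1 1] by simp

lemma norm_sub: "\<lbrakk>x \<in> C; y \<in> C\<rbrakk> \<Longrightarrow> nrm (x \<^bold>- y) \<le> nrm x + nrm y"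
  using norm_add[of x "(-1) \<^bold>\<cdot> y"] by (simp add: cs_sub_def)

lemma norm_sub_commute: assumes "x \<in> C" "y \<in> C" shows "nrm (x \<^bold>- y) = nrm (y \<^bold>- x)"
proof -
  have "(-1) \<^bold>\<cdot> (x \<^bold>- y) = y \<^bold>- x"
    using assms by (simp add: scale_sub) (simp add: cs_sub_def add_comm')
  then show ?thesis using norm_scale[of "x \<^bold>- y" "-1"] assms by simp
qed

lemma sub_eq_zeroD: assumes "x \<^bold>- y = \<^bold>0" "x \<in> C" "y \<in> C" shows "x = y"
  using sub_add[of x y] assms by (simp add: zero_add)

text \<open>The square root of $1-q$ is $1-s$ for the fixed point $s$ of $s \mapsto (q + s^2)/2$;
  the iteration is majorised by the corresponding real one with $q = 1$.\<close>

primrec sqrt_iter :: "'a \<Rightarrow> nat \<Rightarrow> 'a" where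
  "sqrt_iter q 0 = \<^bold>0"
| "sqrt_iter q (Suc n) = (1/2) \<^bold>\<cdot> (q \<^bold>+ sqrt_iter q n \<^bold>* sqrt_iter q n)"

end

primrec sqrt_iter_real :: "nat \<Rightarrow> real" where
  "sqrt_iter_real 0 = 0"
| "sqrt_iter_real (Suc n) = (1 + sqrt_iter_real n * sqrt_iter_real n) / 2"

lemma sqrt_iter_real_bounds: "0 \<le> sqrt_iter_real n \<and> sqrt_iter_real n \<le> 1"
proof (induction n)
  case (Suc n)
  then have "sqrt_iter_real n * sqrt_iter_real n \<le> 1 * 1" by (intro mult_mono) auto
  then show ?case by simp
qed simp

lemma incseq_sqrt_iter_real: "incseq sqrt_iter_real"
proof (rule incseq_SucI)
  fix n
  \<comment> \<open>Half of this square is the increment from n to n + 1.\<close>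
  have "0 \<le> (1 - sqrt_iter_real n)\<^sup>2" by simp
  then show "sqrt_iter_real n \<le> sqrt_iter_real (Suc n)"
    by (simp add: power2_eq_square algebra_simps)
qed

lemma Cauchy_sqrt_iter_real: "Cauchy sqrt_iter_real"
proof -
  have "bdd_above (range sqrt_iter_real)"
    using sqrt_iter_real_bounds by (auto simp: bdd_above_def)
  then show ?thesis
    using LIMSEQ_incseq_SUP[OF _ incseq_sqrt_iter_real] LIMSEQ_imp_Cauchy by blast
qed

section \<open>Convergence of the square root iteration\<close>

context comm_cstar begin

lemma sqrt_iter_mem [simp]: "q \<in> C \<Longrightarrow> sqrt_iter q n \<in> C"
  by (induction n) auto

lemma norm_sqrt_iter:
  assumes "q \<in> C" "nrm q \<le> 1" shows "nrm (sqrt_iter q n) \<le> sqrt_iter_real n"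
proof (induction n)
  case 0 then show ?case using norm_eq_0[of "\<^bold>0"] by simp
next
  case (Suc n)
  let ?s = "sqrt_iter q n"
  have "nrm (?s \<^bold>* ?s) \<le> sqrt_iter_real n * sqrt_iter_real n"
    using norm_mult[of ?s ?s] mult_mono[OF Suc Suc] sqrt_iter_real_bounds[of n] norm_nonneg[of ?s] assms by simp
  then show ?case using norm_add[of q "?s \<^bold>* ?s"] assms by simp
qed

lemma sqrt_step_diff:
  assumes "q \<in> C" "x \<in> C" "y \<in> C"
  shows "(1/2) \<^bold>\<cdot> (q \<^bold>+ y \<^bold>* y) \<^bold>- (1/2) \<^bold>\<cdot> (q \<^bold>+ x \<^bold>* x) = (1/2) \<^bold>\<cdot> ((y \<^bold>- x) \<^bold>* (y \<^bold>+ x))"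
  using assms by (simp add: scale_sub[symmetric] add_sub_add_left square_diff)

text \<open>Commutativity lets the difference of squares factorise. The estimate serves twice: for
  consecutive iterates it compares increments, and with the limit as x it shows that the limit is a
  fixed point.\<close>

lemma norm_sqrt_step_diff:
  assumes "q \<in> C" "x \<in> C" "y \<in> C" "nrm (y \<^bold>- x) \<le> d" "nrm x \<le> a" "nrm y \<le> b"
  shows "nrm ((1/2) \<^bold>\<cdot> (q \<^bold>+ y \<^bold>* y) \<^bold>- (1/2) \<^bold>\<cdot> (q \<^bold>+ x \<^bold>* x)) \<le> d * (b + a) / 2"
proof -
  have "nrm ((y \<^bold>- x) \<^bold>* (y \<^bold>+ x)) \<le> nrm (y \<^bold>- x) * nrm (y \<^bold>+ x)"
    using assms by (intro norm_mult) auto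
  also have "\<dots> \<le> d * (b + a)"
    using assms norm_add[of y x] norm_nonneg[of "y \<^bold>- x"] norm_nonneg[of "y \<^bold>+ x"] by (intro mult_mono) auto
  finally show ?thesis using assms by (simp add: sqrt_step_diff)
qed

text \<open>When q has norm 1 the iteration is not uniformly contracting, so there is no geometric
  rate. Instead the increments are dominated by the real ones, for which the estimate d (b + a) / 2
  holds with equality.\<close>

lemma norm_sqrt_iter_Suc_diff:
  assumes "q \<in> C" "nrm q \<le> 1"
  shows "nrm (sqrt_iter q (Suc n) \<^bold>- sqrt_iter q n) \<le> sqrt_iter_real (Suc n) - sqrt_iter_real n"
proof (induction n)
  case 0
  show ?case using norm_sqrt_iter[OF assms, of 1] assms
    by (simp add: cs_sub_def)
next
  case (Suc n)
  from norm_sqrt_step_diff[OF assms(1) _ _ Suc.IH norm_sqrt_iter[OF assms] norm_sqrt_iter[OF assms]]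
  have "nrm (sqrt_iter q (Suc (Suc n)) \<^bold>- sqrt_iter q (Suc n)) \<le>
    (sqrt_iter_real (Suc n) - sqrt_iter_real n) * (sqrt_iter_real (Suc n) + sqrt_iter_real n) / 2"
    using assms(1) by (simp del: sqrt_iter_real.simps)
  also have "\<dots> = sqrt_iter_real (Suc (Suc n)) - sqrt_iter_real (Suc n)"
    by (simp add: sqrt_iter_real.simps(2)[of "Suc n"] sqrt_iter_real.simps(2)[of n] del: sqrt_iter_real.simps)
       (simp add: field_simps)
  finally show ?case .
qed

lemma norm_sqrt_iter_diff:
  assumes "q \<in> C" "nrm q \<le> 1" "m \<le> n"
  shows "nrm (sqrt_iter q n \<^bold>- sqrt_iter q m) \<le> sqrt_iter_real n - sqrt_iter_real m"
  using assms(3)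
proof (induction n rule: dec_induct)
  case base then show ?case using assms norm_eq_0[of "\<^bold>0"] by simp
next
  case (step n)
  have "nrm (sqrt_iter q (Suc n) \<^bold>- sqrt_iter q m) \<le>
      nrm (sqrt_iter q (Suc n) \<^bold>- sqrt_iter q n) + nrm (sqrt_iter q n \<^bold>- sqrt_iter q m)"
    using sub_add_sub[of "sqrt_iter q (Suc n)" "sqrt_iter q n" "sqrt_iter q m"]
      norm_add[of "sqrt_iter q (Suc n) \<^bold>- sqrt_iter q n" "sqrt_iter q n \<^bold>- sqrt_iter q m"] assms
    by (simp del: sqrt_iter.simps)
  with step.IH norm_sqrt_iter_Suc_diff[OF assms(1,2), of n] show ?case
    by linarith
qed

lemma sa_sqrt_iter: "sa q \<Longrightarrow> sa (sqrt_iter q n)"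
proof (induction n)
  case 0 then show ?case using sa_scale[of q 0] by simp
next
  case (Suc n) then show ?case
    using sa_scale[of "q \<^bold>+ sqrt_iter q n \<^bold>* sqrt_iter q n" "1/2"] by simp
qed

text \<open>The C*-identity and submultiplicativity give (\<open>nrm x\<close>)^2 \<le>
  \<open>nrm (star x)\<close> \<open>nrm x\<close>; cancelling and then exchanging x with its
  adjoint yields both inequalities.\<close>

lemma norm_star: assumes "x \<in> C" shows "nrm (star x) = nrm x"
proof -
  have *: "nrm x \<le> nrm (star x)" if "x \<in> C" for x
  proof (cases "nrm x = 0")
    case False
    then have "0 < nrm x" using norm_nonneg[OF that] by simp
    moreover have "nrm x * nrm x \<le> nrm (star x) * nrm x"
      using norm_star_mult[OF that] norm_mult[of "star x" x] that by (simp add: power2_eq_square)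
    ultimately show ?thesis by simp
  qed (use that norm_nonneg in simp)
  from *[of x] *[of "star x"] assms show ?thesis by simp
qed

lemma star_sub: "\<lbrakk>x \<in> C; y \<in> C\<rbrakk> \<Longrightarrow> star (x \<^bold>- y) = star x \<^bold>- star y"
  by (simp add: cs_sub_def star_add star_scale)

lemma eq_if_norm_sub_small:
  assumes "x \<in> C" "y \<in> C" "\<And>\<epsilon>. \<epsilon> > 0 \<Longrightarrow> nrm (x \<^bold>- y) \<le> \<epsilon>" shows "x = y"
proof -
  have "nrm (x \<^bold>- y) \<le> 0" using assms(3) by (rule field_le_epsilon) simp
  then have "nrm (x \<^bold>- y) = 0" using norm_nonneg[of "x \<^bold>- y"] assms by simp
  then show ?thesis using assms norm_eq_0[of "x \<^bold>- y"] sub_eq_zeroD by simp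
qed

text \<open>The root is 1 - s, where s is the limit of the iteration. The bound on 1 - w is exported
  because it certifies that the root is itself positive in the sense of \<open>near_pos\<close>, and
  not merely self-adjoint.\<close>

lemma sqrt_one_minus:
  assumes q: "sa q" "nrm q \<le> 1"
  obtains w where "sa w" "w \<^bold>* w = \<^bold>1 \<^bold>- q" "nrm (\<^bold>1 \<^bold>- w) \<le> 1"
proof -
  have qC: "q \<in> C" using q by simp
  define u where "u = sqrt_iter q"
  have uC [simp]: "u n \<in> C" for n using qC by (simp add: u_def)
  have u_Suc: "u (Suc n) = (1/2) \<^bold>\<cdot> (q \<^bold>+ u n \<^bold>* u n)" for n by (simp add: u_def)
  have u1: "nrm (u n) \<le> 1" for n
    using norm_sqrt_iter[OF qC q(2), of n] sqrt_iter_real_bounds[of n] by (simp add: u_def)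
  have "\<exists>N. \<forall>i\<ge>N. \<forall>j\<ge>N. nrm (u i \<^bold>- u j) < \<epsilon>" if "\<epsilon> > 0" for \<epsilon>
  proof -
    from Cauchy_sqrt_iter_real that obtain N
      where N: "\<And>i j. \<lbrakk>i \<ge> N; j \<ge> N\<rbrakk> \<Longrightarrow> \<bar>sqrt_iter_real i - sqrt_iter_real j\<bar> < \<epsilon>"
      unfolding Cauchy_def dist_real_def by blast
    have "nrm (u i \<^bold>- u j) < \<epsilon>" if "i \<ge> N" "j \<ge> N" for i j
    proof (cases "i \<le> j")
      case True
      then show ?thesis
        using norm_sqrt_iter_diff[OF qC q(2) True] N[OF that] norm_sub_commute[of "u i" "u j"]
        by (simp add: u_def qC)
    next
      case False
      then show ?thesis
        using norm_sqrt_iter_diff[OF qC q(2), of j i] N[OF that] by (simp add: u_def)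
    qed
    then show ?thesis by blast
  qed
  then obtain s where sC [simp]: "s \<in> C" and lim: "\<And>\<epsilon>. \<epsilon> > 0 \<Longrightarrow> \<exists>N. \<forall>i\<ge>N. nrm (u i \<^bold>- s) < \<epsilon>"
    using complete[of u] uC by blast
  have s1: "nrm s \<le> 1"
  proof (rule field_le_epsilon)
    fix \<epsilon> :: real assume "\<epsilon> > 0"
    then obtain N where "nrm (u N \<^bold>- s) < \<epsilon>" using lim by blast
    then show "nrm s \<le> 1 + \<epsilon>"
      using norm_sub[of "u N" "u N \<^bold>- s"] u1[of N] by (simp add: sub_sub_self)
  qed
  have "star s = s"
  proof (rule eq_if_norm_sub_small)
    fix \<epsilon> :: real assume "\<epsilon> > 0"
    then obtain N where N: "nrm (u N \<^bold>- s) < \<epsilon> / 2" using lim[of "\<epsilon> / 2"] by auto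
    have "star (u N \<^bold>- s) = u N \<^bold>- star s"
      using sa_sqrt_iter[OF q(1), of N] by (simp add: star_sub sa_star u_def)
    then have "nrm (star s \<^bold>- u N) = nrm (u N \<^bold>- s)"
      using norm_star[of "u N \<^bold>- s"] norm_sub_commute[of "star s" "u N"] by simp
    then show "nrm (star s \<^bold>- s) \<le> \<epsilon>"
      using sub_add_sub[of "star s" "u N" s] norm_add[of "star s \<^bold>- u N" "u N \<^bold>- s"] N by simp
  qed auto
  then have sa_s: "sa s" unfolding cs_selfadj_def by simp
  \<comment> \<open>Both sides are compared with iterate N + 1: it is close to s, and it is close to
    the right-hand side because it is one step applied to iterate N.\<close>
  have fix_s: "s = (1/2) \<^bold>\<cdot> (q \<^bold>+ s \<^bold>* s)"
  proof (rule eq_if_norm_sub_small)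
    fix \<epsilon> :: real assume "\<epsilon> > 0"
    then obtain N where N: "\<And>i. i \<ge> N \<Longrightarrow> nrm (u i \<^bold>- s) < \<epsilon> / 2" using lim[of "\<epsilon> / 2"] by auto
    let ?t = "(1/2) \<^bold>\<cdot> (q \<^bold>+ s \<^bold>* s)"
    have "nrm (u (Suc N) \<^bold>- ?t) \<le> \<epsilon> / 2 * (1 + 1) / 2"
      unfolding u_Suc using N[of N] by (intro norm_sqrt_step_diff) (auto simp: qC s1 u1)
    moreover have "nrm (s \<^bold>- u (Suc N)) < \<epsilon> / 2"
      using N[of "Suc N"] norm_sub_commute[of s "u (Suc N)"] by simp
    ultimately show "nrm (s \<^bold>- ?t) \<le> \<epsilon>"
      using sub_add_sub[of s "u (Suc N)" ?t] norm_add[of "s \<^bold>- u (Suc N)" "u (Suc N) \<^bold>- ?t"] qC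
      by simp
  qed (auto simp: qC)
  have "s \<^bold>+ s = q \<^bold>+ s \<^bold>* s"
    using arg_cong[OF fix_s, of "\<lambda>x. 2 \<^bold>\<cdot> x"] qC by (simp add: add_self)
  then have "(\<^bold>1 \<^bold>- s) \<^bold>* (\<^bold>1 \<^bold>- s) = \<^bold>1 \<^bold>- q"
    using one_minus_sq[of s s] qC by (simp add: add_sub)
  moreover have "\<^bold>1 \<^bold>- (\<^bold>1 \<^bold>- s) = s" by (simp add: sub_sub_self)
  ultimately show thesis using that[of "\<^bold>1 \<^bold>- s"] sa_s s1 by simp
qed

section \<open>Positivity and its relation to the norm\<close>

lemma square_add_square:
  assumes "u \<in> C" "w \<in> C"
  shows "(u \<^bold>+ (-\<i>) \<^bold>\<cdot> w) \<^bold>* (u \<^bold>+ \<i> \<^bold>\<cdot> w) = u \<^bold>* u \<^bold>+ w \<^bold>* w"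
proof -
  have "(-\<i>) \<^bold>\<cdot> w = (-1) \<^bold>\<cdot> (\<i> \<^bold>\<cdot> w)" using assms by simp
  then have "u \<^bold>+ (-\<i>) \<^bold>\<cdot> w = u \<^bold>- \<i> \<^bold>\<cdot> w" by (simp only: cs_sub_def)
  moreover have "(\<i> \<^bold>\<cdot> w) \<^bold>* (\<i> \<^bold>\<cdot> w) = (-1) \<^bold>\<cdot> (w \<^bold>* w)"
    using assms by (simp add: scale_mult_left scale_mult_right)
  ultimately show ?thesis
    using square_diff[of "\<i> \<^bold>\<cdot> w" u] assms by (simp add: cs_sub_def)
qed

text \<open>U = u + \<i> w satisfies U^* U = u^2 + w^2, so the C*-identity bounds its norm, and u is
  its real part. This stands in for monotonicity of the norm on positive elements, which is not yet
  at hand.\<close>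

lemma norm_le_of_squares:
  assumes "sa u" "sa w" "0 \<le> t" "u \<^bold>* u \<^bold>+ w \<^bold>* w = complex_of_real (t\<^sup>2) \<^bold>\<cdot> \<^bold>1"
  shows "nrm u \<le> t"
proof -
  define U where "U = u \<^bold>+ \<i> \<^bold>\<cdot> w"
  have [simp]: "u \<in> C" "w \<in> C" "U \<in> C" using assms by (auto simp: U_def)
  have sU: "star U = u \<^bold>+ (-\<i>) \<^bold>\<cdot> w"
    using assms by (simp add: U_def star_add star_scale sa_star)
  have "(nrm U)\<^sup>2 = t\<^sup>2 * nrm \<^bold>1"
    using norm_star_mult[of U] square_add_square[of u w] assms(4) unfolding sU
    by (simp add: U_def norm_power)
  also have "\<dots> \<le> t\<^sup>2" using norm_one_le by (simp add: mult_left_le)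
  finally have "nrm U \<le> t" using assms(3) power2_le_imp_le by blast
  moreover have "U \<^bold>+ star U = 2 \<^bold>\<cdot> u"
    using add_plus_diff[of u "\<i> \<^bold>\<cdot> w"] by (simp add: U_def sU[unfolded U_def] cs_sub_def add_self)
  ultimately show ?thesis
    using norm_add[of U "star U"] norm_star[of U] by simp
qed

text \<open>In spectral terms: p is self-adjoint with spectrum in [0, 2t]. In this form sums are
  handled by the triangle inequality, whereas closure under sums is not apparent for elements of the
  form b^* b.\<close>

definition near_pos :: "'a \<Rightarrow> bool" where
  "near_pos p \<longleftrightarrow> sa p \<and> (\<exists>t\<ge>0. nrm (complex_of_real t \<^bold>\<cdot> \<^bold>1 \<^bold>- p) \<le> t)"

lemma near_pos_add:
  assumes "near_pos p" "near_pos r" shows "near_pos (p \<^bold>+ r)"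
proof -
  from assms obtain t t' where t: "t \<ge> 0" "nrm (complex_of_real t \<^bold>\<cdot> \<^bold>1 \<^bold>- p) \<le> t"
    "t' \<ge> 0" "nrm (complex_of_real t' \<^bold>\<cdot> \<^bold>1 \<^bold>- r) \<le> t'" and [simp]: "sa p" "sa r"
    by (auto simp: near_pos_def)
  have "complex_of_real (t + t') \<^bold>\<cdot> \<^bold>1 \<^bold>- (p \<^bold>+ r) =
      (complex_of_real t \<^bold>\<cdot> \<^bold>1 \<^bold>- p) \<^bold>+ (complex_of_real t' \<^bold>\<cdot> \<^bold>1 \<^bold>- r)"
    by (simp add: add_scale add_sub_add)
  then have "nrm (complex_of_real (t + t') \<^bold>\<cdot> \<^bold>1 \<^bold>- (p \<^bold>+ r)) \<le> t + t'"
    using norm_add[of "complex_of_real t \<^bold>\<cdot> \<^bold>1 \<^bold>- p" "complex_of_real t' \<^bold>\<cdot> \<^bold>1 \<^bold>- r"] t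
    by simp
  then show ?thesis unfolding near_pos_def using t(1,3)
    by (intro conjI exI[of _ "t + t'"]) auto
qed

text \<open>For t > 0 one has p = t (1 - q) with q of norm at most 1, so the root is that of 1 - q
  scaled by the root of t. For t = 0 the norm condition forces p = 0.\<close>

lemma near_pos_sqrt:
  assumes "near_pos p" obtains w where "near_pos w" "w \<^bold>* w = p"
proof -
  from assms obtain t where t: "t \<ge> 0" "nrm (complex_of_real t \<^bold>\<cdot> \<^bold>1 \<^bold>- p) \<le> t" and p: "sa p"
    by (auto simp: near_pos_def)
  show thesis
  proof (cases "t = 0")
    case True
    then have "nrm (\<^bold>0 \<^bold>- p) = 0" using t p norm_nonneg[of "\<^bold>0 \<^bold>- p"] by simp
    then have p0: "p = \<^bold>0" using norm_eq_0[of "\<^bold>0 \<^bold>- p"] sub_eq_zeroD[of "\<^bold>0" p] p by simp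
    have "\<^bold>0 \<^bold>* \<^bold>0 = \<^bold>0" by (simp add: zero_mult)
    then show thesis using that[of "\<^bold>0"] p0 assms by simp
  next
    case False
    with t have tp: "t > 0" by simp
    define q where "q = \<^bold>1 \<^bold>- complex_of_real (1/t) \<^bold>\<cdot> p"
    have "sa q" using p unfolding q_def by (intro sa_sub sa_one sa_scale)
    have "complex_of_real t \<^bold>\<cdot> q = complex_of_real t \<^bold>\<cdot> \<^bold>1 \<^bold>- p"
      using p tp by (simp add: q_def scale_sub)
    then have "t * nrm q \<le> t" using t norm_scale[of q "complex_of_real t"] \<open>sa q\<close> by simp
    then have "nrm q \<le> 1" using tp by simp
    then obtain w where w: "sa w" "w \<^bold>* w = \<^bold>1 \<^bold>- q" "nrm (\<^bold>1 \<^bold>- w) \<le> 1"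
      using sqrt_one_minus[OF \<open>sa q\<close>] by blast
    let ?r = "complex_of_real (sqrt t)"
    have "?r \<^bold>\<cdot> \<^bold>1 \<^bold>- ?r \<^bold>\<cdot> w = ?r \<^bold>\<cdot> (\<^bold>1 \<^bold>- w)"
      using w by (simp add: scale_sub)
    then have "nrm (?r \<^bold>\<cdot> \<^bold>1 \<^bold>- ?r \<^bold>\<cdot> w) \<le> sqrt t"
      using w tp by (simp add: mult_left_le)
    then have "near_pos (?r \<^bold>\<cdot> w)" unfolding near_pos_def using w tp
      by (intro conjI sa_scale exI[of _ "sqrt t"]) auto
    moreover have "(?r \<^bold>\<cdot> w) \<^bold>* (?r \<^bold>\<cdot> w) = p"
    proof -
      have "?r * ?r = complex_of_real t" using tp by (simp flip: of_real_mult)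
      moreover have "\<^bold>1 \<^bold>- q = complex_of_real (1/t) \<^bold>\<cdot> p"
        using p by (simp add: q_def sub_sub_self)
      ultimately show ?thesis using w p tp by (simp add: scale_mult_left scale_mult_right)
    qed
    ultimately show thesis using that by blast
  qed
qed

text \<open>For a contraction v the triangle inequality alone bounds 1 - v^2 by 2. Writing 1 - v^2
  as a square w^2 and using w^2 + v^2 = 1 shows that w is a contraction, which improves the bound to
  1.\<close>

lemma near_pos_square:
  assumes "sa u" shows "near_pos (u \<^bold>* u)"
proof -
  \<comment> \<open>The added 1 keeps r positive when u is zero.\<close>
  define r where "r = nrm u + 1"
  have rp: "r > 0" using assms norm_nonneg[of u] by (simp add: r_def add_nonneg_pos)
  define v where "v = complex_of_real (1/r) \<^bold>\<cdot> u"
  have v: "sa v" using assms unfolding v_def by (intro sa_scale)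
  then have v': "v \<in> C" by simp
  have v1: "nrm v \<le> 1" using rp assms by (simp add: v_def norm_divide r_def)
  have "nrm (v \<^bold>* v) \<le> 1"
    using norm_mult[of v v] v v1 mult_mono[OF v1 v1] norm_nonneg[of v] by simp
  then obtain w where w: "sa w" "w \<^bold>* w = \<^bold>1 \<^bold>- v \<^bold>* v"
    using sqrt_one_minus[of "v \<^bold>* v"] v by auto
  have "w \<^bold>* w \<^bold>+ v \<^bold>* v = complex_of_real (1\<^sup>2) \<^bold>\<cdot> \<^bold>1"
    using w v by (simp add: sub_add)
  then have w1: "nrm w \<le> 1" using norm_le_of_squares[of w v 1] w v by simp
  then have "nrm (w \<^bold>* w) \<le> 1"
    using norm_mult[of w w] w mult_mono[OF w1 w1] norm_nonneg[of w] by simp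
  then have "nrm (\<^bold>1 \<^bold>- v \<^bold>* v) \<le> 1" using w by simp
  moreover have "complex_of_real (r\<^sup>2) \<^bold>\<cdot> \<^bold>1 \<^bold>- u \<^bold>* u = complex_of_real (r\<^sup>2) \<^bold>\<cdot> (\<^bold>1 \<^bold>- v \<^bold>* v)"
    using assms rp by (simp add: v_def scale_sub scale_mult_left scale_mult_right power2_eq_square)
  ultimately have "nrm (complex_of_real (r\<^sup>2) \<^bold>\<cdot> \<^bold>1 \<^bold>- u \<^bold>* u) \<le> r\<^sup>2"
    using v by (simp add: mult_left_le norm_power)
  then show ?thesis unfolding near_pos_def using assms
    by (intro conjI exI[of _ "r\<^sup>2"]) auto
qed

lemma decompose:
  assumes "b \<in> C"
  obtains u v where "sa u" "sa v" "b = u \<^bold>+ \<i> \<^bold>\<cdot> v" "star b = u \<^bold>+ (-\<i>) \<^bold>\<cdot> v"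
proof -
  define u where "u = (1/2) \<^bold>\<cdot> (b \<^bold>+ star b)"
  define v where "v = (-\<i>/2) \<^bold>\<cdot> (b \<^bold>- star b)"
  have "sa u" using assms unfolding cs_selfadj_def by (simp add: u_def star_scale star_add add_comm'[of "star b" b])
  moreover have sv: "sa v"
    using assms unfolding cs_selfadj_def by (simp add: v_def star_scale star_sub scale_sub)
      (simp add: cs_sub_def add_comm'[of "(\<i> / 2) \<^bold>\<cdot> star b" "- (\<i> / 2) \<^bold>\<cdot> b"])
  moreover have b: "b = u \<^bold>+ \<i> \<^bold>\<cdot> v"
  proof -
    have "\<i> \<^bold>\<cdot> v = (1/2) \<^bold>\<cdot> (b \<^bold>- star b)" using assms by (simp add: v_def)
    then have "u \<^bold>+ \<i> \<^bold>\<cdot> v = (1/2) \<^bold>\<cdot> ((b \<^bold>+ star b) \<^bold>+ (b \<^bold>- star b))"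
      using assms by (simp add: u_def scale_add)
    then show ?thesis using assms by (simp add: add_plus_diff add_self)
  qed
  moreover have "star b = u \<^bold>+ (-\<i>) \<^bold>\<cdot> v"
    using \<open>sa u\<close> sv by (subst b) (simp add: star_add star_scale sa_star)
  ultimately show thesis using that by blast
qed

text \<open>With b = u + \<i> v and commuting self-adjoint u and v, the product b^* b becomes u^2 +
  v^2, a sum of two \<open>near_pos\<close> elements. Conversely a self-adjoint root w serves as
  b.\<close>

lemma pos_iff_near_pos: "pos p \<longleftrightarrow> near_pos p"
proof
  assume "pos p"
  then obtain b where b: "b \<in> C" "p = star b \<^bold>* b" by (auto simp: cs_positive_def)
  from decompose[OF b(1)] obtain u v where uv: "sa u" "sa v" "b = u \<^bold>+ \<i> \<^bold>\<cdot> v"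
    "star b = u \<^bold>+ (-\<i>) \<^bold>\<cdot> v" by blast
  have "p = u \<^bold>* u \<^bold>+ v \<^bold>* v"
    unfolding b(2) uv(4) by (subst uv(3)) (use uv in \<open>simp add: square_add_square\<close>)
  then show "near_pos p" using near_pos_add near_pos_square uv by simp
next
  assume p: "near_pos p"
  then obtain w where "near_pos w" "w \<^bold>* w = p" using near_pos_sqrt by blast
  then show "pos p" unfolding cs_positive_def
    by (intro conjI bexI[of _ w]) (auto simp: near_pos_def sa_star)
qed

lemma pos_sa: "pos p \<Longrightarrow> sa p" by (simp add: pos_iff_near_pos near_pos_def)

lemma pos_mem [simp]: "pos p \<Longrightarrow> p \<in> C" by (simp add: cs_positive_def)

lemma pos_sqrt: assumes "pos p" obtains w where "pos w" "w \<^bold>* w = p"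
  using near_pos_sqrt assms by (auto simp: pos_iff_near_pos)

lemma pos_star_mult: "b \<in> C \<Longrightarrow> pos (star b \<^bold>* b)"
  unfolding cs_positive_def by (intro conjI bexI[of _ b] refl) simp_all

lemma pos_mult: assumes "pos p" "pos r" shows "pos (p \<^bold>* r)"
proof -
  from assms obtain v w where "pos v" "v \<^bold>* v = p" "pos w" "w \<^bold>* w = r"
    using pos_sqrt by metis
  then have "star (v \<^bold>* w) \<^bold>* (v \<^bold>* w) = p \<^bold>* r" and "v \<^bold>* w \<in> C"
    using mult_interchange[of v w v w] sa_mult[OF pos_sa pos_sa, of v w] by (auto simp: sa_star)
  then show ?thesis using pos_star_mult by metis
qed

lemma pos_of_norm_le:
  assumes "sa a" "nrm a \<le> t" shows "pos (complex_of_real t \<^bold>\<cdot> \<^bold>1 \<^bold>- a)"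
proof -
  have "0 \<le> t" using norm_nonneg[of a] assms by simp
  then show ?thesis unfolding pos_iff_near_pos near_pos_def
    using assms sa_scale[OF sa_one] by (intro conjI exI[of _ t]) (auto simp: sub_sub_self)
qed

lemma pos_of_norm_le':
  assumes "sa a" "nrm a \<le> t" shows "pos (complex_of_real t \<^bold>\<cdot> \<^bold>1 \<^bold>+ a)"
  using pos_of_norm_le[of "complex_of_real (-1) \<^bold>\<cdot> a" t] assms sa_scale[OF assms(1), of "-1"]
  by (simp add: cs_sub_def)

text \<open>Together with \<open>norm_le_if_pos\<close> this expresses the norm through operations
  and positivity alone, both of which homomorphisms preserve.\<close>

lemma pos_norm_square_minus:
  assumes "a \<in> C" "nrm a \<le> t" shows "pos (complex_of_real (t\<^sup>2) \<^bold>\<cdot> \<^bold>1 \<^bold>- star a \<^bold>* a)"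
proof (rule pos_of_norm_le)
  show "sa (star a \<^bold>* a)" using pos_sa pos_star_mult assms by blast
  show "nrm (star a \<^bold>* a) \<le> t\<^sup>2" using assms by (simp add: norm_star_mult power_mono norm_nonneg)
qed

text \<open>As a need not be self-adjoint, it is replaced by u, the root of a^* a. Then u^2 + w^2 =
  t^2 1 bounds u, and the C*-identity carries the bound back to a.\<close>

lemma norm_le_if_pos:
  assumes "a \<in> C" "0 \<le> t" "pos (complex_of_real (t\<^sup>2) \<^bold>\<cdot> \<^bold>1 \<^bold>- star a \<^bold>* a)"
  shows "nrm a \<le> t"
proof -
  from pos_sqrt[OF assms(3)] pos_sqrt[OF pos_star_mult[OF assms(1)]] obtain w u
    where w: "pos w" "w \<^bold>* w = complex_of_real (t\<^sup>2) \<^bold>\<cdot> \<^bold>1 \<^bold>- star a \<^bold>* a"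
      and u: "pos u" "u \<^bold>* u = star a \<^bold>* a" by metis
  have "u \<^bold>* u \<^bold>+ w \<^bold>* w = complex_of_real (t\<^sup>2) \<^bold>\<cdot> \<^bold>1"
    unfolding u(2) w(2) using assms(1) add_comm' sub_add by simp
  then have "nrm u \<le> t" using norm_le_of_squares u w pos_sa assms by blast
  moreover have "(nrm a)\<^sup>2 \<le> (nrm u)\<^sup>2"
    using norm_star_mult[OF assms(1)] norm_mult[of u u] u by (simp add: power2_eq_square)
  ultimately show ?thesis using u norm_nonneg[of u] power2_le_imp_le by fastforce
qed

text \<open>The product of the two positive elements is t^2 1 - a^2. In this form the norm of a
  self-adjoint element can later be bounded by testing its values on characters.\<close>

lemma norm_le_if_bounds:
  assumes "sa a" "0 \<le> t" "pos (complex_of_real t \<^bold>\<cdot> \<^bold>1 \<^bold>- a)" "pos (complex_of_real t \<^bold>\<cdot> \<^bold>1 \<^bold>+ a)"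
  shows "nrm a \<le> t"
proof (rule norm_le_if_pos)
  have "(complex_of_real t \<^bold>\<cdot> \<^bold>1 \<^bold>- a) \<^bold>* (complex_of_real t \<^bold>\<cdot> \<^bold>1 \<^bold>+ a) =
      complex_of_real (t\<^sup>2) \<^bold>\<cdot> \<^bold>1 \<^bold>- star a \<^bold>* a"
    using assms(1) square_diff[of a "complex_of_real t \<^bold>\<cdot> \<^bold>1"]
    by (simp add: scale_mult_left scale_mult_right sa_star power2_eq_square)
  then show "pos (complex_of_real (t\<^sup>2) \<^bold>\<cdot> \<^bold>1 \<^bold>- star a \<^bold>* a)"
    using pos_mult[OF assms(3,4)] by simp
qed (use assms in auto)

end

section \<open>Bounded measurable functions\<close>

lemma complex_cs_sel [simp]:
  "cs_carrier complex_cs = UNIV" "cs_zero complex_cs = 0" "cs_one complex_cs = 1"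
  "cs_add complex_cs = (+)" "cs_mult complex_cs = (*)" "cs_scale complex_cs = (*)"
  "cs_star complex_cs = cnj" "cs_norm complex_cs = cmod"
  by (simp_all add: complex_cs_def)

lemma Linf_sel [simp]:
  "cs_carrier (Linf X) = Linf_set X" "cs_zero (Linf X) = (\<lambda>x. 0)"
  "cs_one (Linf X) = (\<lambda>x. if x \<in> space X then 1 else 0)"
  "cs_add (Linf X) = (\<lambda>f g x. f x + g x)" "cs_mult (Linf X) = (\<lambda>f g x. f x * g x)"
  "cs_scale (Linf X) = (\<lambda>c f x. c * f x)" "cs_star (Linf X) = (\<lambda>f x. cnj (f x))"
  "cs_norm (Linf X) = (\<lambda>f. SUP x. cmod (f x))"
  by (simp_all add: Linf_def)

lemma cs_positive_complex: "cs_positive complex_cs z \<longleftrightarrow> Im z = 0 \<and> 0 \<le> Re z"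
proof
  assume "cs_positive complex_cs z"
  then show "Im z = 0 \<and> 0 \<le> Re z" by (auto simp: cs_positive_def)
next
  assume z: "Im z = 0 \<and> 0 \<le> Re z"
  then have "z = cnj (complex_of_real (sqrt (Re z))) * complex_of_real (sqrt (Re z))"
    by (simp add: complex_eq_iff)
  then show "cs_positive complex_cs z" unfolding cs_positive_def complex_cs_sel by blast
qed

lemma cs_selfadj_complex: "cs_selfadj complex_cs z \<longleftrightarrow> Im z = 0"
  by (auto simp: cs_selfadj_def complex_eq_iff)

lemma cs_le_complex: "cs_le complex_cs x y \<longleftrightarrow> Im x = 0 \<and> Im y = 0 \<and> Re x \<le> Re y"
  by (auto simp: cs_le_def cs_selfadj_complex cs_positive_complex cs_sub_def)

lemma cs_is_sup_complex:
  "cs_is_sup complex_cs a s \<longleftrightarrow> Im s = 0 \<and> (\<forall>k. Im (a k) = 0 \<and> Re (a k) \<le> Re s) \<and>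
     (\<forall>r. (\<forall>k. Re (a k) \<le> r) \<longrightarrow> Re s \<le> r)" (is "?L \<longleftrightarrow> ?R")
proof
  assume L: ?L
  show ?R
  proof (intro conjI allI impI)
    fix r assume "\<forall>k. Re (a k) \<le> r"
    then show "Re s \<le> r" using L
      by (auto simp: cs_is_sup_def cs_le_complex cs_selfadj_complex dest!: spec[of _ "complex_of_real r"])
  qed (use L in \<open>auto simp: cs_is_sup_def cs_le_complex cs_selfadj_complex\<close>)
next
  assume ?R then show ?L
    by (auto simp: cs_is_sup_def cs_le_complex cs_selfadj_complex)
qed

text \<open>For increasing real sequences the order-theoretic supremum is the limit; normality of a
  character can thus be exploited through uniqueness of limits.\<close>

lemma cs_is_sup_complex_incseq:
  assumes "\<And>k. Im (a k) = 0" "Im s = 0" "\<And>k. Re (a k) \<le> Re (a (Suc k))"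
  shows "cs_is_sup complex_cs a s \<longleftrightarrow> a \<longlonglongrightarrow> s"
proof -
  have inc: "incseq (\<lambda>k. Re (a k))" using assms(3) by (rule incseq_SucI)
  have *: "a \<longlonglongrightarrow> s \<longleftrightarrow> (\<lambda>k. Re (a k)) \<longlonglongrightarrow> Re s"
    using assms by (simp add: tendsto_complex_iff)
  show ?thesis
  proof
    assume L: "cs_is_sup complex_cs a s"
    have bdd: "bdd_above (range (\<lambda>k. Re (a k)))"
      using L by (auto simp: cs_is_sup_complex bdd_above_def)
    have "Re s = (SUP k. Re (a k))"
      using L cSUP_upper[OF UNIV_I bdd]
      by (intro order_antisym) (auto simp: cs_is_sup_complex intro!: cSUP_least)
    with bdd show "a \<longlonglongrightarrow> s" using LIMSEQ_incseq_SUP[OF _ inc] * by simp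
  next
    assume "a \<longlonglongrightarrow> s"
    then have l: "(\<lambda>k. Re (a k)) \<longlonglongrightarrow> Re s" using * by simp
    then show "cs_is_sup complex_cs a s"
      using assms incseq_le[OF inc l] LIMSEQ_le_const2[OF l] by (auto simp: cs_is_sup_complex)
  qed
qed

lemma cs_is_sup_complex_const: "Im c = 0 \<Longrightarrow> cs_is_sup complex_cs (\<lambda>k. c) c"
  by (auto simp: cs_is_sup_complex)

section \<open>The C*-algebra of bounded measurable functions\<close>

lemma Linf_set_iff:
  "f \<in> Linf_set X \<longleftrightarrow> f \<in> borel_measurable X \<and> (\<exists>M. \<forall>x. cmod (f x) \<le> M) \<and> (\<forall>x. x \<notin> space X \<longrightarrow> f x = 0)"
proof -
  have "\<exists>M. \<forall>x. cmod (f x) \<le> M"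
    if b: "bounded (f ` space X)" and z: "\<And>x. x \<notin> space X \<Longrightarrow> f x = 0"
  proof -
    from b obtain M where M: "\<And>x. x \<in> space X \<Longrightarrow> cmod (f x) \<le> M" by (auto simp: bounded_iff)
    \<comment> \<open>On an empty space M may be negative, while f is 0 everywhere; hence the
      maximum.\<close>
    have "cmod (f x) \<le> max M 0" for x
      using M[of x] z[of x] by (cases "x \<in> space X") auto
    then show ?thesis by blast
  qed
  then show ?thesis by (auto simp: Linf_set_def bounded_iff)
qed

lemma Linf_set_measurable: "f \<in> Linf_set X \<Longrightarrow> f \<in> borel_measurable X"
  and Linf_set_bounded: "f \<in> Linf_set X \<Longrightarrow> \<exists>M. \<forall>x. cmod (f x) \<le> M"
  and Linf_set_outside: "f \<in> Linf_set X \<Longrightarrow> x \<notin> space X \<Longrightarrow> f x = 0"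
  by (auto simp: Linf_set_iff)

lemma Linf_setI:
  assumes "f \<in> borel_measurable X" "\<And>x. cmod (f x) \<le> M" "\<And>x. x \<notin> space X \<Longrightarrow> f x = 0"
  shows "f \<in> Linf_set X"
  using assms by (auto simp: Linf_set_iff)

lemma Linf_set_zero [simp]: "(\<lambda>x. 0) \<in> Linf_set X"
  by (rule Linf_setI[where M = 0]) auto

lemma Linf_set_one [simp]: "(\<lambda>x. if x \<in> space X then 1 else 0) \<in> Linf_set X"
proof (rule Linf_setI[where M = 1])
  show "(\<lambda>x. if x \<in> space X then 1 else 0::complex) \<in> borel_measurable X"
    by (subst measurable_cong[where g = "\<lambda>_. 1"]) auto
qed auto

lemma Linf_set_add [simp]: "\<lbrakk>f \<in> Linf_set X; g \<in> Linf_set X\<rbrakk> \<Longrightarrow> (\<lambda>x. f x + g x) \<in> Linf_set X"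
proof -
  assume fg: "f \<in> Linf_set X" "g \<in> Linf_set X"
  then obtain M N where "\<And>x. cmod (f x) \<le> M" "\<And>x. cmod (g x) \<le> N" by (meson Linf_set_bounded)
  then have "cmod (f x + g x) \<le> M + N" for x by (meson norm_triangle_mono)
  then show ?thesis using fg by (auto simp: Linf_set_iff)
qed

lemma Linf_set_mult [simp]: "\<lbrakk>f \<in> Linf_set X; g \<in> Linf_set X\<rbrakk> \<Longrightarrow> (\<lambda>x. f x * g x) \<in> Linf_set X"
proof -
  assume fg: "f \<in> Linf_set X" "g \<in> Linf_set X"
  then obtain M N where MN: "\<And>x. cmod (f x) \<le> M" "\<And>x. cmod (g x) \<le> N" by (meson Linf_set_bounded)
  have "cmod (f x * g x) \<le> M * N" for x
    unfolding norm_mult using MN[of x] order_trans[OF norm_ge_zero MN(1)] by (intro mult_mono) auto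
  then show ?thesis using fg by (auto simp: Linf_set_iff)
qed

lemma Linf_set_scale [simp]: "f \<in> Linf_set X \<Longrightarrow> (\<lambda>x. c * f x) \<in> Linf_set X"
proof -
  assume f: "f \<in> Linf_set X"
  then obtain M where "\<And>x. cmod (f x) \<le> M" by (meson Linf_set_bounded)
  then have "cmod (c * f x) \<le> cmod c * M" for x by (simp add: norm_mult mult_left_mono)
  then show ?thesis using f by (auto simp: Linf_set_iff)
qed

lemma borel_measurable_cnj: "f \<in> borel_measurable M \<Longrightarrow> (\<lambda>x. cnj (f x)) \<in> borel_measurable M"
  by (rule borel_measurable_continuous_on[OF continuous_on_cnj[OF continuous_on_id]])

lemma Linf_set_cnj [simp]: "f \<in> Linf_set X \<Longrightarrow> (\<lambda>x. cnj (f x)) \<in> Linf_set X"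
  by (auto simp: Linf_set_iff borel_measurable_cnj)

lemma norm_le_Linf_norm: "f \<in> Linf_set X \<Longrightarrow> cmod (f x) \<le> (SUP x. cmod (f x))"
  using Linf_set_bounded[of f X] by (intro cSUP_upper) (auto simp: bdd_above_def)

lemma Linf_norm_le: "(\<And>x. cmod (f x) \<le> M) \<Longrightarrow> (SUP x. cmod (f x)) \<le> M"
  by (rule cSUP_least) auto

lemma Linf_norm_nonneg: "f \<in> Linf_set X \<Longrightarrow> 0 \<le> (SUP x. cmod (f x))"
  using norm_le_Linf_norm[of f X undefined] norm_ge_zero[of "f undefined"] by linarith

lemma Linf_complete:
  assumes u: "\<And>k::nat. u k \<in> Linf_set X"
    and cau: "\<And>\<epsilon>. \<epsilon> > 0 \<Longrightarrow> \<exists>N. \<forall>i\<ge>N. \<forall>j\<ge>N. (SUP x. cmod (u i x - u j x)) < \<epsilon>"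
  shows "\<exists>l\<in>Linf_set X. \<forall>\<epsilon>>0. \<exists>N. \<forall>i\<ge>N. (SUP x. cmod (u i x - l x)) < \<epsilon>"
proof -
  have sub: "(\<lambda>x. u i x - u j x) \<in> Linf_set X" for i j
    using Linf_set_add[OF u[of i] Linf_set_scale[OF u[of j], of "-1"]] by simp
  have cau': "\<exists>N. \<forall>i\<ge>N. \<forall>j\<ge>N. \<forall>x. cmod (u i x - u j x) < \<epsilon>" if "\<epsilon> > 0" for \<epsilon>
    using cau[OF that] norm_le_Linf_norm[OF sub] by (meson le_less_trans)
  define l where "l x = lim (\<lambda>k. u k x)" for x
  have "Cauchy (\<lambda>k. u k x)" for x
    using cau' unfolding Cauchy_def dist_norm by blast
  then have lim: "(\<lambda>k. u k x) \<longlonglongrightarrow> l x" for x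
    using convergent_LIMSEQ_iff Cauchy_convergent by (auto simp: l_def)
  have near: "\<exists>N. \<forall>i\<ge>N. \<forall>x. cmod (u i x - l x) \<le> \<epsilon>" if e: "\<epsilon> > 0" for \<epsilon>
  proof -
    from cau'[OF e] obtain N where N: "\<And>i j x. \<lbrakk>i \<ge> N; j \<ge> N\<rbrakk> \<Longrightarrow> cmod (u i x - u j x) < \<epsilon>" by blast
    have "cmod (u i x - l x) \<le> \<epsilon>" if "i \<ge> N" for i x
    proof (rule LIMSEQ_le_const2)
      show "(\<lambda>j. cmod (u i x - u j x)) \<longlonglongrightarrow> cmod (u i x - l x)"
        by (intro tendsto_intros lim)
      show "\<exists>N. \<forall>j\<ge>N. cmod (u i x - u j x) \<le> \<epsilon>" using N[OF that] less_imp_le by blast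
    qed
    then show ?thesis by blast
  qed
  obtain N where N: "\<And>x. cmod (u N x - l x) \<le> 1" using near[of 1] by auto
  obtain M where M: "\<And>x. cmod (u N x) \<le> M" using Linf_set_bounded[OF u] by blast
  have "l \<in> Linf_set X"
  proof (rule Linf_setI)
    show "l \<in> borel_measurable X"
      by (rule borel_measurable_LIMSEQ_metric[OF Linf_set_measurable[OF u] lim])
    show "cmod (l x) \<le> M + 1" for x
      using norm_triangle_ineq4[of "u N x" "u N x - l x"] N[of x] M[of x] by simp
    show "l x = 0" if "x \<notin> space X" for x
      using Linf_set_outside[OF u that] lim[of x] by (simp add: LIMSEQ_const_iff)
  qed
  moreover have "\<exists>N. \<forall>i\<ge>N. (SUP x. cmod (u i x - l x)) < \<epsilon>" if "\<epsilon> > 0" for \<epsilon>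
  proof -
    from near[of "\<epsilon>/2"] that obtain N where N: "\<And>i x. i \<ge> N \<Longrightarrow> cmod (u i x - l x) \<le> \<epsilon>/2"
      by auto
    have "(SUP x. cmod (u i x - l x)) < \<epsilon>" if "i \<ge> N" for i
      using Linf_norm_le[of "\<lambda>x. u i x - l x", OF N[OF that]] \<open>\<epsilon> > 0\<close> by linarith
    then show ?thesis by blast
  qed
  ultimately show ?thesis by blast
qed

lemma Linf_norm_star_mult:
  assumes f: "f \<in> Linf_set X"
  shows "(SUP x. cmod (cnj (f x) * f x)) = (SUP x. cmod (f x))\<^sup>2"
proof (rule order_antisym)
  have *: "cmod (cnj (f x) * f x) = (cmod (f x))\<^sup>2" for x by (simp add: norm_mult power2_eq_square)
  show "(SUP x. cmod (cnj (f x) * f x)) \<le> (SUP x. cmod (f x))\<^sup>2"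
    unfolding * by (rule cSUP_least) (auto intro!: power_mono norm_le_Linf_norm[OF f])
  have "cmod (f x) \<le> sqrt (SUP x. cmod (cnj (f x) * f x))" for x
    using norm_le_Linf_norm[OF Linf_set_mult[OF Linf_set_cnj[OF f] f], of x]
    unfolding * by (simp add: real_le_rsqrt)
  from power_mono[OF Linf_norm_le[of f, OF this] Linf_norm_nonneg[OF f], of 2]
  show "(SUP x. cmod (f x))\<^sup>2 \<le> (SUP x. cmod (cnj (f x) * f x))"
    using Linf_norm_nonneg[OF Linf_set_mult[OF Linf_set_cnj[OF f] f]] by simp
qed

lemma Linf_norm_scale:
  assumes f: "f \<in> Linf_set X"
  shows "(SUP x. cmod (c * f x)) = cmod c * (SUP x. cmod (f x))"
proof (rule order_antisym)
  show "(SUP x. cmod (c * f x)) \<le> cmod c * (SUP x. cmod (f x))"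
    unfolding norm_mult by (intro cSUP_least mult_left_mono norm_le_Linf_norm[OF f]) auto
  show "cmod c * (SUP x. cmod (f x)) \<le> (SUP x. cmod (c * f x))"
  proof (cases "c = 0")
    case False
    have "cmod (f x) \<le> (SUP x. cmod (c * f x)) / cmod c" for x
      using norm_le_Linf_norm[OF Linf_set_scale[OF f, of c], of x] False
      by (simp add: norm_mult field_simps)
    from Linf_norm_le[of f, OF this] False show ?thesis by (simp add: field_simps)
  qed simp
qed

lemma cstar_alg_Linf: "cstar_alg (Linf X)"
  unfolding cstar_alg_def cs_sub_def
proof (intro conjI ballI allI impI)
  fix f assume "f \<in> cs_carrier (Linf X)"
  then have f: "f \<in> Linf_set X" by simp
  then show "\<exists>g\<in>cs_carrier (Linf X). cs_add (Linf X) f g = cs_zero (Linf X)"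
    by (intro bexI[of _ "\<lambda>x. (-1) * f x"]) (use Linf_set_scale[of f X "-1"] in auto)
  show "(cs_norm (Linf X) f = 0) = (f = cs_zero (Linf X))"
  proof
    assume "cs_norm (Linf X) f = 0"
    then have "cmod (f x) \<le> 0" for x using norm_le_Linf_norm[OF f, of x] by simp
    then show "f = cs_zero (Linf X)" by auto
  qed simp
  show "cs_norm (Linf X) (cs_scale (Linf X) c f) = cmod c * cs_norm (Linf X) f" for c
    using Linf_norm_scale[OF f] by simp
  show "cs_norm (Linf X) (cs_mult (Linf X) (cs_star (Linf X) f) f) = (cs_norm (Linf X) f)\<^sup>2"
    using Linf_norm_star_mult[OF f] by simp
  fix g assume "g \<in> cs_carrier (Linf X)"
  then have g: "g \<in> Linf_set X" by simp
  show "cs_norm (Linf X) (cs_add (Linf X) f g) \<le> cs_norm (Linf X) f + cs_norm (Linf X) g"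
    using norm_le_Linf_norm[OF f] norm_le_Linf_norm[OF g]
    by (auto intro!: Linf_norm_le norm_triangle_mono)
  show "cs_norm (Linf X) (cs_mult (Linf X) f g) \<le> cs_norm (Linf X) f * cs_norm (Linf X) g"
    using norm_le_Linf_norm[OF f] norm_le_Linf_norm[OF g] Linf_norm_nonneg[OF f]
    by (simp, intro Linf_norm_le) (auto intro!: mult_mono simp: norm_mult)
next
  fix u :: "nat \<Rightarrow> 'a \<Rightarrow> complex"
  assume "(\<forall>k. u k \<in> cs_carrier (Linf X)) \<and> (\<forall>\<epsilon>>0. \<exists>N. \<forall>i\<ge>N. \<forall>j\<ge>N.
    cs_norm (Linf X) (cs_add (Linf X) (u i) (cs_scale (Linf X) (- 1) (u j))) < \<epsilon>)"
  then show "\<exists>l\<in>cs_carrier (Linf X). \<forall>\<epsilon>>0. \<exists>N. \<forall>i\<ge>N.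
    cs_norm (Linf X) (cs_add (Linf X) (u i) (cs_scale (Linf X) (- 1) l)) < \<epsilon>"
    using Linf_complete[of u X] by simp
qed (auto simp: algebra_simps Linf_set_outside)

lemma cs_selfadj_Linf: "cs_selfadj (Linf X) f \<longleftrightarrow> f \<in> Linf_set X \<and> (\<forall>x. Im (f x) = 0)"
  by (auto simp: cs_selfadj_def fun_eq_iff complex_eq_iff)

lemma cs_positive_Linf:
  "cs_positive (Linf X) f \<longleftrightarrow> f \<in> Linf_set X \<and> (\<forall>x. Im (f x) = 0 \<and> 0 \<le> Re (f x))"
proof
  assume "cs_positive (Linf X) f"
  then show "f \<in> Linf_set X \<and> (\<forall>x. Im (f x) = 0 \<and> 0 \<le> Re (f x))" by (auto simp: cs_positive_def)
next
  assume f: "f \<in> Linf_set X \<and> (\<forall>x. Im (f x) = 0 \<and> 0 \<le> Re (f x))"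
  then obtain M where M: "\<And>x. cmod (f x) \<le> M" by (meson Linf_set_bounded)
  define b where "b x = complex_of_real (sqrt (Re (f x)))" for x
  have "b \<in> Linf_set X"
  proof (rule Linf_setI)
    show "b \<in> borel_measurable X" unfolding b_def
      using Linf_set_measurable[OF conjunct1[OF f]] by measurable
    show "cmod (b x) \<le> sqrt M" for x
      using f M[of x] complex_Re_le_cmod[of "f x"] by (simp add: b_def)
    show "b x = 0" if "x \<notin> space X" for x using f that Linf_set_outside[of f X x] by (simp add: b_def)
  qed
  moreover have "f = (\<lambda>x. cnj (b x) * b x)"
    using f by (simp add: fun_eq_iff b_def complex_eq_iff)
  ultimately show "cs_positive (Linf X) f"
    unfolding cs_positive_def using f by (auto intro!: bexI[of _ b])
qed

lemma cs_le_Linf: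
  "cs_le (Linf X) f g \<longleftrightarrow> f \<in> Linf_set X \<and> g \<in> Linf_set X \<and> (\<forall>x. cs_le complex_cs (f x) (g x))"
proof -
  have "(\<lambda>x. g x - f x) \<in> Linf_set X" if "f \<in> Linf_set X" "g \<in> Linf_set X"
    using Linf_set_add[OF that(2) Linf_set_scale[OF that(1), of "-1"]] by simp
  then show ?thesis
    by (auto simp: cs_le_def cs_selfadj_Linf cs_positive_Linf cs_sub_def cs_le_complex cs_selfadj_complex
        cs_positive_complex)
qed

section \<open>Suprema of measurable functions are pointwise\<close>

lemma pointwise_SUP_Linf:
  assumes a: "\<And>k::nat. a k \<in> Linf_set X" and M: "\<And>k x. \<bar>Re (a k x)\<bar> \<le> M"
  shows "(\<lambda>x. complex_of_real (SUP k. Re (a k x))) \<in> Linf_set X"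
proof (rule Linf_setI)
  have bdd: "bdd_above (range (\<lambda>k. Re (a k x)))" for x
    using M[of _ x] by (auto simp: bdd_above_def abs_le_iff)
  have "(\<lambda>x. SUP k. Re (a k x)) \<in> borel_measurable X"
    using Linf_set_measurable[OF a] bdd by (intro borel_measurable_cSUP) auto
  then show "(\<lambda>x. complex_of_real (SUP k. Re (a k x))) \<in> borel_measurable X" by measurable
  show "cmod (complex_of_real (SUP k. Re (a k x))) \<le> M" for x
  proof -
    have "(SUP k. Re (a k x)) \<le> M" using M[of _ x] by (intro cSUP_least) (auto simp: abs_le_iff)
    moreover have "Re (a 0 x) \<le> (SUP k. Re (a k x))" using bdd by (intro cSUP_upper) auto
    ultimately show ?thesis using M[of 0 x] by (simp add: abs_le_iff)
  qed
  show "complex_of_real (SUP k. Re (a k x)) = 0" if "x \<notin> space X" for x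
    using that Linf_set_outside[OF a] by simp
qed

lemma cs_is_sup_SUP:
  assumes "\<And>k::nat. Im (a k) = 0" "bdd_above (range (\<lambda>k. Re (a k)))"
  shows "cs_is_sup complex_cs a (complex_of_real (SUP k. Re (a k)))"
  using assms by (auto simp: cs_is_sup_complex intro: cSUP_upper cSUP_least)

lemma cs_is_sup_complex_unique: "cs_is_sup complex_cs a s \<Longrightarrow> cs_is_sup complex_cs a t \<Longrightarrow> s = t"
  by (auto simp: cs_is_sup_complex complex_eq_iff intro!: order_antisym)

lemma cs_is_sup_LinfI:
  assumes "s \<in> Linf_set X" "\<And>k. a k \<in> Linf_set X" "\<And>x. cs_is_sup complex_cs (\<lambda>k. a k x) (s x)"
  shows "cs_is_sup (Linf X) a s"
  using assms by (auto simp: cs_is_sup_def cs_le_Linf cs_selfadj_Linf cs_selfadj_complex)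

text \<open>The point is that the pointwise supremum lies in the algebra: countability makes it
  measurable, and it is squeezed between \<open>a 0\<close> and s, hence bounded. It is then a least
  upper bound as well and must coincide with s.\<close>

lemma cs_is_sup_Linf:
  "cs_is_sup (Linf X) a s \<longleftrightarrow>
    s \<in> Linf_set X \<and> (\<forall>k. a k \<in> Linf_set X) \<and> (\<forall>x. cs_is_sup complex_cs (\<lambda>k. a k x) (s x))"
proof
  assume L: "cs_is_sup (Linf X) a s"
  then have s: "s \<in> Linf_set X" and a: "\<And>k. a k \<in> Linf_set X"
    and real: "\<And>k x. Im (a k x) = 0" "\<And>x. Im (s x) = 0" and le: "\<And>k x. Re (a k x) \<le> Re (s x)"
    by (auto simp: cs_is_sup_def cs_le_Linf cs_le_complex)
  \<comment> \<open>This is the maximum of \<open>a k\<close> and \<open>a 0\<close>. The function s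
    controls the sequence only from above; passing to b adds a uniform lower bound without changing
    the pointwise supremum.\<close>
  define b where "b k x = (if Re (a k x) \<le> Re (a 0 x) then a 0 x else a k x)" for k x
  obtain M N where MN: "\<And>x. cmod (s x) \<le> M" "\<And>x. cmod (a 0 x) \<le> N" by (meson Linf_set_bounded s a)
  have bdd: "bdd_above (range (\<lambda>k. Re (a k x)))" for x using le by (auto simp: bdd_above_def)
  have bS: "b k \<in> Linf_set X" for k
  proof (rule Linf_setI)
    show "b k \<in> borel_measurable X" unfolding b_def
      using Linf_set_measurable[OF a[of k]] Linf_set_measurable[OF a[of 0]] by measurable
    have *: "cmod (a k x) \<le> M + N" if "\<not> Re (a k x) \<le> Re (a 0 x)" for x
    proof -
      have "cmod (a k x) = \<bar>Re (a k x)\<bar>" using real by (simp add: cmod_def)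
      then show ?thesis
        using that le[of k x] MN[of x] abs_Re_le_cmod[of "s x"] abs_Re_le_cmod[of "a 0 x"] by linarith
    qed
    show "cmod (b k x) \<le> M + N" for x
      using *[of x] MN[of x] order_trans[OF norm_ge_zero MN(1)[of x]] by (auto simp: b_def)
    show "b k x = 0" if "x \<notin> space X" for x using Linf_set_outside[OF a that] by (simp add: b_def)
  qed
  have b_bnd: "\<bar>Re (b k x)\<bar> \<le> M + N" for k x
    using le[of k x] MN[of x] abs_Re_le_cmod[of "s x"] abs_Re_le_cmod[of "a 0 x"]
      norm_ge_zero[of "s x"] by (auto simp: b_def)
  have SUPeq: "(SUP k. Re (b k x)) = (SUP k. Re (a k x))" for x
  proof (rule order_antisym)
    show "(SUP k. Re (b k x)) \<le> (SUP k. Re (a k x))"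
      using cSUP_upper[OF UNIV_I bdd] by (intro cSUP_least) (auto simp: b_def)
    have "bdd_above (range (\<lambda>k. Re (b k x)))" using b_bnd[of _ x] by (auto simp: bdd_above_def abs_le_iff)
    then show "(SUP k. Re (a k x)) \<le> (SUP k. Re (b k x))"
      by (intro cSUP_mono) (auto simp: b_def)
  qed
  define t where "t x = complex_of_real (SUP k. Re (a k x))" for x
  have t: "t \<in> Linf_set X" using pointwise_SUP_Linf[of b X, OF bS b_bnd] by (simp add: SUPeq t_def[abs_def])
  have tsup: "cs_is_sup complex_cs (\<lambda>k. a k x) (t x)" for x
    unfolding t_def using real bdd by (intro cs_is_sup_SUP) auto
  have "cs_is_sup (Linf X) a t" using t a tsup by (rule cs_is_sup_LinfI)
  then have "cs_le (Linf X) t s" "cs_le (Linf X) s t" using L unfolding cs_is_sup_def by blast+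
  then have "s x = t x" for x by (auto simp: cs_le_Linf cs_le_complex complex_eq_iff intro!: order_antisym)
  then show "s \<in> Linf_set X \<and> (\<forall>k. a k \<in> Linf_set X) \<and> (\<forall>x. cs_is_sup complex_cs (\<lambda>k. a k x) (s x))"
    using s a tsup by simp
qed (use cs_is_sup_LinfI in blast)

lemma comm_sigma_cstar_Linf: "comm_sigma_cstar (Linf X)"
proof -
  have "\<exists>s. cs_is_sup (Linf X) a s" if a: "cs_bdd_incseq (Linf X) a" for a
  proof -
    from a obtain M where aS: "\<And>k. a k \<in> Linf_set X" and real: "\<And>k x. Im (a k x) = 0"
      and M: "\<And>k. (SUP x. cmod (a k x)) \<le> M"
      by (auto simp: cs_bdd_incseq_def cs_selfadj_Linf)
    have bnd: "\<bar>Re (a k x)\<bar> \<le> M" for k x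
      using norm_le_Linf_norm[OF aS, of k x] M[of k] abs_Re_le_cmod[of "a k x"] by linarith
    then have "bdd_above (range (\<lambda>k. Re (a k x)))" for x
      by (auto simp: bdd_above_def abs_le_iff)
    then have "cs_is_sup (Linf X) a (\<lambda>x. complex_of_real (SUP k. Re (a k x)))"
      using real by (intro cs_is_sup_LinfI pointwise_SUP_Linf[OF aS bnd] aS cs_is_sup_SUP) auto
    then show ?thesis by blast
  qed
  then show ?thesis
    by (auto simp: comm_sigma_cstar_def sigma_cstar_def cstar_alg_Linf mult.commute)
qed

section \<open>Homomorphisms, spectra and the adjunction\<close>

lemma comm_cstar_Linf: "comm_cstar (Linf X)"
  by unfold_locales (auto simp: cstar_alg_Linf mult.commute)

lemma comm_cstar_complex: "comm_cstar complex_cs"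
proof
  have compl: "\<exists>l. \<forall>\<epsilon>>0. \<exists>N. \<forall>i\<ge>N. cmod (u i - l) < \<epsilon>"
    if "\<forall>\<epsilon>>0. \<exists>N. \<forall>i\<ge>N. \<forall>j\<ge>N. cmod (u i - u j) < \<epsilon>" for u :: "nat \<Rightarrow> complex"
  proof -
    from that have "Cauchy u" unfolding Cauchy_def dist_norm by blast
    then obtain l where "u \<longlonglongrightarrow> l" using Cauchy_convergent convergent_def by blast
    then show ?thesis unfolding lim_sequentially dist_norm by blast
  qed
  have ex_neg: "\<exists>y. x + y = 0" for x :: complex by (rule exI[of _ "-x"]) simp
  have cst: "cmod x * cmod x = (cmod x)\<^sup>2" for x by (simp add: power2_eq_square)
  show "cstar_alg complex_cs"
    unfolding cstar_alg_def cs_sub_def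
    by (intro conjI ballI allI impI)
       (use compl ex_neg in \<open>auto simp: algebra_simps norm_mult norm_triangle_ineq cst\<close>)
qed auto

lemma comm_sigma_cstar_imp_comm_cstar: "comm_sigma_cstar A \<Longrightarrow> comm_cstar A"
  by unfold_locales (auto simp: comm_sigma_cstar_def sigma_cstar_def)

section \<open>Homomorphisms, order and norm\<close>

lemma
  assumes "star_hom A B h"
  shows star_hom_mem: "x \<in> cs_carrier A \<Longrightarrow> h x \<in> cs_carrier B"
    and star_hom_one: "h (cs_one A) = cs_one B"
    and star_hom_add: "\<lbrakk>x \<in> cs_carrier A; y \<in> cs_carrier A\<rbrakk> \<Longrightarrow> h (cs_add A x y) = cs_add B (h x) (h y)"
    and star_hom_mult: "\<lbrakk>x \<in> cs_carrier A; y \<in> cs_carrier A\<rbrakk> \<Longrightarrow> h (cs_mult A x y) = cs_mult B (h x) (h y)"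
    and star_hom_scale: "x \<in> cs_carrier A \<Longrightarrow> h (cs_scale A c x) = cs_scale B c (h x)"
    and star_hom_star: "x \<in> cs_carrier A \<Longrightarrow> h (cs_star A x) = cs_star B (h x)"
  using assms by (auto simp: star_hom_def cs_linear_def)

lemma sigma_star_hom_star_hom: "sigma_star_hom A B h \<Longrightarrow> star_hom A B h"
  by (simp add: sigma_star_hom_def)

lemma sigma_star_hom_sup:
  "\<lbrakk>sigma_star_hom A B h; cs_bdd_incseq A a; cs_is_sup A a s\<rbrakk> \<Longrightarrow> cs_is_sup B (\<lambda>k. h (a k)) (h s)"
  by (auto simp: sigma_star_hom_def sigma_normal_def comp_def)

context comm_cstar begin

lemma star_hom_pos:
  assumes "star_hom A B h" "pos x" shows "cs_positive B (h x)"
proof -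
  from assms(2) obtain b where "b \<in> C" "x = star b \<^bold>* b" unfolding cs_positive_def by blast
  then have "h b \<in> cs_carrier B" "h x = cs_mult B (cs_star B (h b)) (h b)"
    using star_hom_mem[OF assms(1)] star_hom_mult[OF assms(1)] star_hom_star[OF assms(1)] by auto
  moreover have "h x \<in> cs_carrier B" using star_hom_mem[OF assms(1)] assms(2) by simp
  ultimately show ?thesis unfolding cs_positive_def by (intro conjI bexI[of _ "h b"])
qed

lemma star_hom_sub:
  assumes "star_hom A B h" "x \<in> C" "y \<in> C" shows "h (x \<^bold>- y) = cs_sub B (h x) (h y)"
  using assms by (simp add: cs_sub_def star_hom_add star_hom_scale)

lemma star_hom_sa: "\<lbrakk>star_hom A B h; sa x\<rbrakk> \<Longrightarrow> cs_selfadj B (h x)"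
  by (metis cs_selfadj_def star_hom_mem star_hom_star)

lemma star_hom_le: "\<lbrakk>star_hom A B h; cs_le A x y\<rbrakk> \<Longrightarrow> cs_le B (h x) (h y)"
  using star_hom_sa[of B h x] star_hom_sa[of B h y] star_hom_pos[of B h "y \<^bold>- x"] star_hom_sub[of B h y x] by (simp add: cs_le_def)

lemma sigma_star_homI:
  assumes "star_hom A B h"
    and "\<And>a s. \<lbrakk>cs_bdd_incseq A a; cs_is_sup A a s\<rbrakk> \<Longrightarrow> cs_is_sup B (\<lambda>k. h (a k)) (h s)"
  shows "sigma_star_hom A B h"
  using assms star_hom_pos[OF assms(1)]
  by (auto simp: sigma_star_hom_def sigma_normal_def pos_unital_map_def star_hom_def comp_def)

lemma bdd_incseq_mem: "cs_bdd_incseq A a \<Longrightarrow> a k \<in> C"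
  by (auto simp: cs_bdd_incseq_def)

lemma is_sup_mem: "cs_is_sup A a s \<Longrightarrow> s \<in> C"
  by (auto simp: cs_is_sup_def)

lemma star_hom_cong:
  assumes "star_hom A B h" "\<And>a. a \<in> C \<Longrightarrow> k a = h a" shows "star_hom A B k"
  using assms by (simp add: star_hom_def cs_linear_def)

lemma sigma_star_hom_cong:
  assumes "sigma_star_hom A B h" "\<And>a. a \<in> C \<Longrightarrow> k a = h a" shows "sigma_star_hom A B k"
proof (rule sigma_star_homI)
  show "star_hom A B k" using star_hom_cong assms sigma_star_hom_star_hom by blast
  show "cs_is_sup B (\<lambda>n. k (a n)) (k s)" if "cs_bdd_incseq A a" "cs_is_sup A a s" for a s
    using sigma_star_hom_sup[OF assms(1) that] bdd_incseq_mem[OF that(1)] is_sup_mem[OF that(2)]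
    by (simp add: assms(2))
qed

text \<open>The image of t^2 1 - a^* a is positive in B, and there positivity of this expression
  bounds the norm of the image of a.\<close>

lemma star_hom_norm_le:
  assumes "comm_cstar B" and h: "star_hom A B h" and a: "a \<in> C" "nrm a \<le> t"
  shows "cs_norm B (h a) \<le> t"
proof -
  interpret B: comm_cstar B by fact
  have "0 \<le> t" using norm_nonneg[of a] a by simp
  have "cs_positive B (h (complex_of_real (t\<^sup>2) \<^bold>\<cdot> \<^bold>1 \<^bold>- star a \<^bold>* a))"
    using star_hom_pos[OF h pos_norm_square_minus[OF a]] .
  also have "h (complex_of_real (t\<^sup>2) \<^bold>\<cdot> \<^bold>1 \<^bold>- star a \<^bold>* a) =
      cs_sub B (cs_scale B (complex_of_real (t\<^sup>2)) (cs_one B)) (cs_mult B (cs_star B (h a)) (h a))"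
    using a h by (simp add: star_hom_sub[OF h] star_hom_scale[OF h] star_hom_one[OF h]
      star_hom_mult[OF h] star_hom_star[OF h])
  finally show ?thesis using B.norm_le_if_pos star_hom_mem[OF h] a \<open>0 \<le> t\<close> by blast
qed

text \<open>Normality of a second homomorphism can be applied to the image sequence only if that
  sequence is norm-bounded; contractivity supplies this.\<close>

lemma star_hom_bdd_incseq:
  assumes "comm_cstar B" and h: "star_hom A B h" and a: "cs_bdd_incseq A a"
  shows "cs_bdd_incseq B (\<lambda>k. h (a k))"
proof -
  from a obtain M where "\<And>k. nrm (a k) \<le> M" by (auto simp: cs_bdd_incseq_def)
  then have "cs_norm B (h (a k)) \<le> M" for k
    using star_hom_norm_le[OF assms(1) h] bdd_incseq_mem[OF a] by blast
  with a show ?thesis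
    using star_hom_sa[OF h] star_hom_le[OF h] by (auto simp: cs_bdd_incseq_def)
qed

lemma sigma_star_hom_comp:
  assumes "comm_cstar B" "sigma_star_hom A B h" "sigma_star_hom B D k"
  shows "sigma_star_hom A D (\<lambda>a. k (h a))"
proof (rule sigma_star_homI)
  have h: "star_hom A B h" and k: "star_hom B D k" using assms sigma_star_hom_star_hom by auto
  then show "star_hom A D (\<lambda>a. k (h a))" by (simp add: star_hom_def cs_linear_def)
  show "cs_is_sup D (\<lambda>n. k (h (a n))) (k (h s))" if "cs_bdd_incseq A a" "cs_is_sup A a s" for a s
    using sigma_star_hom_sup[OF assms(3) star_hom_bdd_incseq[OF assms(1) h that(1)]
        sigma_star_hom_sup[OF assms(2) that]] .
qed

lemma sigma_star_hom_id: "sigma_star_hom A A (\<lambda>a. a)"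
  by (rule sigma_star_homI) (auto simp: star_hom_def cs_linear_def)

lemma sigma_star_hom_LinfD:
  assumes "sigma_star_hom A (Linf X) h" "x \<in> space X"
  shows "sigma_star_hom A complex_cs (\<lambda>a. h a x)"
proof (rule sigma_star_homI)
  show "star_hom A complex_cs (\<lambda>a. h a x)"
    using sigma_star_hom_star_hom[OF assms(1)] assms(2) by (simp add: star_hom_def cs_linear_def)
  show "cs_is_sup complex_cs (\<lambda>n. h (a n) x) (h s x)" if "cs_bdd_incseq A a" "cs_is_sup A a s" for a s
    using sigma_star_hom_sup[OF assms(1) that] by (simp add: cs_is_sup_Linf)
qed

text \<open>Operations and suprema in \<open>Linf X\<close> are pointwise, so a homomorphism into it
  amounts to a family of characters indexed by points, with measurable and bounded values. This is
  how \<open>Linf_map\<close> and \<open>adj_Phi\<close> are recognised as homomorphisms.\<close>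

lemma sigma_star_hom_LinfI:
  assumes mem: "\<And>a. a \<in> C \<Longrightarrow> h a \<in> Linf_set X"
    and hom: "\<And>x. x \<in> space X \<Longrightarrow> sigma_star_hom A complex_cs (\<lambda>a. h a x)"
  shows "sigma_star_hom A (Linf X) h"
proof (rule sigma_star_homI)
  note out = Linf_set_outside[OF mem]
  note sh = sigma_star_hom_star_hom[OF hom]
  have "h (x \<^bold>+ y) = (\<lambda>p. h x p + h y p)" if "x \<in> C" "y \<in> C" for x y
  proof
    show "h (x \<^bold>+ y) p = h x p + h y p" for p
      using star_hom_add[OF sh, of p] out[of _ p] that by (cases "p \<in> space X") auto
  qed
  moreover have "h (x \<^bold>* y) = (\<lambda>p. h x p * h y p)" if "x \<in> C" "y \<in> C" for x y
  proof
    show "h (x \<^bold>* y) p = h x p * h y p" for p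
      using star_hom_mult[OF sh, of p] out[of _ p] that by (cases "p \<in> space X") auto
  qed
  moreover have "h (c \<^bold>\<cdot> x) = (\<lambda>p. c * h x p)" if "x \<in> C" for c x
  proof
    show "h (c \<^bold>\<cdot> x) p = c * h x p" for p
      using star_hom_scale[OF sh, of p] out[of _ p] that by (cases "p \<in> space X") auto
  qed
  moreover have "h (star x) = (\<lambda>p. cnj (h x p))" if "x \<in> C" for x
  proof
    show "h (star x) p = cnj (h x p)" for p
      using star_hom_star[OF sh, of p] out[of _ p] that by (cases "p \<in> space X") auto
  qed
  moreover have "h \<^bold>1 = (\<lambda>p. if p \<in> space X then 1 else 0)"
    using star_hom_one[OF sh] out by auto
  ultimately show "star_hom A (Linf X) h" using mem by (simp add: star_hom_def cs_linear_def)
  show "cs_is_sup (Linf X) (\<lambda>k. h (a k)) (h s)" if a: "cs_bdd_incseq A a" "cs_is_sup A a s" for a s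
  proof (rule cs_is_sup_LinfI)
    show "h s \<in> Linf_set X" "h (a k) \<in> Linf_set X" for k
      using mem a bdd_incseq_mem is_sup_mem by auto
    show "cs_is_sup complex_cs (\<lambda>k. h (a k) x) (h s x)" for x
    proof (cases "x \<in> space X")
      case True
      then show ?thesis using sigma_star_hom_sup[OF hom a] by simp
    next
      case False
      then show ?thesis
        using out[OF bdd_incseq_mem[OF a(1)] False] out[OF is_sup_mem[OF a(2)] False]
        by (simp add: cs_is_sup_complex_const)
    qed
  qed
qed

end

lemma sigma_star_hom_eval:
  "x \<in> space X \<Longrightarrow> sigma_star_hom (Linf X) complex_cs (\<lambda>f. f x)"
  using comm_cstar.sigma_star_hom_LinfD[OF comm_cstar_Linf comm_cstar.sigma_star_hom_id[OF comm_cstar_Linf]] .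

section \<open>Pullback along measurable maps\<close>

lemma Linf_set_comp:
  assumes "f \<in> measurable X Y" "g \<in> Linf_set Y"
  shows "(\<lambda>x. if x \<in> space X then g (f x) else 0) \<in> Linf_set X"
proof -
  from assms(2) obtain M where M: "\<And>y. cmod (g y) \<le> M" by (meson Linf_set_bounded)
  have "(\<lambda>x. g (f x)) \<in> borel_measurable X"
    using measurable_compose[OF assms(1) Linf_set_measurable[OF assms(2)]] .
  then have "(\<lambda>x. if x \<in> space X then g (f x) else 0) \<in> borel_measurable X"
    by (subst measurable_cong[where g = "\<lambda>x. g (f x)"]) auto
  then show ?thesis
    by (rule Linf_setI[where M = M]) (use M order_trans[OF norm_ge_zero M] in auto)
qed

lemma sigma_star_hom_Linf_map:
  assumes "f \<in> measurable X Y"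
  shows "sigma_star_hom (Linf Y) (Linf X) (Linf_map X Y f)"
proof (rule comm_cstar.sigma_star_hom_LinfI[OF comm_cstar_Linf])
  show "Linf_map X Y f g \<in> Linf_set X" if "g \<in> cs_carrier (Linf Y)" for g
    using Linf_set_comp[OF assms] that by (simp add: Linf_map_def)
  show "sigma_star_hom (Linf Y) complex_cs (\<lambda>g. Linf_map X Y f g x)" if "x \<in> space X" for x
    by (rule comm_cstar.sigma_star_hom_cong[OF comm_cstar_Linf sigma_star_hom_eval[of "f x"]])
       (use that measurable_space[OF assms] in \<open>auto simp: Linf_map_def\<close>)
qed

section \<open>The spectrum as a measurable space\<close>

lemma space_Spec [simp]: "space (Spec A) = spec_space A"
  unfolding Spec_def by (rule space_measure_of) auto

lemma sets_Spec: "sets (Spec A) = sigma_sets (spec_space A)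
    {{\<phi> \<in> spec_space A. \<phi> a \<in> S} | a S. a \<in> cs_carrier A \<and> S \<in> sets borel}"
  unfolding Spec_def by (rule sets_measure_of) auto

text \<open>Only preimages of generators need testing: the spectrum carries the smallest
  sigma-algebra that makes all evaluations measurable.\<close>

lemma measurable_SpecI:
  assumes "\<And>x. x \<in> space M \<Longrightarrow> f x \<in> spec_space A"
    and "\<And>a. a \<in> cs_carrier A \<Longrightarrow> (\<lambda>x. f x a) \<in> borel_measurable M"
  shows "f \<in> measurable M (Spec A)"
  unfolding Spec_def
proof (rule measurable_measure_of)
  show "f \<in> space M \<rightarrow> spec_space A" using assms(1) by auto
  fix y assume "y \<in> {{\<phi> \<in> spec_space A. \<phi> a \<in> S} | a S. a \<in> cs_carrier A \<and> S \<in> sets borel}"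
  then obtain a S where aS: "y = {\<phi> \<in> spec_space A. \<phi> a \<in> S}" "a \<in> cs_carrier A" "S \<in> sets borel" by auto
  have "f -` y \<inter> space M = (\<lambda>x. f x a) -` S \<inter> space M" using assms(1) aS by auto
  then show "f -` y \<inter> space M \<in> sets M" using measurable_sets[OF assms(2)] aS by simp
qed auto

lemma measurable_Spec_eval: "a \<in> cs_carrier A \<Longrightarrow> (\<lambda>\<phi>. \<phi> a) \<in> borel_measurable (Spec A)"
proof (rule measurableI)
  fix S assume "a \<in> cs_carrier A" "S \<in> sets (borel :: complex measure)"
  moreover have "(\<lambda>\<phi>. \<phi> a) -` S \<inter> space (Spec A) = {\<phi> \<in> spec_space A. \<phi> a \<in> S}" by auto
  ultimately show "(\<lambda>\<phi>. \<phi> a) -` S \<inter> space (Spec A) \<in> sets (Spec A)"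
    unfolding sets_Spec by (intro sigma_sets.Basic) auto
qed simp

lemma spec_space_hom: "\<phi> \<in> spec_space A \<Longrightarrow> sigma_star_hom A complex_cs \<phi>"
  and spec_space_ext: "\<phi> \<in> spec_space A \<Longrightarrow> \<phi> \<in> extensional (cs_carrier A)"
  by (auto simp: spec_space_def)

lemma spec_space_restrictI:
  assumes "comm_cstar A" "sigma_star_hom A complex_cs \<phi>"
  shows "restrict \<phi> (cs_carrier A) \<in> spec_space A"
  using comm_cstar.sigma_star_hom_cong[OF assms, of "restrict \<phi> (cs_carrier A)"]
  by (auto simp: spec_space_def)

lemma spec_space_norm_le:
  assumes "comm_cstar A" "\<phi> \<in> spec_space A" "a \<in> cs_carrier A"
  shows "cmod (\<phi> a) \<le> cs_norm A a"
  using comm_cstar.star_hom_norm_le[OF assms(1) comm_cstar_complex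
      sigma_star_hom_star_hom[OF spec_space_hom[OF assms(2)]] assms(3) order_refl] by simp

lemma Spec_map_measurable:
  assumes A: "comm_cstar A" and B: "comm_cstar B" and h: "sigma_star_hom A B h"
  shows "Spec_map A B h \<in> measurable (Spec B) (Spec A)"
proof (rule measurable_SpecI)
  show "Spec_map A B h \<phi> \<in> spec_space A" if "\<phi> \<in> space (Spec B)" for \<phi>
    using that spec_space_restrictI[OF A comm_cstar.sigma_star_hom_comp[OF A B h spec_space_hom, of \<phi>]]
    by (simp add: Spec_map_def)
  fix a assume a: "a \<in> cs_carrier A"
  then have "h a \<in> cs_carrier B" using star_hom_mem[OF sigma_star_hom_star_hom[OF h]] by simp
  from measurable_Spec_eval[OF this] a
  show "(\<lambda>\<phi>. Spec_map A B h \<phi> a) \<in> borel_measurable (Spec B)"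
    by (subst measurable_cong[where g = "\<lambda>\<phi>. \<phi> (h a)"]) (auto simp: Spec_map_def)
qed

text \<open>Contractivity of characters bounds the transposed function of a uniformly by
  \<open>cs_norm A a\<close>.\<close>

lemma sigma_star_hom_adj_Phi:
  assumes A: "comm_cstar A" and f: "f \<in> measurable X (Spec A)"
  shows "sigma_star_hom A (Linf X) (adj_Phi X A f)"
proof (rule comm_cstar.sigma_star_hom_LinfI[OF A])
  have fx: "f x \<in> spec_space A" if "x \<in> space X" for x using measurable_space[OF f that] by simp
  show "adj_Phi X A f a \<in> Linf_set X" if a: "a \<in> cs_carrier A" for a
  proof (rule Linf_setI)
    show "adj_Phi X A f a \<in> borel_measurable X"
      using measurable_compose[OF f measurable_Spec_eval[OF a]] a
      by (subst measurable_cong[where g = "\<lambda>x. f x a"]) (auto simp: adj_Phi_def)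
    show "cmod (adj_Phi X A f a x) \<le> cs_norm A a" for x
      using spec_space_norm_le[OF A fx a] comm_cstar.norm_nonneg[OF A a] a by (auto simp: adj_Phi_def)
  qed (use a in \<open>simp add: adj_Phi_def\<close>)
  show "sigma_star_hom A complex_cs (\<lambda>a. adj_Phi X A f a x)" if "x \<in> space X" for x
    by (rule comm_cstar.sigma_star_hom_cong[OF A spec_space_hom[OF fx[OF that]]])
       (use that in \<open>simp add: adj_Phi_def\<close>)
qed

text \<open>The inverse sends h to the map taking x to the character a \<mapsto> h a x. Both hom
  sets, and the characters themselves, are extensional, so that equality on the relevant domain is
  equality of functions.\<close>

lemma bij_betw_adj_Phi:
  assumes A: "comm_cstar A"
  shows "bij_betw (adj_Phi X A) (meas_hom X (Spec A)) (alg_hom A (Linf X))"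
proof (rule bij_betwI')
  fix f g assume "f \<in> meas_hom X (Spec A)" "g \<in> meas_hom X (Spec A)"
  then have f: "f \<in> measurable X (Spec A)" "f \<in> extensional (space X)"
    and g: "g \<in> measurable X (Spec A)" "g \<in> extensional (space X)" by (auto simp: meas_hom_def)
  show "(adj_Phi X A f = adj_Phi X A g) = (f = g)"
  proof
    assume eq: "adj_Phi X A f = adj_Phi X A g"
    show "f = g"
    proof (rule extensionalityI[OF f(2) g(2)], rule extensionalityI)
      fix x assume x: "x \<in> space X"
      show "f x \<in> extensional (cs_carrier A)" "g x \<in> extensional (cs_carrier A)"
        using spec_space_ext measurable_space[OF f(1) x] measurable_space[OF g(1) x] by auto
      show "f x a = g x a" if "a \<in> cs_carrier A" for a
        using fun_cong[OF fun_cong[OF eq, of a], of x] that x by (simp add: adj_Phi_def)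
    qed
  qed simp
next
  fix f assume "f \<in> meas_hom X (Spec A)"
  then show "adj_Phi X A f \<in> alg_hom A (Linf X)"
    using sigma_star_hom_adj_Phi[OF A] by (auto simp: meas_hom_def alg_hom_def adj_Phi_def)
next
  fix h assume "h \<in> alg_hom A (Linf X)"
  then have h: "sigma_star_hom A (Linf X) h" "h \<in> extensional (cs_carrier A)"
    by (auto simp: alg_hom_def)
  have mem: "h a \<in> Linf_set X" if "a \<in> cs_carrier A" for a
    using star_hom_mem[OF sigma_star_hom_star_hom[OF h(1)] that] by simp
  define f where "f = restrict (\<lambda>x. restrict (\<lambda>a. h a x) (cs_carrier A)) (space X)"
  have "f \<in> measurable X (Spec A)"
  proof (rule measurable_SpecI)
    show "f x \<in> spec_space A" if "x \<in> space X" for x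
      using spec_space_restrictI[OF A comm_cstar.sigma_star_hom_LinfD[OF A h(1) that]] that
      by (simp add: f_def)
    show "(\<lambda>x. f x a) \<in> borel_measurable X" if "a \<in> cs_carrier A" for a
      using Linf_set_measurable[OF mem[OF that]] that
      by (subst measurable_cong[where g = "h a"]) (auto simp: f_def)
  qed
  then have "f \<in> meas_hom X (Spec A)" by (auto simp: meas_hom_def f_def)
  moreover have "h = adj_Phi X A f"
  proof (rule extensionalityI[OF h(2)])
    show "adj_Phi X A f \<in> extensional (cs_carrier A)" by (auto simp: adj_Phi_def)
    show "h a = adj_Phi X A f a" if "a \<in> cs_carrier A" for a
      using that Linf_set_outside[OF mem[OF that]] by (auto simp: adj_Phi_def f_def)
  qed
  ultimately show "\<exists>f\<in>meas_hom X (Spec A). h = adj_Phi X A f" by blast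
qed

section \<open>Naturality of the transposition\<close>

lemma adj_Phi_natural_space:
  assumes A: "comm_cstar A" and g: "g \<in> measurable Y X" and k: "k \<in> meas_hom X (Spec A)"
  shows "adj_Phi Y A (restrict (k \<circ> g) (space Y)) = restrict (Linf_map Y X g \<circ> adj_Phi X A k) (cs_carrier A)"
proof (rule extensionalityI)
  show "adj_Phi Y A (restrict (k \<circ> g) (space Y)) \<in> extensional (cs_carrier A)"
    "restrict (Linf_map Y X g \<circ> adj_Phi X A k) (cs_carrier A) \<in> extensional (cs_carrier A)"
    by (auto simp: adj_Phi_def)
  fix a assume a: "a \<in> cs_carrier A"
  have "k \<in> measurable X (Spec A)" using k by (simp add: meas_hom_def)
  then have "adj_Phi X A k a \<in> Linf_set X"
    using star_hom_mem[OF sigma_star_hom_star_hom[OF sigma_star_hom_adj_Phi[OF A]] a] by simp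
  then show "adj_Phi Y A (restrict (k \<circ> g) (space Y)) a =
      restrict (Linf_map Y X g \<circ> adj_Phi X A k) (cs_carrier A) a"
    using a measurable_space[OF g] by (auto simp: adj_Phi_def Linf_map_def)
qed

lemma adj_Phi_natural_alg:
  assumes h: "sigma_star_hom B A h" and k: "k \<in> meas_hom X (Spec A)"
  shows "adj_Phi X B (restrict (Spec_map B A h \<circ> k) (space X)) = restrict (adj_Phi X A k \<circ> h) (cs_carrier B)"
proof (rule extensionalityI)
  show "adj_Phi X B (restrict (Spec_map B A h \<circ> k) (space X)) \<in> extensional (cs_carrier B)"
    "restrict (adj_Phi X A k \<circ> h) (cs_carrier B) \<in> extensional (cs_carrier B)"
    by (auto simp: adj_Phi_def)
  fix b assume "b \<in> cs_carrier B"
  then show "adj_Phi X B (restrict (Spec_map B A h \<circ> k) (space X)) b =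
      restrict (adj_Phi X A k \<circ> h) (cs_carrier B) b"
    using star_hom_mem[OF sigma_star_hom_star_hom[OF h]] measurable_space[of k X "Spec A"] k
    by (auto simp: adj_Phi_def Spec_map_def meas_hom_def)
qed

section \<open>Countably complete ultrafilters and sobriety\<close>

text \<open>Properness and maximality both sit in the complement clause. Phrased with sets alone,
  the notion applies equally to characters and to zero-one measures.\<close>

definition sigma_ultra :: "'x measure \<Rightarrow> 'x set set \<Rightarrow> bool" where
  "sigma_ultra X U \<longleftrightarrow> U \<subseteq> sets X \<and> (\<forall>S\<in>sets X. space X - S \<in> U \<longleftrightarrow> S \<notin> U) \<and>
     (\<forall>S T. S \<in> U \<and> T \<in> sets X \<and> S \<subseteq> T \<longrightarrow> T \<in> U) \<and>
     (\<forall>F. (\<forall>n::nat. F n \<in> U) \<longrightarrow> (\<Inter>n. F n) \<in> U)"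

lemma
  assumes "sigma_ultra X U"
  shows sigma_ultra_sets: "S \<in> U \<Longrightarrow> S \<in> sets X"
    and sigma_ultra_compl: "S \<in> sets X \<Longrightarrow> space X - S \<in> U \<longleftrightarrow> S \<notin> U"
    and sigma_ultra_mono: "\<lbrakk>S \<in> U; T \<in> sets X; S \<subseteq> T\<rbrakk> \<Longrightarrow> T \<in> U"
    and sigma_ultra_INT: "(\<And>n::nat. F n \<in> U) \<Longrightarrow> (\<Inter>n. F n) \<in> U"
  using assms unfolding sigma_ultra_def by blast+

lemma sigma_ultra_empty: assumes "sigma_ultra X U" shows "{} \<notin> U"
proof
  assume "{} \<in> U"
  then have "space X - {} \<in> U" using sigma_ultra_mono[OF assms] by auto
  then show False using sigma_ultra_compl[OF assms, of "{}"] \<open>{} \<in> U\<close> by simp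
qed

lemma sigma_ultra_nonempty: "sigma_ultra X U \<Longrightarrow> S \<in> U \<Longrightarrow> S \<noteq> {}"
  using sigma_ultra_empty by blast

lemma sigma_ultra_Int:
  assumes "sigma_ultra X U" "S \<in> U" "T \<in> U" shows "S \<inter> T \<in> U"
proof -
  have "(\<Inter>n::nat. if n = 0 then S else T) \<in> U"
    using assms(2,3) by (intro sigma_ultra_INT[OF assms(1)]) simp
  moreover have "(\<Inter>n::nat. if n = 0 then S else T) = S \<inter> T"
    by (auto split: if_splits)
  ultimately show ?thesis by simp
qed

lemma sigma_ultra_space: "sigma_ultra X U \<Longrightarrow> space X \<in> U"
  using sigma_ultra_compl[of X U "{}"] sigma_ultra_empty by auto

lemma sigma_ultra_meets: "\<lbrakk>sigma_ultra X U; S \<in> U; T \<in> U\<rbrakk> \<Longrightarrow> S \<inter> T \<noteq> {}"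
  using sigma_ultra_Int sigma_ultra_empty by metis

text \<open>If no F n lay in U, all complements would, and so would their intersection, which is
  disjoint from the union.\<close>

lemma sigma_ultra_UN:
  assumes U: "sigma_ultra X U" and F: "\<And>n::nat. F n \<in> sets X"
  shows "(\<Union>n. F n) \<in> U \<longleftrightarrow> (\<exists>n. F n \<in> U)"
proof
  assume UN: "(\<Union>n. F n) \<in> U"
  show "\<exists>n. F n \<in> U"
  proof (rule ccontr)
    assume "\<not> (\<exists>n. F n \<in> U)"
    then have "(\<Inter>n. space X - F n) \<in> U"
      using sigma_ultra_compl[OF U F] by (intro sigma_ultra_INT[OF U]) auto
    then show False using sigma_ultra_meets[OF U UN] by fastforce
  qed
next
  assume "\<exists>n. F n \<in> U"
  then show "(\<Union>n. F n) \<in> U" using sigma_ultra_mono[OF U _ sets.countable_UN[of F UNIV]] F by blast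
qed

text \<open>Separability of the plane is what counts: for each radius 1 / (k + 1) countably many
  balls cover it, so the preimage of one of them lies in U. The intersection over k again lies in U,
  and f is constant on it.\<close>

lemma sigma_ultra_const:
  fixes f :: "'x \<Rightarrow> complex"
  assumes U: "sigma_ultra X U" and f: "f \<in> borel_measurable X"
  shows "\<exists>c. {x \<in> space X. f x = c} \<in> U"
proof -
  obtain D :: "complex set" where D: "countable D" "\<And>V. open V \<Longrightarrow> V \<noteq> {} \<Longrightarrow> \<exists>d\<in>D. d \<in> V"
    using countable_dense_exists by blast
  have "D \<noteq> {}" using D(2)[of UNIV] by auto
  define d where "d = from_nat_into D"
  let ?B = "\<lambda>e n. {x \<in> space X. dist (f x) (d n) < e}"
  have meas: "?B e n \<in> sets X" for e n using f by measurable
  have "\<exists>n. ?B e n \<in> U" if "e > 0" for e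
  proof -
    have "(\<Union>n. ?B e n) = space X"
    proof (intro equalityI subsetI)
      fix x assume "x \<in> space X"
      obtain y where y: "y \<in> D" "y \<in> ball (f x) e" using D(2)[of "ball (f x) e"] \<open>e > 0\<close> by auto
      then obtain n where "y = d n" using D(1) from_nat_into_surj d_def by metis
      then show "x \<in> (\<Union>n. ?B e n)" using y \<open>x \<in> space X\<close> by auto
    qed auto
    then have "(\<Union>n. ?B e n) \<in> U" using sigma_ultra_space[OF U] by simp
    then show ?thesis using sigma_ultra_UN[of X U "?B e", OF U meas] by blast
  qed
  then have "\<exists>n. ?B (inverse (real (Suc k))) n \<in> U" for k by simp
  then have "\<forall>k. \<exists>n. ?B (inverse (real (Suc k))) n \<in> U" by (rule allI)
  from choice[OF this] obtain n where n: "\<And>k. ?B (inverse (real (Suc k))) (n k) \<in> U" by blast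
  then have T: "(\<Inter>k. ?B (inverse (real (Suc k))) (n k)) \<in> U" by (rule sigma_ultra_INT[OF U])
  then have "(\<Inter>k. ?B (inverse (real (Suc k))) (n k)) \<noteq> {}"
    by (rule sigma_ultra_nonempty[OF U])
  then obtain x0 where x0: "x0 \<in> (\<Inter>k. ?B (inverse (real (Suc k))) (n k))" by (meson ex_in_conv)
  have "(\<Inter>k. ?B (inverse (real (Suc k))) (n k)) \<subseteq> {x \<in> space X. f x = f x0}"
  proof
    fix x assume x: "x \<in> (\<Inter>k. ?B (inverse (real (Suc k))) (n k))"
    have "dist (f x) (f x0) \<le> 0"
    proof (rule field_le_epsilon)
      fix e :: real assume "e > 0"
      then obtain k where k: "inverse (real (Suc k)) < e / 2"
        using reals_Archimedean[of "e / 2"] by auto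
      have "dist (f x) (d (n k)) < inverse (real (Suc k))" "dist (f x0) (d (n k)) < inverse (real (Suc k))"
        using x x0 by auto
      then show "dist (f x) (f x0) \<le> 0 + e"
        using dist_triangle2[of "f x" "f x0" "d (n k)"] k by linarith
    qed
    then show "x \<in> {x \<in> space X. f x = f x0}" using x by auto
  qed
  moreover have "{x \<in> space X. f x = f x0} \<in> sets X" using f by measurable
  ultimately have "{x \<in> space X. f x = f x0} \<in> U" using sigma_ultra_mono[OF U T] by blast
  then show ?thesis by blast
qed

text \<open>The candidate character sends each element to its almost everywhere constant value. Any countable
  set of these values is attained by an actual character, and every axiom of a character only involves
  countably many elements.\<close>

lemma sigma_ultra_Spec_principal:
  assumes A: "comm_cstar A" and U: "sigma_ultra (Spec A) U"
  obtains \<phi> where "\<phi> \<in> spec_space A" "\<And>S. S \<in> sets (Spec A) \<Longrightarrow> S \<in> U \<longleftrightarrow> \<phi> \<in> S"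
proof -
  interpret comm_cstar A by fact
  have "\<forall>a\<in>C. \<exists>c. {\<psi> \<in> spec_space A. \<psi> a = c} \<in> U"
    using sigma_ultra_const[OF U measurable_Spec_eval] by simp
  from bchoice[OF this] obtain v where "\<forall>a\<in>C. {\<psi> \<in> spec_space A. \<psi> a = v a} \<in> U" by (rule exE)
  then have v: "{\<psi> \<in> spec_space A. \<psi> a = v a} \<in> U" if "a \<in> C" for a using that by (rule bspec)
  have attained: "\<exists>\<psi>. sigma_star_hom A complex_cs \<psi> \<and> (\<forall>a\<in>K. \<psi> a = v a)"
    if K: "countable K" "K \<subseteq> C" "K \<noteq> {}" for K
  proof -
    have "(\<Inter>n. {\<psi> \<in> spec_space A. \<psi> (from_nat_into K n) = v (from_nat_into K n)}) \<in> U"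
      using v K from_nat_into[OF K(3)] by (intro sigma_ultra_INT[OF U]) auto
    then have "(\<Inter>n. {\<psi> \<in> spec_space A. \<psi> (from_nat_into K n) = v (from_nat_into K n)}) \<noteq> {}"
      by (rule sigma_ultra_nonempty[OF U])
    then obtain \<psi> where \<psi>: "\<And>n. \<psi> \<in> spec_space A \<and> \<psi> (from_nat_into K n) = v (from_nat_into K n)"
      by blast
    then have "\<forall>a\<in>K. \<psi> a = v a" using from_nat_into_surj[OF K(1)] by metis
    then show ?thesis using \<psi> spec_space_hom by blast
  qed
  have hom: "sigma_star_hom A complex_cs v"
  proof (rule sigma_star_homI)
    have "v (x \<^bold>+ y) = v x + v y \<and> v (x \<^bold>* y) = v x * v y \<and> v (c \<^bold>\<cdot> x) = c * v x \<and>
        v (star x) = cnj (v x) \<and> v \<^bold>1 = 1" if xy: "x \<in> C" "y \<in> C" for x y c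
    proof -
      \<comment> \<open>All algebraic axioms for this x, y and c are equations between values at
        these seven elements, so one character agreeing with v on them suffices.\<close>
      let ?K = "{x, y, x \<^bold>+ y, x \<^bold>* y, c \<^bold>\<cdot> x, star x, \<^bold>1}"
      have "\<exists>\<psi>. sigma_star_hom A complex_cs \<psi> \<and> (\<forall>a\<in>?K. \<psi> a = v a)"
        using xy by (intro attained) auto
      then obtain \<psi> where \<psi>: "star_hom A complex_cs \<psi>" "\<And>a. a \<in> ?K \<Longrightarrow> v a = \<psi> a"
        using sigma_star_hom_star_hom by metis
      show ?thesis using xy star_hom_add[OF \<psi>(1)] star_hom_mult[OF \<psi>(1)] star_hom_scale[OF \<psi>(1)]
          star_hom_star[OF \<psi>(1)] star_hom_one[OF \<psi>(1)] by (simp add: \<psi>(2))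
    qed
    then show "star_hom A complex_cs v"
      unfolding star_hom_def cs_linear_def using one_mem by (simp, blast)
    show "cs_is_sup complex_cs (\<lambda>k. v (a k)) (v s)" if a: "cs_bdd_incseq A a" "cs_is_sup A a s" for a s
    proof -
      \<comment> \<open>Normality involves an entire sequence and its supremum, which is still a
        countable set of elements.\<close>
      have "\<exists>\<psi>. sigma_star_hom A complex_cs \<psi> \<and> (\<forall>b\<in>insert s (range a). \<psi> b = v b)"
        using bdd_incseq_mem[OF a(1)] is_sup_mem[OF a(2)] by (intro attained) auto
      then obtain \<psi> where \<psi>: "sigma_star_hom A complex_cs \<psi>" "\<And>b. b \<in> insert s (range a) \<Longrightarrow> v b = \<psi> b"
        by metis
      show ?thesis using sigma_star_hom_sup[OF \<psi>(1) a] by (simp add: \<psi>(2))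
    qed
  qed
  define \<phi> where "\<phi> = restrict v C"
  have \<phi>: "\<phi> \<in> spec_space A" unfolding \<phi>_def by (rule spec_space_restrictI[OF A hom])
  \<comment> \<open>Agreement of U with the principal ultrafilter passes to complements and
    countable unions. It remains to check generators, and the set where the evaluation at a takes
    values in T is decided by \<open>v a\<close>.\<close>
  have "S \<in> U \<longleftrightarrow> \<phi> \<in> S" if "S \<in> sets (Spec A)" for S
    using that unfolding sets_Spec
  proof (induction rule: sigma_sets.induct)
    case (Basic S)
    then obtain a T where a: "a \<in> C" "T \<in> sets borel" and S: "S = {\<phi> \<in> spec_space A. \<phi> a \<in> T}" by auto
    have SS: "S \<in> sets (Spec A)" unfolding sets_Spec using Basic by (rule sigma_sets.Basic)
    have "\<phi> \<in> S \<longleftrightarrow> v a \<in> T" using \<phi> a by (simp add: S \<phi>_def)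
    moreover have "S \<in> U" if "v a \<in> T"
      using that S by (intro sigma_ultra_mono[OF U v[OF a(1)] SS]) auto
    moreover have "S \<notin> U" if "v a \<notin> T"
      using that sigma_ultra_meets[OF U v[OF a(1)], of S] by (auto simp: S)
    ultimately show ?case by blast
  next
    case Empty then show ?case using sigma_ultra_empty[OF U] by simp
  next
    case (Compl S)
    then have "S \<in> sets (Spec A)" by (simp add: sets_Spec)
    from sigma_ultra_compl[OF U this] Compl.IH \<phi> show ?case by simp
  next
    case (Union F)
    then have "F n \<in> sets (Spec A)" for n by (simp add: sets_Spec)
    from sigma_ultra_UN[of _ U F, OF U this] Union.IH show ?case by simp
  qed
  with \<phi> show thesis using that by blast
qed

section \<open>Characters of algebras of bounded measurable functions\<close>

abbreviation chi :: "'x set \<Rightarrow> 'x \<Rightarrow> complex" where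
  "chi S \<equiv> indicator S"

lemma chi_Linf: "S \<in> sets X \<Longrightarrow> chi S \<in> Linf_set X"
  by (rule Linf_setI[where M = 1]) (auto simp: indicator_def dest: sets.sets_into_space)

text \<open>Indicators are idempotent, so a character takes only the values 0 and 1 on them;
  intersections correspond to products, and normality supplies the countable case.\<close>

lemma sigma_ultra_of_character:
  assumes \<psi>: "\<psi> \<in> spec_space (Linf X)"
  shows "sigma_ultra X {S \<in> sets X. \<psi> (chi S) = 1}" (is "sigma_ultra X ?U")
proof -
  interpret comm_cstar "Linf X" by (rule comm_cstar_Linf)
  have hom: "sigma_star_hom (Linf X) complex_cs \<psi>" using spec_space_hom[OF \<psi>] .
  note sh = sigma_star_hom_star_hom[OF hom]
  have mult: "\<psi> (\<lambda>x. f x * g x) = \<psi> f * \<psi> g" if "f \<in> Linf_set X" "g \<in> Linf_set X" for f g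
    using star_hom_mult[OF sh] that by simp
  have compl: "\<psi> (chi (space X - S)) = 1 - \<psi> (chi S)" if S: "S \<in> sets X" for S
  proof -
    have "(\<lambda>x. chi S x + chi (space X - S) x) = (\<lambda>x. if x \<in> space X then 1 else 0)"
      using sets.sets_into_space[OF S] by (auto simp: fun_eq_iff indicator_def)
    then have "\<psi> (chi S) + \<psi> (chi (space X - S)) = 1"
      using star_hom_add[OF sh, of "chi S" "chi (space X - S)"] star_hom_one[OF sh]
        chi_Linf[OF S] chi_Linf[of "space X - S" X] S by auto
    then show ?thesis by (simp add: algebra_simps)
  qed
  have Int: "\<psi> (chi (S \<inter> T)) = \<psi> (chi S) * \<psi> (chi T)" if "S \<in> sets X" "T \<in> sets X" for S T
    using mult[OF chi_Linf[OF that(1)] chi_Linf[OF that(2)]] by (simp add: indicator_inter_arith[abs_def])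
  have idem: "\<psi> (chi S) = 0 \<or> \<psi> (chi S) = 1" if "S \<in> sets X" for S
    using Int[OF that that] by auto
  have "(\<Inter>n. F n) \<in> ?U" if F: "\<And>n::nat. F n \<in> ?U" for F
  proof -
    \<comment> \<open>Partial intersections decrease, whereas normality is about increasing
      sequences; it is therefore applied to their complements, on which \<psi> vanishes.\<close>
    define G where "G n = (\<Inter>k\<le>n. F k)" for n
    have GS: "G n \<in> sets X" for n unfolding G_def using F by (intro sets.finite_INT) auto
    have G1: "\<psi> (chi (G n)) = 1" for n
    proof (induction n)
      case 0 then show ?case using F[of 0] by (simp add: G_def)
    next
      case (Suc n)
      have "G (Suc n) = F (Suc n) \<inter> G n" by (auto simp: G_def atMost_Suc)
      then show ?case using Int[of "F (Suc n)" "G n"] F[of "Suc n"] GS Suc by simp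
    qed
    have INT: "(\<Inter>n. F n) = (\<Inter>n. G n)" by (auto simp: G_def)
    have IS: "(\<Inter>n. G n) \<in> sets X" using GS by auto
    let ?a = "\<lambda>n. chi (space X - G n)" and ?s = "chi (space X - (\<Inter>n. G n))"
    have aS: "?a n \<in> Linf_set X" for n using GS by (intro chi_Linf) auto
    have sS: "?s \<in> Linf_set X" using IS by (intro chi_Linf) auto
    have Gdec: "x \<in> G (Suc n) \<Longrightarrow> x \<in> G n" for x n by (auto simp: G_def)
    have "cs_bdd_incseq (Linf X) ?a"
      unfolding cs_bdd_incseq_def cs_selfadj_Linf cs_le_Linf cs_le_complex
    proof (intro conjI allI exI[of _ 1])
      show "cs_norm (Linf X) (?a n) \<le> 1" for n
        unfolding Linf_sel by (rule Linf_norm_le) (auto simp: indicator_def)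
    qed (use aS Gdec in \<open>auto simp: indicator_def\<close>)
    moreover have "cs_is_sup (Linf X) ?a ?s"
    proof (rule cs_is_sup_LinfI[OF sS aS])
      fix x
      show "cs_is_sup complex_cs (\<lambda>n. ?a n x) (?s x)"
      proof (cases "\<exists>n. x \<in> space X \<and> x \<notin> G n")
        case True
        then obtain m where "x \<in> space X" "x \<notin> G m" by blast
        then show ?thesis
          by (auto simp: cs_is_sup_complex indicator_def dest: spec[of _ m])
      next
        case False
        then have "?a n x = 0" "?s x = 0" for n by (auto simp: indicator_def)
        then show ?thesis by (simp add: cs_is_sup_complex_const)
      qed
    qed
    ultimately have "cs_is_sup complex_cs (\<lambda>n. \<psi> (?a n)) (\<psi> ?s)"
      by (rule sigma_star_hom_sup[OF hom])
    then have "cs_is_sup complex_cs (\<lambda>n. 0) (\<psi> ?s)" using compl[OF GS] G1 by simp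
    then have "\<psi> ?s = 0" using cs_is_sup_complex_unique cs_is_sup_complex_const[of 0] by fastforce
    then show ?thesis using compl[OF IS] IS INT by simp
  qed
  moreover have "space X - S \<in> ?U \<longleftrightarrow> S \<notin> ?U" if "S \<in> sets X" for S
    using that compl[OF that] idem[OF that] by auto
  moreover have "T \<in> ?U" if "S \<in> ?U" "T \<in> sets X" "S \<subseteq> T" for S T
    using that Int[of S T] by (auto simp: Int_absorb2)
  ultimately show ?thesis unfolding sigma_ultra_def by blast
qed

text \<open>On the set E in the ultrafilter where f has the constant value c, the products of f and
  of c with the indicator agree. As \<psi> is 1 on that indicator, \<psi> f = c follows at once,
  without approximation by simple functions.\<close>

lemma character_const:
  assumes \<psi>: "\<psi> \<in> spec_space (Linf X)" and f: "f \<in> Linf_set X"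
  shows "\<psi> (chi {x \<in> space X. f x = \<psi> f}) = 1"
proof -
  note sh = sigma_star_hom_star_hom[OF spec_space_hom[OF \<psi>]]
  obtain c where c: "{x \<in> space X. f x = c} \<in> {S \<in> sets X. \<psi> (chi S) = 1}"
    using sigma_ultra_const[OF sigma_ultra_of_character[OF \<psi>] Linf_set_measurable[OF f]] by blast
  let ?E = "{x \<in> space X. f x = c}"
  have E: "chi ?E \<in> Linf_set X" using c by (intro chi_Linf) auto
  have "(\<lambda>x. f x * chi ?E x) = (\<lambda>x. c * chi ?E x)" by (auto simp: fun_eq_iff indicator_def)
  then have "\<psi> f * \<psi> (chi ?E) = c * \<psi> (chi ?E)"
    using star_hom_mult[OF sh, of f "chi ?E"] star_hom_scale[OF sh, of "chi ?E" c] f E by simp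
  then have "\<psi> f = c" using c by simp
  then show ?thesis using c by simp
qed

text \<open>The level set of f at height \<psi> f belongs to the ultrafilter of \<psi>, which is
  that of x, so it contains x.\<close>

lemma character_eq_eval:
  assumes \<psi>: "\<psi> \<in> spec_space (Linf X)" and x: "x \<in> space X"
    and S: "\<And>S. S \<in> sets X \<Longrightarrow> \<psi> (chi S) = 1 \<longleftrightarrow> x \<in> S"
  shows "\<psi> = adj_unit X x"
proof (rule extensionalityI)
  show "\<psi> \<in> extensional (Linf_set X)" using spec_space_ext[OF \<psi>] by simp
  show "adj_unit X x \<in> extensional (Linf_set X)" using x by (simp add: adj_unit_def)
  fix f assume f: "f \<in> Linf_set X"
  have "{y \<in> space X. f y = \<psi> f} \<in> sets X" using Linf_set_measurable[OF f] by measurable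
  then have "f x = \<psi> f" using S character_const[OF \<psi> f] by auto
  then show "\<psi> f = adj_unit X x f" using f x by (simp add: adj_unit_def)
qed

lemma adj_unit_measurable: "adj_unit X \<in> measurable X (Spec (Linf X))"
proof (rule measurable_SpecI)
  show "adj_unit X x \<in> spec_space (Linf X)" if "x \<in> space X" for x
    using spec_space_restrictI[OF comm_cstar_Linf sigma_star_hom_eval[OF that]] that
    by (simp add: adj_unit_def)
  show "(\<lambda>x. adj_unit X x f) \<in> borel_measurable X" if "f \<in> cs_carrier (Linf X)" for f
    using that Linf_set_measurable[of f X]
    by (subst measurable_cong[where g = f]) (auto simp: adj_unit_def)
qed

text \<open>Measurability of the inverse comes for free: it pulls S back to the set of characters
  with value 1 on \<open>chi S\<close>, which is measurable because evaluation at
  \<open>chi S\<close> is.\<close>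

lemma meas_iso_adj_unit:
  assumes bij: "bij_betw (adj_unit X) (space X) (spec_space (Linf X))"
  shows "meas_iso X (Spec (Linf X)) (adj_unit X)"
proof -
  define g where "g = the_inv_into (space X) (adj_unit X)"
  have inj: "inj_on (adj_unit X) (space X)" using bij by (simp add: bij_betw_def)
  have gf: "g (adj_unit X x) = x" if "x \<in> space X" for x
    using the_inv_into_f_f[OF inj that] by (simp add: g_def)
  have fg: "adj_unit X (g \<psi>) = \<psi>" if "\<psi> \<in> spec_space (Linf X)" for \<psi>
    using f_the_inv_into_f_bij_betw[OF bij] that by (simp add: g_def)
  have gS: "g \<psi> \<in> space X" if "\<psi> \<in> spec_space (Linf X)" for \<psi>
    using bij_betw_the_inv_into[OF bij] that by (auto simp: g_def bij_betw_def)
  have "g \<in> measurable (Spec (Linf X)) X"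
  proof (rule measurableI)
    fix S assume S: "S \<in> sets X"
    have "chi S (g \<psi>) = \<psi> (chi S)" if "\<psi> \<in> spec_space (Linf X)" for \<psi>
      using fun_cong[OF fg[OF that], of "chi S"] gS[OF that] chi_Linf[OF S] by (simp add: adj_unit_def)
    then have "\<psi> (chi S) = 1 \<longleftrightarrow> g \<psi> \<in> S" if "\<psi> \<in> spec_space (Linf X)" for \<psi>
      using that by (metis indicator_eq_1_iff)
    then have "g -` S \<inter> space (Spec (Linf X)) = (\<lambda>\<psi>. \<psi> (chi S)) -` {1} \<inter> space (Spec (Linf X))"
      by auto
    also have "\<dots> \<in> sets (Spec (Linf X))"
      using chi_Linf[OF S] by (intro measurable_sets[OF measurable_Spec_eval]) auto
    finally show "g -` S \<inter> space (Spec (Linf X)) \<in> sets (Spec (Linf X))" .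
  qed (use gS in simp)
  then show ?thesis unfolding meas_iso_def using adj_unit_measurable bij gf fg by auto
qed

lemma adj_unit_eqD:
  assumes "x \<in> space X" "y \<in> space X"
    and "adj_unit X x = adj_unit X y" "S \<in> sets X"
  shows "x \<in> S \<longleftrightarrow> y \<in> S"
proof -
  have "chi S x = chi S y"
    using fun_cong[OF assms(3), of "chi S"] chi_Linf[OF assms(4)] assms(1,2) by (simp add: adj_unit_def)
  then show ?thesis by (simp add: indicator_def of_bool_eq_iff)
qed

lemma Spec_separated:
  assumes "\<phi> \<in> spec_space A" "\<psi> \<in> spec_space A" "\<And>S. S \<in> sets (Spec A) \<Longrightarrow> \<phi> \<in> S \<longleftrightarrow> \<psi> \<in> S"
  shows "\<phi> = \<psi>"
proof (rule extensionalityI[OF spec_space_ext[OF assms(1)] spec_space_ext[OF assms(2)]])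
  fix a assume a: "a \<in> cs_carrier A"
  have "{\<eta> \<in> space (Spec A). \<eta> a = \<psi> a} \<in> sets (Spec A)" using measurable_Spec_eval[OF a] by measurable
  from assms(3)[OF this] show "\<phi> a = \<psi> a" using assms by simp
qed

text \<open>Surjectivity is the principality of ultrafilters on a spectrum, applied to the
  ultrafilter that a character of \<open>Linf (Spec A)\<close> determines.\<close>

lemma bij_betw_adj_unit_Spec:
  assumes A: "comm_cstar A"
  shows "bij_betw (adj_unit (Spec A)) (spec_space A) (spec_space (Linf (Spec A)))"
proof (rule bij_betwI')
  fix \<phi> \<psi> assume "\<phi> \<in> spec_space A" "\<psi> \<in> spec_space A"
  then show "(adj_unit (Spec A) \<phi> = adj_unit (Spec A) \<psi>) = (\<phi> = \<psi>)"
    using adj_unit_eqD[of \<phi> "Spec A" \<psi>] Spec_separated[of \<phi> A \<psi>] by auto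
next
  fix \<phi> assume "\<phi> \<in> spec_space A"
  then show "adj_unit (Spec A) \<phi> \<in> spec_space (Linf (Spec A))"
    using measurable_space[OF adj_unit_measurable, of \<phi> "Spec A"] by simp
next
  fix \<psi> assume \<psi>: "\<psi> \<in> spec_space (Linf (Spec A))"
  obtain \<phi> where \<phi>: "\<phi> \<in> spec_space A"
    "\<And>S. S \<in> sets (Spec A) \<Longrightarrow> S \<in> {S \<in> sets (Spec A). \<psi> (chi S) = 1} \<longleftrightarrow> \<phi> \<in> S"
    using sigma_ultra_Spec_principal[OF A sigma_ultra_of_character[OF \<psi>]] by blast
  then have "\<psi> = adj_unit (Spec A) \<phi>" by (intro character_eq_eval[OF \<psi>]) auto
  with \<phi> show "\<exists>\<phi>\<in>spec_space A. \<psi> = adj_unit (Spec A) \<phi>" by blast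
qed

section \<open>Zero-one measures and sobriety\<close>

lemma return_zero_one:
  assumes "x \<in> space X"
  shows "return X x \<in> {\<mu>. sets \<mu> = sets X \<and> prob_space \<mu> \<and> (\<forall>S\<in>sets X. emeasure \<mu> S = 0 \<or> emeasure \<mu> S = 1)}"
  using assms by (auto simp: prob_space_return indicator_def)

text \<open>Measure 1 means almost everywhere, and countably many almost everywhere statements may
  be combined.\<close>

lemma sigma_ultra_of_measure:
  assumes \<mu>: "sets \<mu> = sets X" "prob_space \<mu>" "\<forall>S\<in>sets X. emeasure \<mu> S = 0 \<or> emeasure \<mu> S = 1"
  shows "sigma_ultra X {S \<in> sets X. emeasure \<mu> S = 1}" (is "sigma_ultra X ?U")
proof -
  interpret prob_space \<mu> by fact
  have sp: "space \<mu> = space X" using sets_eq_imp_space_eq[OF \<mu>(1)] .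
  have AE: "S \<in> ?U \<longleftrightarrow> (AE x in \<mu>. x \<in> S)" if "S \<in> sets X" for S
    using that AE_in_set_eq_1[of S] \<mu>(1) by (auto simp: emeasure_eq_measure)
  have "space X - S \<in> ?U \<longleftrightarrow> S \<notin> ?U" if S: "S \<in> sets X" for S
    using prob_compl[of S] S \<mu>(1,3) sp by (auto simp: emeasure_eq_measure)
  moreover have "T \<in> ?U" if "S \<in> ?U" "T \<in> sets X" "S \<subseteq> T" for S T
    using that AE[of S] AE[of T] by (auto elim: eventually_mono)
  moreover have "(\<Inter>n. F n) \<in> ?U" if F: "\<And>n::nat. F n \<in> ?U" for F
  proof -
    have "(\<Inter>n. F n) \<in> sets X" using F by auto
    moreover have "AE x in \<mu>. \<forall>n. x \<in> F n" using F AE by (subst AE_all_countable) auto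
    ultimately show ?thesis using AE[of "\<Inter>n. F n"] by simp
  qed
  ultimately show ?thesis unfolding sigma_ultra_def by blast
qed

text \<open>Disjoint sets cannot both lie in U, so at most one term of a disjoint union contributes
  to the sum, and one does exactly when the union lies in U.\<close>

lemma measure_of_sigma_ultra:
  assumes U: "sigma_ultra X U"
  obtains \<mu> where "sets \<mu> = sets X" "prob_space \<mu>" "\<And>S. S \<in> sets X \<Longrightarrow> emeasure \<mu> S = (if S \<in> U then 1 else 0)"
proof -
  define m :: "'a set \<Rightarrow> ennreal" where "m S = (if S \<in> U then 1 else 0)" for S
  define \<mu> where "\<mu> = measure_of (space X) (sets X) m"
  have "countably_additive (sets X) m"
  proof (rule countably_additiveI)
    fix F :: "nat \<Rightarrow> 'a set" assume F: "range F \<subseteq> sets X" "disjoint_family F"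
    then have FS: "\<And>n. F n \<in> sets X" by auto
    show "(\<Sum>i. m (F i)) = m (\<Union>i. F i)"
    proof (cases "\<exists>n. F n \<in> U")
      case True
      then obtain n where n: "F n \<in> U" by blast
      have "F i \<notin> U" if "i \<noteq> n" for i
        using sigma_ultra_meets[OF U n] F(2) that by (auto simp: disjoint_family_on_def)
      then have "m (F i) = (if i = n then 1 else 0)" for i using n by (auto simp: m_def)
      then have "(\<lambda>i. m (F i)) sums 1" using sums_single[of n "\<lambda>_. 1::ennreal"] by simp
      then show ?thesis using sigma_ultra_UN[OF U, of F] FS True by (auto simp: m_def sums_iff)
    next
      case False
      then show ?thesis using sigma_ultra_UN[OF U, of F] FS by (auto simp: m_def)
    qed
  qed
  then have em: "emeasure \<mu> S = m S" if "S \<in> sets X" for S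
    unfolding \<mu>_def using that sigma_ultra_empty[OF U]
    by (intro emeasure_measure_of_sigma sets.sigma_algebra_axioms) (auto simp: positive_def m_def)
  have sets: "sets \<mu> = sets X" by (simp add: \<mu>_def)
  have "prob_space \<mu>"
    using em[OF sets.top] sigma_ultra_space[OF U] by (intro prob_spaceI) (simp add: \<mu>_def m_def)
  with sets em show thesis using that by (simp add: m_def)
qed

lemma sober_Spec:
  assumes A: "comm_cstar A" shows "sober (Spec A)"
  unfolding sober_def
proof (rule bij_betwI')
  fix \<phi> \<psi> assume \<phi>\<psi>: "\<phi> \<in> space (Spec A)" "\<psi> \<in> space (Spec A)"
  show "(return (Spec A) \<phi> = return (Spec A) \<psi>) = (\<phi> = \<psi>)"
  proof
    assume eq: "return (Spec A) \<phi> = return (Spec A) \<psi>"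
    have "\<phi> \<in> S \<longleftrightarrow> \<psi> \<in> S" if "S \<in> sets (Spec A)" for S
      using arg_cong[OF eq, of "\<lambda>\<mu>. emeasure \<mu> S"] that by (auto simp: indicator_def split: if_splits)
    then show "\<phi> = \<psi>" using Spec_separated[of \<phi> A \<psi>] \<phi>\<psi> by simp
  qed simp
next
  fix \<mu> assume "\<mu> \<in> {\<mu>. sets \<mu> = sets (Spec A) \<and> prob_space \<mu> \<and>
      (\<forall>S\<in>sets (Spec A). emeasure \<mu> S = 0 \<or> emeasure \<mu> S = 1)}"
  then have \<mu>: "sets \<mu> = sets (Spec A)" "prob_space \<mu>"
    "\<forall>S\<in>sets (Spec A). emeasure \<mu> S = 0 \<or> emeasure \<mu> S = 1" by auto
  obtain \<phi> where \<phi>: "\<phi> \<in> spec_space A"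
    "\<And>S. S \<in> sets (Spec A) \<Longrightarrow> S \<in> {S \<in> sets (Spec A). emeasure \<mu> S = 1} \<longleftrightarrow> \<phi> \<in> S"
    using sigma_ultra_Spec_principal[OF A sigma_ultra_of_measure[OF \<mu>]] by blast
  have "\<mu> = return (Spec A) \<phi>"
  proof (rule measure_eqI)
    show "emeasure \<mu> S = emeasure (return (Spec A) \<phi>) S" if "S \<in> sets \<mu>" for S
      using that \<phi>(2)[of S] \<mu> by (auto simp: indicator_def)
  qed (simp add: \<mu>)
  with \<phi> show "\<exists>\<phi>\<in>space (Spec A). \<mu> = return (Spec A) \<phi>" by auto
qed (rule return_zero_one)

text \<open>For surjectivity, a character gives an ultrafilter, the ultrafilter a zero-one measure,
  and sobriety a point at which the character must be evaluation.\<close>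

lemma bij_betw_adj_unit_sober:
  assumes "sober X"
  shows "bij_betw (adj_unit X) (space X) (spec_space (Linf X))"
proof (rule bij_betwI')
  have bij: "bij_betw (return X) (space X)
     {\<mu>. sets \<mu> = sets X \<and> prob_space \<mu> \<and> (\<forall>S\<in>sets X. emeasure \<mu> S = 0 \<or> emeasure \<mu> S = 1)}"
    using assms by (simp add: sober_def)
  fix x y assume xy: "x \<in> space X" "y \<in> space X"
  show "(adj_unit X x = adj_unit X y) = (x = y)"
  proof
    assume "adj_unit X x = adj_unit X y"
    then have "return X x = return X y"
      using adj_unit_eqD[OF xy] by (intro measure_eqI) (auto simp: indicator_def)
    then show "x = y" using bij xy by (auto simp: bij_betw_def inj_on_def)
  qed simp
next
  fix x assume "x \<in> space X"
  then show "adj_unit X x \<in> spec_space (Linf X)"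
    using measurable_space[OF adj_unit_measurable, of x X] by simp
next
  fix \<psi> assume \<psi>: "\<psi> \<in> spec_space (Linf X)"
  obtain \<mu> where \<mu>: "sets \<mu> = sets X" "prob_space \<mu>"
    "\<And>S. S \<in> sets X \<Longrightarrow> emeasure \<mu> S = (if S \<in> {S \<in> sets X. \<psi> (chi S) = 1} then 1 else 0)"
    using measure_of_sigma_ultra[OF sigma_ultra_of_character[OF \<psi>]] by blast
  then have "\<mu> \<in> return X ` space X"
    using assms by (auto simp: sober_def bij_betw_def)
  then obtain x where x: "x \<in> space X" "\<mu> = return X x" by blast
  have "\<psi> (chi S) = 1 \<longleftrightarrow> x \<in> S" if "S \<in> sets X" for S
    using \<mu>(3)[OF that] that unfolding x(2) by (auto simp: indicator_def split: if_splits)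
  then have "\<psi> = adj_unit X x" by (intro character_eq_eval[OF \<psi> x(1)])
  with x show "\<exists>x\<in>space X. \<psi> = adj_unit X x" by blast
qed

section \<open>The counit\<close>

lemma sigma_star_hom_adj_counit:
  assumes A: "comm_cstar A" shows "sigma_star_hom A (Linf (Spec A)) (adj_counit A)"
  unfolding adj_counit_def
  by (intro sigma_star_hom_adj_Phi[OF A] measurable_SpecI)
     (use measurable_Spec_eval in \<open>auto intro: measurable_cong[THEN iffD1, OF _ measurable_Spec_eval]\<close>)

lemma adj_counit_apply:
  "\<lbrakk>a \<in> cs_carrier A; \<phi> \<in> spec_space A\<rbrakk> \<Longrightarrow> adj_counit A a \<phi> = \<phi> a"
  by (simp add: adj_counit_def adj_Phi_def)

text \<open>Pullback along the unit is the inverse, and one composite is a triangle identity. For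
  the other, a character \<psi> composed with this pullback is evaluation at some \<phi>, since the
  unit at a spectrum is surjective; testing on the image of the counit shows \<phi> =
  \<psi>.\<close>

lemma alg_iso_adj_counit_Linf: "alg_iso (Linf X) (Linf (Spec (Linf X))) (adj_counit (Linf X))"
proof -
  let ?Y = "Spec (Linf X)"
  let ?k = "Linf_map X ?Y (adj_unit X)"
  have k: "sigma_star_hom (Linf ?Y) (Linf X) ?k" by (rule sigma_star_hom_Linf_map[OF adj_unit_measurable])
  note h = sigma_star_hom_adj_counit[OF comm_cstar_Linf, of X]
  have hmem: "adj_counit (Linf X) f \<in> Linf_set ?Y" if "f \<in> Linf_set X" for f
    using star_hom_mem[OF sigma_star_hom_star_hom[OF h]] that by simp
  have kmem: "?k g \<in> Linf_set X" if "g \<in> Linf_set ?Y" for g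
    using star_hom_mem[OF sigma_star_hom_star_hom[OF k]] that by simp
  have unit: "adj_unit X x \<in> spec_space (Linf X)" if "x \<in> space X" for x
    using measurable_space[OF adj_unit_measurable that] by simp
  have kh: "?k (adj_counit (Linf X) f) = f" if f: "f \<in> Linf_set X" for f
  proof
    show "?k (adj_counit (Linf X) f) x = f x" for x
      using hmem[OF f] f unit[of x] adj_counit_apply[of f "Linf X" "adj_unit X x"] Linf_set_outside[OF f, of x]
      by (auto simp: Linf_map_def adj_unit_def)
  qed
  have hk: "adj_counit (Linf X) (?k g) = g" if g: "g \<in> Linf_set ?Y" for g
  proof
    fix \<psi>
    show "adj_counit (Linf X) (?k g) \<psi> = g \<psi>"
    proof (cases "\<psi> \<in> spec_space (Linf X)")
      case False
      then show ?thesis using Linf_set_outside[OF hmem[OF kmem[OF g]]] Linf_set_outside[OF g] by simp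
    next
      case \<psi>: True
      have "Spec_map (Linf ?Y) (Linf X) ?k \<psi> \<in> spec_space (Linf ?Y)"
        using measurable_space[OF Spec_map_measurable[OF comm_cstar_Linf comm_cstar_Linf k]] \<psi> by simp
      then obtain \<phi> where \<phi>: "\<phi> \<in> spec_space (Linf X)"
        "Spec_map (Linf ?Y) (Linf X) ?k \<psi> = adj_unit ?Y \<phi>"
        using bij_betw_adj_unit_Spec[OF comm_cstar_Linf, of X] by (auto simp: bij_betw_def)
      have ev: "\<psi> (?k g) = g \<phi>" if "g \<in> Linf_set ?Y" for g
        using fun_cong[OF \<phi>(2), of g] that \<phi>(1) \<psi> by (simp add: Spec_map_def adj_unit_def)
      have "\<phi> = \<psi>"
      proof (rule extensionalityI[OF spec_space_ext[OF \<phi>(1)] spec_space_ext[OF \<psi>]])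
        fix f assume "f \<in> cs_carrier (Linf X)"
        then show "\<phi> f = \<psi> f"
          using ev[OF hmem, of f] kh[of f] adj_counit_apply[of f "Linf X" \<phi>] \<phi>(1) by simp
      qed
      then show ?thesis using ev[OF g] adj_counit_apply[of "?k g" "Linf X" \<psi>] kmem[OF g] \<psi> by simp
    qed
  qed
  show ?thesis unfolding alg_iso_def
    using h k kh hk by (intro conjI exI[of _ ?k]) auto
qed

section \<open>Pure states and the counit\<close>

lemma
  assumes "cs_state A \<psi>"
  shows state_add: "\<lbrakk>x \<in> cs_carrier A; y \<in> cs_carrier A\<rbrakk> \<Longrightarrow> \<psi> (cs_add A x y) = \<psi> x + \<psi> y"
    and state_scale: "x \<in> cs_carrier A \<Longrightarrow> \<psi> (cs_scale A c x) = c * \<psi> x"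
    and state_one: "\<psi> (cs_one A) = 1"
    and state_pos: "cs_positive A x \<Longrightarrow> Im (\<psi> x) = 0 \<and> 0 \<le> Re (\<psi> x)"
  using assms by (auto simp: cs_state_def pos_unital_map_def cs_linear_def cs_positive_complex)

lemma zero_if_multiples_bounded_below:
  fixes z :: real assumes "\<And>r. -1 \<le> r * z" shows "z = 0"
  using assms[of "2 / z"] assms[of "- 2 / z"] by (cases "z = 0") auto

text \<open>The real part is real-linear in l, so a lower bound forces it to vanish; comparing l = 1
  with l = \<i> then isolates q.\<close>

lemma linear_form_bounded_below_zero:
  fixes p q :: complex
  assumes "\<And>l. Im (cnj l * p + l * q) = 0 \<and> -1 \<le> Re (cnj l * p + l * q)"
  shows "q = 0"
proof -
  have zero: "cnj l * p + l * q = 0" for l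
  proof -
    let ?z = "Re (cnj l * p + l * q)"
    have "Re (cnj (of_real r * l) * p + (of_real r * l) * q) = r * ?z" for r
      by (simp add: algebra_simps)
    then have "-1 \<le> r * ?z" for r using assms[of "of_real r * l"] by simp
    then have "?z = 0" by (rule zero_if_multiples_bounded_below)
    then show ?thesis using assms[of l] by (simp add: complex_eq_iff)
  qed
  from zero[of 1] zero[of \<i>] have "p + q = 0" "q - p = 0"
    by (auto simp: algebra_simps complex_eq_iff)
  then show ?thesis by (simp add: complex_eq_iff)
qed

text \<open>The degenerate case of the Cauchy-Schwarz inequality: the quadratic term vanishes, so
  positivity of \<psi> on the squared modulus of l g + 1 leaves a real-linear form in l bounded
  below by -1.\<close>

lemma state_Linf_zero:
  assumes \<psi>: "cs_state (Linf X) \<psi>" and g: "g \<in> Linf_set X" and z: "\<psi> (\<lambda>x. cnj (g x) * g x) = 0"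
  shows "\<psi> g = 0"
proof (rule linear_form_bounded_below_zero)
  fix l
  let ?one = "\<lambda>x. if x \<in> space X then 1 else 0 :: complex"
  let ?k = "\<lambda>x. l * g x + ?one x"
  have k: "?k \<in> Linf_set X" using g by simp
  have eq: "(\<lambda>x. cnj (?k x) * ?k x) =
      (\<lambda>x. (cnj l * l) * (cnj (g x) * g x) + ((cnj l * cnj (g x) + l * g x) + ?one x))"
    using Linf_set_outside[OF g] by (auto simp: fun_eq_iff algebra_simps)
  have "\<psi> (\<lambda>x. cnj (?k x) * ?k x) = cnj l * \<psi> (\<lambda>x. cnj (g x)) + l * \<psi> g + 1"
    unfolding eq using state_add[OF \<psi>] state_scale[OF \<psi>] state_one[OF \<psi>] g z by simp
  moreover have "Im (\<psi> (\<lambda>x. cnj (?k x) * ?k x)) = 0 \<and> 0 \<le> Re (\<psi> (\<lambda>x. cnj (?k x) * ?k x))"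
    using comm_cstar.pos_star_mult[OF comm_cstar_Linf, of ?k X] k by (intro state_pos[OF \<psi>]) simp
  ultimately show "Im (cnj l * \<psi> (\<lambda>x. cnj (g x)) + l * \<psi> g) = 0 \<and>
      -1 \<le> Re (cnj l * \<psi> (\<lambda>x. cnj (g x)) + l * \<psi> g)" by simp
qed

text \<open>Subtracting its value at x from f gives a function g vanishing at x. The mixture of the
  two states then kills the squared modulus of g; as both values are nonnegative, each state kills
  it, and hence g.\<close>

lemma pure_sigma_state_eval:
  assumes x: "x \<in> space X" shows "pure_sigma_state (Linf X) (\<lambda>f. f x)"
  unfolding pure_sigma_state_def
proof (intro conjI allI impI)
  show "sigma_state (Linf X) (\<lambda>f. f x)"
    using sigma_star_hom_eval[OF x] by (simp add: sigma_state_def sigma_star_hom_def)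
  fix \<psi>1 \<psi>2 :: "('a \<Rightarrow> complex) \<Rightarrow> complex" and t :: real
  assume *: "cs_state (Linf X) \<psi>1 \<and> cs_state (Linf X) \<psi>2 \<and> 0 < t \<and> t < 1 \<and>
    (\<forall>f\<in>cs_carrier (Linf X). f x = of_real t * \<psi>1 f + of_real (1 - t) * \<psi>2 f)"
  then have t: "0 < t" "t < 1" and \<psi>: "cs_state (Linf X) \<psi>1" "cs_state (Linf X) \<psi>2" by auto
  have eq: "\<psi>1 f = f x \<and> \<psi>2 f = f x" if f: "f \<in> Linf_set X" for f
  proof -
    let ?one = "\<lambda>x. if x \<in> space X then 1 else 0 :: complex"
    \<comment> \<open>The unit of the algebra replaces the constant function so that g is zero off
      \<open>space X\<close>.\<close>
    let ?g = "\<lambda>y. f y + (- f x) * ?one y"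
    have one: "(\<lambda>y. (- f x) * ?one y) \<in> Linf_set X" by (intro Linf_set_scale Linf_set_one)
    have g: "?g \<in> Linf_set X" using Linf_set_add[OF f one] .
    let ?p = "\<lambda>y. cnj (?g y) * ?g y"
    have p: "?p \<in> Linf_set X" using Linf_set_mult[OF Linf_set_cnj[OF g] g] .
    have pos: "cs_positive (Linf X) ?p"
      using comm_cstar.pos_star_mult[OF comm_cstar_Linf, of ?g X] g by simp
    have "?p x = 0" using x by simp
    then have sum: "of_real t * \<psi>1 ?p + of_real (1 - t) * \<psi>2 ?p = 0" using * p by simp
    have r: "Im (\<psi>1 ?p) = 0" "0 \<le> Re (\<psi>1 ?p)" "Im (\<psi>2 ?p) = 0" "0 \<le> Re (\<psi>2 ?p)"
      using state_pos[OF \<psi>(1) pos] state_pos[OF \<psi>(2) pos] by auto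
    have s0: "t * Re (\<psi>1 ?p) + (1 - t) * Re (\<psi>2 ?p) = 0"
      using arg_cong[OF sum, of Re] by simp
    have "0 \<le> t * Re (\<psi>1 ?p)" "0 \<le> (1 - t) * Re (\<psi>2 ?p)"
      using r t by auto
    with s0 have "t * Re (\<psi>1 ?p) = 0" "(1 - t) * Re (\<psi>2 ?p) = 0" by linarith+
    then have "Re (\<psi>1 ?p) = 0" "Re (\<psi>2 ?p) = 0" using t by auto
    then have "\<psi>1 ?p = 0" "\<psi>2 ?p = 0" using r by (auto simp: complex_eq_iff)
    then have "\<psi>1 ?g = 0" "\<psi>2 ?g = 0" using state_Linf_zero[OF _ g] \<psi> by auto
    have "\<psi> ?g = \<psi> f - f x" if "cs_state (Linf X) \<psi>" for \<psi>
      using state_add[OF that, of f "\<lambda>y. (- f x) * ?one y"] state_scale[OF that, of ?one "- f x"]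
        state_one[OF that] f one by simp
    from this[OF \<psi>(1)] this[OF \<psi>(2)] show ?thesis using \<open>\<psi>1 ?g = 0\<close> \<open>\<psi>2 ?g = 0\<close> by simp
  qed
  show "\<forall>f\<in>cs_carrier (Linf X). \<psi>1 f = f x \<and> \<psi>2 f = f x" using eq by simp
qed

lemma purely_sigma_rep_Linf: "purely_sigma_rep (Linf X)"
  unfolding purely_sigma_rep_def
proof (intro conjI allI impI)
  show "sigma_cstar (Linf X)" using comm_sigma_cstar_Linf unfolding comm_sigma_cstar_def by blast
  fix f assume f: "cs_positive (Linf X) f \<and> (\<forall>\<phi>. pure_sigma_state (Linf X) \<phi> \<longrightarrow> \<phi> f = 0)"
  then have "f x = 0" for x
    using pure_sigma_state_eval[of x X] Linf_set_outside[of f X x]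
    by (cases "x \<in> space X") (auto simp: cs_positive_Linf)
  then show "f = cs_zero (Linf X)" by auto
qed

section \<open>Pure states are multiplicative\<close>

context comm_cstar begin

lemma state_sa:
  assumes "cs_state A \<phi>" "sa a" shows "Im (\<phi> a) = 0"
  using state_pos[OF assms(1) pos_of_norm_le'[OF assms(2) order_refl]] assms
  by (simp add: state_add state_scale state_one)

lemma state_norm_le:
  assumes "cs_state A \<phi>" "sa a" "nrm a \<le> t" shows "\<bar>Re (\<phi> a)\<bar> \<le> t"
  using state_pos[OF assms(1) pos_of_norm_le'[OF assms(2,3)]]
    state_pos[OF assms(1) pos_of_norm_le[OF assms(2,3)]] assms
  by (auto simp: state_add state_scale state_one cs_sub_def abs_le_iff)

lemma state_star:
  assumes \<phi>: "cs_state A \<phi>" and "b \<in> C" shows "\<phi> (star b) = cnj (\<phi> b)"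
proof -
  obtain u v where uv: "sa u" "sa v" "b = u \<^bold>+ \<i> \<^bold>\<cdot> v" "star b = u \<^bold>+ (-\<i>) \<^bold>\<cdot> v"
    using decompose[OF assms(2)] by blast
  have "Im (\<phi> u) = 0" "Im (\<phi> v) = 0" using state_sa[OF \<phi>] uv by auto
  then show ?thesis unfolding uv(4) unfolding uv(3)
    using uv(1,2) by (simp add: state_add[OF \<phi>] state_scale[OF \<phi>] complex_eq_iff)
qed

text \<open>Positivity rests on products of positive elements being positive, thus on commutativity.
  Purity is extremality among all states, so a plain state is the right kind of object to
  produce.\<close>

lemma state_of_weight:
  assumes \<phi>: "cs_state A \<phi>" and x: "pos x" and l: "\<phi> x = of_real l" "l > 0"
  shows "cs_state A (\<lambda>y. \<phi> (x \<^bold>* y) / of_real l)"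
  unfolding cs_state_def pos_unital_map_def cs_linear_def
proof (intro conjI ballI allI impI)
  fix y assume y: "pos y"
  have "Im (\<phi> (x \<^bold>* y)) = 0 \<and> 0 \<le> Re (\<phi> (x \<^bold>* y))" using state_pos[OF \<phi> pos_mult[OF x y]] .
  then show "cs_positive complex_cs (\<phi> (x \<^bold>* y) / of_real l)"
    using l by (simp add: cs_positive_complex Re_divide_of_real Im_divide_of_real)
next
  fix y z assume yz: "y \<in> C" "z \<in> C"
  have "x \<^bold>* (y \<^bold>+ z) = x \<^bold>* y \<^bold>+ x \<^bold>* z"
    using mult_add_all x yz by simp
  then show "\<phi> (x \<^bold>* (y \<^bold>+ z)) / of_real l =
      cs_add complex_cs (\<phi> (x \<^bold>* y) / of_real l) (\<phi> (x \<^bold>* z) / of_real l)"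
    using x yz by (simp add: state_add[OF \<phi>] add_divide_distrib)
next
  fix c y assume y: "y \<in> C"
  then show "\<phi> (x \<^bold>* c \<^bold>\<cdot> y) / of_real l = cs_scale complex_cs c (\<phi> (x \<^bold>* y) / of_real l)"
    using x by (simp add: scale_mult_right state_scale[OF \<phi>])
qed (use x l in auto)

text \<open>For a contraction $a = a^*$, the weight $x = 1/2 + a/4$ and its complement $1 - x$ both have
  positive mass, so purity applies without a case distinction.\<close>

lemma pure_state_mult_contraction:
  assumes \<phi>: "pure_sigma_state A \<phi>" and a: "sa a" "nrm a \<le> 1" and y: "y \<in> C"
  shows "\<phi> (a \<^bold>* y) = \<phi> a * \<phi> y"
proof -
  have st: "cs_state A \<phi>"
    using \<phi> by (simp add: pure_sigma_state_def sigma_state_def sigma_normal_def cs_state_def)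
  have aC: "a \<in> C" using a by simp
  define r where "r = Re (\<phi> a)"
  have \<phi>a: "\<phi> a = of_real r" using state_sa[OF st a(1)] by (simp add: r_def complex_eq_iff)
  have r: "\<bar>r\<bar> \<le> 1" using state_norm_le[OF st a] by (simp add: r_def)
  \<comment> \<open>For e = 1 and e = -1 these are complementary weights with sum 1, and both are
    positive because the multiple of a has norm at most 1/2.\<close>
  define x where "x e = complex_of_real (1/2) \<^bold>\<cdot> \<^bold>1 \<^bold>+ complex_of_real (e/4) \<^bold>\<cdot> a" for e
  have xC: "x e \<in> C" for e using aC by (simp add: x_def)
  have pos: "pos (x e)" if e: "\<bar>e\<bar> = 1" for e
    unfolding x_def
  proof (rule pos_of_norm_le')
    show "sa (complex_of_real (e/4) \<^bold>\<cdot> a)" using a(1) by (rule sa_scale)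
    show "nrm (complex_of_real (e/4) \<^bold>\<cdot> a) \<le> 1/2" using a(2) e aC by (simp add: norm_divide)
  qed
  have \<phi>x: "\<phi> (x e) = of_real (1/2 + e * r / 4)" for e
    using aC by (simp add: x_def state_add[OF st] state_scale[OF st] state_one[OF st] \<phi>a)
  have xy: "\<phi> (x e \<^bold>* z) = \<phi> z / 2 + of_real (e/4) * \<phi> (a \<^bold>* z)" if "z \<in> C" for e z
    using aC that by (simp add: x_def mult_add scale_mult_left state_add[OF st] state_scale[OF st])
  \<comment> \<open>The mass of \<open>x 1\<close>; it lies between 1/4 and 3/4 since r has absolute
    value at most 1.\<close>
  define l where "l = 1/2 + r/4"
  have l: "0 < l" "l < 1" using r by (auto simp: l_def)
  have l': "1/2 + (-1) * r / 4 = 1 - l" by (simp add: l_def)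
  let ?\<psi>1 = "\<lambda>z. \<phi> (x 1 \<^bold>* z) / of_real l" and ?\<psi>2 = "\<lambda>z. \<phi> (x (-1) \<^bold>* z) / of_real (1 - l)"
  have "cs_state A ?\<psi>1" using \<phi>x[of 1] l by (intro state_of_weight[OF st pos]) (auto simp: l_def)
  moreover have "cs_state A ?\<psi>2"
    using \<phi>x[of "-1"] l unfolding l' by (intro state_of_weight[OF st pos]) auto
  moreover have "\<phi> z = of_real l * ?\<psi>1 z + of_real (1 - l) * ?\<psi>2 z" if "z \<in> C" for z
  proof -
    have "of_real l * ?\<psi>1 z = \<phi> (x 1 \<^bold>* z)" "of_real (1 - l) * ?\<psi>2 z = \<phi> (x (-1) \<^bold>* z)"
      using l by auto
    moreover have "\<phi> z = \<phi> (x 1 \<^bold>* z) + \<phi> (x (-1) \<^bold>* z)" using xy[OF that] by simp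
    ultimately show ?thesis by simp
  qed
  ultimately have "?\<psi>1 y = \<phi> y"
    using \<phi> l y unfolding pure_sigma_state_def by blast
  then have "\<phi> (x 1 \<^bold>* y) = of_real l * \<phi> y" using l by (simp add: field_simps)
  \<comment> \<open>Expanding \<open>x 1\<close>, the terms \<phi> y / 2 cancel and the product rule
    for a remains.\<close>
  then show ?thesis using xy[OF y, of 1] by (simp add: l_def \<phi>a field_simps)
qed

lemma pure_state_mult:
  assumes \<phi>: "pure_sigma_state A \<phi>" and b: "b \<in> C" and y: "y \<in> C"
  shows "\<phi> (b \<^bold>* y) = \<phi> b * \<phi> y"
proof -
  have st: "cs_state A \<phi>"
    using \<phi> by (simp add: pure_sigma_state_def sigma_state_def sigma_normal_def cs_state_def)
  have sa: "\<phi> (a \<^bold>* y) = \<phi> a * \<phi> y" if a: "sa a" for a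
  proof -
    define r where "r = nrm a + 1"
    have rp: "r > 0" using a norm_nonneg[of a] by (simp add: r_def)
    define c where "c = complex_of_real (1/r) \<^bold>\<cdot> a"
    have c: "sa c" unfolding c_def using a by (rule sa_scale)
    have "nrm c \<le> 1" using a rp by (simp add: c_def norm_divide r_def)
    from pure_state_mult_contraction[OF \<phi> c this y] have "\<phi> (c \<^bold>* y) = \<phi> c * \<phi> y" .
    moreover have "a = complex_of_real r \<^bold>\<cdot> c" using a rp by (simp add: c_def)
    ultimately show ?thesis using c y by (simp add: scale_mult_left state_scale[OF st])
  qed
  obtain u v where uv: "sa u" "sa v" "b = u \<^bold>+ \<i> \<^bold>\<cdot> v"
    using decompose[OF b] by blast
  then show ?thesis using sa[OF uv(1)] sa[OF uv(2)] y
    by (simp add: mult_add scale_mult_left state_add[OF st] state_scale[OF st] algebra_simps)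
qed

lemma pure_state_character:
  assumes \<phi>: "pure_sigma_state A \<phi>" shows "restrict \<phi> C \<in> spec_space A"
proof (rule spec_space_restrictI)
  show "comm_cstar A" by unfold_locales
  have st: "cs_state A \<phi>" and n: "sigma_normal A complex_cs \<phi>"
    using \<phi> by (auto simp: pure_sigma_state_def sigma_state_def sigma_normal_def cs_state_def)
  have "cs_linear A complex_cs \<phi>" using st by (simp add: cs_state_def pos_unital_map_def)
  then have "star_hom A complex_cs \<phi>"
    using pure_state_mult[OF \<phi>] state_star[OF st] state_one[OF st] by (simp add: star_hom_def)
  then show "sigma_star_hom A complex_cs \<phi>" using n by (simp add: sigma_star_hom_def)
qed

end

text \<open>The order is defined through the algebraic operations, so the inverse map respects it
  too and carries suprema to suprema: an upper bound t of the image sequence is compared with s by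
  way of \<open>h t\<close>.\<close>

lemma alg_isoI:
  assumes A: "comm_cstar A" and B: "comm_cstar B" and h: "sigma_star_hom A B h"
    and bij: "bij_betw h (cs_carrier A) (cs_carrier B)"
  shows "alg_iso A B h"
proof -
  define k where "k = inv_into (cs_carrier A) h"
  note sh = sigma_star_hom_star_hom[OF h]
  interpret A: comm_cstar A by fact
  interpret B: comm_cstar B by fact
  have kh: "k (h a) = a" if "a \<in> cs_carrier A" for a
    using bij_betw_inv_into_left[OF bij that] by (simp add: k_def)
  have hk: "h (k b) = b" if "b \<in> cs_carrier B" for b
    using bij_betw_inv_into_right[OF bij that] by (simp add: k_def)
  have km: "k b \<in> cs_carrier A" if "b \<in> cs_carrier B" for b
    using bij_betw_inv_into[OF bij] that by (auto simp: k_def bij_betw_def)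
  have keq: "k b = a" if "a \<in> cs_carrier A" "h a = b" for a b using kh that by blast
  have sk: "star_hom B A k"
    unfolding star_hom_def cs_linear_def
  proof (intro conjI ballI allI)
    fix x assume x: "x \<in> cs_carrier B"
    show "k x \<in> cs_carrier A" using km[OF x] .
    show "k (cs_scale B c x) = cs_scale A c (k x)" for c
      by (rule keq) (simp_all add: km x hk star_hom_scale[OF sh])
    show "k (cs_star B x) = cs_star A (k x)"
      by (rule keq) (simp_all add: km x hk star_hom_star[OF sh])
    fix y assume y: "y \<in> cs_carrier B"
    show "k (cs_add B x y) = cs_add A (k x) (k y)"
      by (rule keq) (simp_all add: km x y hk star_hom_add[OF sh])
    show "k (cs_mult B x y) = cs_mult A (k x) (k y)"
      by (rule keq) (simp_all add: km x y hk star_hom_mult[OF sh])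
  qed (rule keq, simp_all add: star_hom_one[OF sh])
  have "sigma_star_hom B A k"
  proof (rule B.sigma_star_homI[OF sk])
    fix b s assume b: "cs_bdd_incseq B b" and s: "cs_is_sup B b s"
    show "cs_is_sup A (\<lambda>n. k (b n)) (k s)"
      unfolding cs_is_sup_def
    proof (intro conjI allI impI)
      show "cs_selfadj A (k s)" using s B.star_hom_sa[OF sk] by (simp add: cs_is_sup_def)
      show "cs_le A (k (b n)) (k s)" for n using s B.star_hom_le[OF sk] by (simp add: cs_is_sup_def)
      fix t assume t: "cs_selfadj A t \<and> (\<forall>n. cs_le A (k (b n)) t)"
      then have tC: "t \<in> cs_carrier A" by (simp add: cs_selfadj_def)
      have "cs_le B (b n) (h t)" for n
        using A.star_hom_le[OF sh, of "k (b n)" t] t hk[OF B.bdd_incseq_mem[OF b]] by simp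
      moreover have "cs_selfadj B (h t)" using t A.star_hom_sa[OF sh] by blast
      ultimately have "cs_le B s (h t)" using s by (simp add: cs_is_sup_def)
      from B.star_hom_le[OF sk this] show "cs_le A (k s) t" using kh[OF tC] by simp
    qed
  qed
  then show ?thesis unfolding alg_iso_def using h kh hk by blast
qed

section \<open>Algebras separated by their characters\<close>

locale pure_cstar =
  fixes A :: "'a cstar"
  assumes comm_sigma: "comm_sigma_cstar A" and pure: "purely_sigma_rep A"

sublocale pure_cstar \<subseteq> comm_cstar A
  using comm_sigma_cstar_imp_comm_cstar[OF comm_sigma] .

context pure_cstar begin

abbreviation "spec \<equiv> spec_space A"

lemma comm_cstar_A: "comm_cstar A" by unfold_locales

lemma spec_star_hom: "\<phi> \<in> spec \<Longrightarrow> star_hom A complex_cs \<phi>"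
  using sigma_star_hom_star_hom spec_space_hom by blast

lemma
  assumes "\<phi> \<in> spec"
  shows spec_add: "\<lbrakk>x \<in> C; y \<in> C\<rbrakk> \<Longrightarrow> \<phi> (x \<^bold>+ y) = \<phi> x + \<phi> y"
    and spec_mult: "\<lbrakk>x \<in> C; y \<in> C\<rbrakk> \<Longrightarrow> \<phi> (x \<^bold>* y) = \<phi> x * \<phi> y"
    and spec_scale: "x \<in> C \<Longrightarrow> \<phi> (c \<^bold>\<cdot> x) = c * \<phi> x"
    and spec_star: "x \<in> C \<Longrightarrow> \<phi> (star x) = cnj (\<phi> x)"
    and spec_one: "\<phi> \<^bold>1 = 1"
    and spec_sub: "\<lbrakk>x \<in> C; y \<in> C\<rbrakk> \<Longrightarrow> \<phi> (x \<^bold>- y) = \<phi> x - \<phi> y"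
    and spec_pos: "pos x \<Longrightarrow> Im (\<phi> x) = 0 \<and> 0 \<le> Re (\<phi> x)"
    and spec_sa: "sa x \<Longrightarrow> Im (\<phi> x) = 0"
  using star_hom_add[OF spec_star_hom[OF assms]] star_hom_mult[OF spec_star_hom[OF assms]]
    star_hom_scale[OF spec_star_hom[OF assms]] star_hom_star[OF spec_star_hom[OF assms]]
    star_hom_one[OF spec_star_hom[OF assms]] star_hom_sub[OF spec_star_hom[OF assms]]
    star_hom_pos[OF spec_star_hom[OF assms], of x] star_hom_sa[OF spec_star_hom[OF assms], of x]
  by (auto simp: cs_positive_complex cs_selfadj_complex) (simp add: cs_sub_def)

text \<open>Separation is given for positive elements, so it is applied to d^* d with d = a - b; the
  C*-identity then yields d = 0.\<close>

lemma spec_separates: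
  assumes "a \<in> C" "b \<in> C" "\<And>\<phi>. \<phi> \<in> spec \<Longrightarrow> \<phi> a = \<phi> b" shows "a = b"
proof -
  define d where "d = a \<^bold>- b"
  have d: "d \<in> C" using assms by (simp add: d_def)
  have "\<phi> (star d \<^bold>* d) = 0" if "pure_sigma_state A \<phi>" for \<phi>
  proof -
    have R: "restrict \<phi> C \<in> spec" using pure_state_character[OF that] .
    have "restrict \<phi> C (star d \<^bold>* d) = 0"
      using d assms spec_mult[OF R, of "star d" d] spec_sub[OF R, of a b] assms(3)[OF R]
      by (simp add: d_def)
    then show ?thesis using d by simp
  qed
  then have "star d \<^bold>* d = \<^bold>0"
    using pure pos_star_mult[OF d] unfolding purely_sigma_rep_def by blast
  then have "(nrm d)\<^sup>2 = 0" using norm_star_mult[OF d] norm_eq_0[of "\<^bold>0"] by simp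
  then show ?thesis using d norm_eq_0[OF d] assms sub_eq_zeroD by (simp add: d_def)
qed

lemma sa_if_spec_real:
  assumes "a \<in> C" "\<And>\<phi>. \<phi> \<in> spec \<Longrightarrow> Im (\<phi> a) = 0" shows "sa a"
proof -
  have "star a = a"
    using assms by (intro spec_separates) (auto simp: spec_star complex_eq_iff)
  then show ?thesis unfolding cs_selfadj_def using assms by simp
qed

text \<open>w is the positive root of a^2. Characters are multiplicative and nonnegative on w, so
  they send it to the nonnegative root of the square of their value at a.\<close>

lemma spec_abs:
  assumes "sa a" obtains w where "pos w" "\<And>\<phi>. \<phi> \<in> spec \<Longrightarrow> \<phi> w = of_real \<bar>Re (\<phi> a)\<bar>"
proof -
  have "pos (a \<^bold>* a)" using pos_star_mult[of a] assms by (simp add: sa_star)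
  then obtain w where w: "pos w" "w \<^bold>* w = a \<^bold>* a" using pos_sqrt by metis
  have "\<phi> w = of_real \<bar>Re (\<phi> a)\<bar>" if \<phi>: "\<phi> \<in> spec" for \<phi>
  proof -
    have "\<phi> w * \<phi> w = \<phi> a * \<phi> a"
      using spec_mult[OF \<phi>, of w w] spec_mult[OF \<phi>, of a a] w assms by simp
    moreover have "Im (\<phi> w) = 0 \<and> 0 \<le> Re (\<phi> w)" "Im (\<phi> a) = 0"
      using spec_pos[OF \<phi> w(1)] spec_sa[OF \<phi> assms] by auto
    ultimately have "(Re (\<phi> w))\<^sup>2 = (Re (\<phi> a))\<^sup>2" by (simp add: complex_eq_iff power2_eq_square)
    then have "\<bar>Re (\<phi> w)\<bar> = \<bar>Re (\<phi> a)\<bar>" by (simp add: power2_eq_iff abs_eq_iff)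
    then show ?thesis using spec_pos[OF \<phi> w(1)] by (simp add: complex_eq_iff)
  qed
  then show thesis using that w by blast
qed

text \<open>Under every character the absolute value of a agrees with a, so it equals a. The order
  can thus be tested on characters.\<close>

lemma pos_if_spec_nonneg:
  assumes "sa a" "\<And>\<phi>. \<phi> \<in> spec \<Longrightarrow> 0 \<le> Re (\<phi> a)" shows "pos a"
proof -
  obtain w where w: "pos w" "\<And>\<phi>. \<phi> \<in> spec \<Longrightarrow> \<phi> w = of_real \<bar>Re (\<phi> a)\<bar>"
    using spec_abs[OF assms(1)] by blast
  have "w = a"
    using w assms spec_sa[OF _ assms(1)] by (intro spec_separates) (auto simp: complex_eq_iff)
  with w show ?thesis by simp
qed

text \<open>This is the image of the counit, but blind to values off the spectrum; closure
  properties can then be stated for functions such as constants, which do not vanish there.\<close>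

definition rep :: "(('a \<Rightarrow> complex) \<Rightarrow> complex) \<Rightarrow> bool" where
  "rep F \<longleftrightarrow> (\<exists>a\<in>C. \<forall>\<phi>\<in>spec. F \<phi> = \<phi> a)"

lemma rep_const: "rep (\<lambda>_. c)"
  unfolding rep_def by (rule bexI[of _ "c \<^bold>\<cdot> \<^bold>1"]) (auto simp: spec_scale spec_one)

lemma rep_add: assumes "rep F" "rep G" shows "rep (\<lambda>\<phi>. F \<phi> + G \<phi>)"
proof -
  from assms obtain a b where "a \<in> C" "b \<in> C" "\<forall>\<phi>\<in>spec. F \<phi> = \<phi> a" "\<forall>\<phi>\<in>spec. G \<phi> = \<phi> b"
    unfolding rep_def by blast
  then show ?thesis unfolding rep_def by (intro bexI[of _ "a \<^bold>+ b"]) (auto simp: spec_add)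
qed

lemma rep_mult: assumes "rep F" "rep G" shows "rep (\<lambda>\<phi>. F \<phi> * G \<phi>)"
proof -
  from assms obtain a b where "a \<in> C" "b \<in> C" "\<forall>\<phi>\<in>spec. F \<phi> = \<phi> a" "\<forall>\<phi>\<in>spec. G \<phi> = \<phi> b"
    unfolding rep_def by blast
  then show ?thesis unfolding rep_def by (intro bexI[of _ "a \<^bold>* b"]) (auto simp: spec_mult)
qed

lemma rep_cong: "rep F \<Longrightarrow> (\<And>\<phi>. \<phi> \<in> spec \<Longrightarrow> G \<phi> = F \<phi>) \<Longrightarrow> rep G"
  unfolding rep_def by metis

lemma rep_scale: "rep F \<Longrightarrow> rep (\<lambda>\<phi>. c * F \<phi>)"
  using rep_mult[OF rep_const] .

lemma rep_diff: "rep F \<Longrightarrow> rep G \<Longrightarrow> rep (\<lambda>\<phi>. F \<phi> - G \<phi>)"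
  using rep_add[OF _ rep_scale[of G "-1"], of F] by simp

lemma rep_power: "rep F \<Longrightarrow> rep (\<lambda>\<phi>. F \<phi> ^ n)"
  by (induction n) (auto intro: rep_const rep_mult)

lemma rep_real:
  assumes "rep (\<lambda>\<phi>. complex_of_real (u \<phi>))"
  obtains a where "sa a" "\<And>\<phi>. \<phi> \<in> spec \<Longrightarrow> \<phi> a = of_real (u \<phi>)"
proof -
  from assms obtain a where a: "a \<in> C" "\<And>\<phi>. \<phi> \<in> spec \<Longrightarrow> \<phi> a = of_real (u \<phi>)"
    unfolding rep_def by metis
  have "Im (\<phi> a) = 0" if "\<phi> \<in> spec" for \<phi> using a(2)[OF that] by simp
  with a(1) have "sa a" by (rule sa_if_spec_real)
  with a show thesis using that by blast
qed

lemma rep_abs: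
  assumes "rep (\<lambda>\<phi>. complex_of_real (u \<phi>))" shows "rep (\<lambda>\<phi>. complex_of_real \<bar>u \<phi>\<bar>)"
proof -
  obtain a where a: "sa a" "\<And>\<phi>. \<phi> \<in> spec \<Longrightarrow> \<phi> a = of_real (u \<phi>)" using rep_real[OF assms] by blast
  obtain w where w: "pos w" "\<And>\<phi>. \<phi> \<in> spec \<Longrightarrow> \<phi> w = of_real \<bar>Re (\<phi> a)\<bar>"
    using spec_abs[OF a(1)] by blast
  have "of_real \<bar>u \<phi>\<bar> = \<phi> w" if "\<phi> \<in> spec" for \<phi> using w(2)[OF that] a(2)[OF that] by simp
  then show ?thesis unfolding rep_def using w(1) by (intro bexI[of _ w]) auto
qed

lemma rep_bounded:
  assumes "rep F" obtains M where "\<And>\<phi>. \<phi> \<in> spec \<Longrightarrow> cmod (F \<phi>) \<le> M"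
proof -
  from assms obtain a where a: "a \<in> C" "\<And>\<phi>. \<phi> \<in> spec \<Longrightarrow> F \<phi> = \<phi> a" unfolding rep_def by metis
  then show thesis using that[of "nrm a"] spec_space_norm_le[OF comm_cstar_A] by simp
qed

text \<open>The bound at all characters becomes a norm bound through
  \<open>norm_le_if_bounds\<close>, so the representing elements have a supremum in A. Characters,
  being normal, send it to the pointwise limit.\<close>

lemma rep_incseq_limit:
  assumes u: "\<And>k. rep (\<lambda>\<phi>. complex_of_real (u k \<phi>))"
    and inc: "\<And>k \<phi>. \<phi> \<in> spec \<Longrightarrow> u k \<phi> \<le> u (Suc k) \<phi>"
    and bnd: "\<And>k \<phi>. \<phi> \<in> spec \<Longrightarrow> \<bar>u k \<phi>\<bar> \<le> M"
    and lim: "\<And>\<phi>. \<phi> \<in> spec \<Longrightarrow> (\<lambda>k. u k \<phi>) \<longlonglongrightarrow> v \<phi>"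
  shows "rep (\<lambda>\<phi>. complex_of_real (v \<phi>))"
proof -
  have "\<forall>k. \<exists>a. sa a \<and> (\<forall>\<phi>\<in>spec. \<phi> a = of_real (u k \<phi>))" using rep_real[OF u] by metis
  from choice[OF this] obtain a where a: "\<And>k. sa (a k)" "\<And>k \<phi>. \<phi> \<in> spec \<Longrightarrow> \<phi> (a k) = of_real (u k \<phi>)"
    by blast
  \<comment> \<open>The bound is assumed on the spectrum only, so M may be negative if the spectrum
    is empty; a norm bound must be nonnegative.\<close>
  define N where "N = max M 0"
  have N: "0 \<le> N" by (simp add: N_def)
  have uN: "u k \<phi> \<le> N" "- u k \<phi> \<le> N" if "\<phi> \<in> spec" for k \<phi>
    using bnd[OF that, of k] by (auto simp: N_def)
  have Re_a: "Re (\<phi> (a k)) = u k \<phi>" if "\<phi> \<in> spec" for k \<phi> using a(2)[OF that] by simp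
  have aC: "a k \<in> C" for k using a(1) by simp
  have sN: "sa (complex_of_real N \<^bold>\<cdot> \<^bold>1)" by (rule sa_scale[OF sa_one])
  have "nrm (a k) \<le> N" for k
  proof (rule norm_le_if_bounds[OF a(1) N])
    show "pos (complex_of_real N \<^bold>\<cdot> \<^bold>1 \<^bold>- a k)"
    proof (rule pos_if_spec_nonneg[OF sa_sub[OF sN a(1)]])
      fix \<phi> assume \<phi>: "\<phi> \<in> spec"
      show "0 \<le> Re (\<phi> (complex_of_real N \<^bold>\<cdot> \<^bold>1 \<^bold>- a k))"
        using uN[OF \<phi>, of k] Re_a[OF \<phi>] aC by (simp add: spec_sub[OF \<phi>] spec_scale[OF \<phi>] spec_one[OF \<phi>])
    qed
    show "pos (complex_of_real N \<^bold>\<cdot> \<^bold>1 \<^bold>+ a k)"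
    proof (rule pos_if_spec_nonneg[OF sa_add[OF sN a(1)]])
      fix \<phi> assume \<phi>: "\<phi> \<in> spec"
      show "0 \<le> Re (\<phi> (complex_of_real N \<^bold>\<cdot> \<^bold>1 \<^bold>+ a k))"
        using uN[OF \<phi>, of k] Re_a[OF \<phi>] aC by (simp add: spec_add[OF \<phi>] spec_scale[OF \<phi>] spec_one[OF \<phi>])
    qed
  qed
  moreover have "pos (a (Suc k) \<^bold>- a k)" for k
  proof (rule pos_if_spec_nonneg[OF sa_sub[OF a(1) a(1)]])
    show "0 \<le> Re (\<phi> (a (Suc k) \<^bold>- a k))" if \<phi>: "\<phi> \<in> spec" for \<phi>
      using inc[OF \<phi>, of k] Re_a[OF \<phi>] aC by (simp add: spec_sub[OF \<phi>])
  qed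
  ultimately have bi: "cs_bdd_incseq A a"
    using a(1) by (auto simp: cs_bdd_incseq_def cs_le_def)
  then obtain s where s: "cs_is_sup A a s"
    using comm_sigma by (auto simp: comm_sigma_cstar_def sigma_cstar_def)
  have "\<phi> s = of_real (v \<phi>)" if \<phi>: "\<phi> \<in> spec" for \<phi>
  proof -
    have "cs_is_sup complex_cs (\<lambda>k. \<phi> (a k)) (\<phi> s)"
      using sigma_star_hom_sup[OF spec_space_hom[OF \<phi>] bi s] .
    moreover have "sa s" using s by (simp add: cs_is_sup_def)
    ultimately have "(\<lambda>k. \<phi> (a k)) \<longlonglongrightarrow> \<phi> s"
      using cs_is_sup_complex_incseq[of "\<lambda>k. \<phi> (a k)" "\<phi> s"] a(2)[OF \<phi>] inc[OF \<phi>] spec_sa[OF \<phi>] by simp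
    moreover have "(\<lambda>k. \<phi> (a k)) \<longlonglongrightarrow> of_real (v \<phi>)"
      unfolding a(2)[OF \<phi>] using lim[OF \<phi>] by (rule tendsto_of_real)
    ultimately show ?thesis by (rule LIMSEQ_unique)
  qed
  then show ?thesis unfolding rep_def using is_sup_mem[OF s] by (intro bexI[of _ s]) auto
qed

text \<open>The positive part g of u - t is half the sum of u - t and its absolute value. Once it is
  scaled to e with values in [0, 1], the functions 1 - (1 - e)^n increase to 1 where e > 0 and stay
  0 where e = 0.\<close>

lemma rep_superlevel:
  assumes "rep (\<lambda>\<phi>. complex_of_real (u \<phi>))"
  shows "rep (\<lambda>\<phi>. complex_of_real (indicator {\<phi>\<in>spec. t < u \<phi>} \<phi>))"
proof -
  define g where "g \<phi> = max (u \<phi> - t) 0" for \<phi>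
  have "rep (\<lambda>\<phi>. complex_of_real (u \<phi> - t))" using rep_diff[OF assms rep_const[of "of_real t"]] by simp
  from rep_scale[OF rep_add[OF this rep_abs[OF this]], of "1/2"]
  have g: "rep (\<lambda>\<phi>. complex_of_real (g \<phi>))"
    by (rule rep_cong) (auto simp: g_def max_def field_simps simp flip: of_real_add)
  then obtain M where M: "\<And>\<phi>. \<phi> \<in> spec \<Longrightarrow> cmod (complex_of_real (g \<phi>)) \<le> M" using rep_bounded by blast
  \<comment> \<open>At least 1, so that dividing by K is harmless even when g vanishes.\<close>
  define K where "K = max M 1"
  define e where "e \<phi> = g \<phi> / K" for \<phi>
  have e01: "0 \<le> e \<phi>" "e \<phi> \<le> 1" if "\<phi> \<in> spec" for \<phi>
    using M[OF that] by (auto simp: e_def K_def g_def divide_simps)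
  have "rep (\<lambda>\<phi>. complex_of_real (e \<phi>))" using rep_scale[OF g, of "1 / of_real K"] by (simp add: e_def)
  then have "rep (\<lambda>\<phi>. 1 - (1 - complex_of_real (e \<phi>)) ^ n)" for n
    by (intro rep_diff rep_const rep_power)
  then have "rep (\<lambda>\<phi>. complex_of_real (1 - (1 - e \<phi>) ^ n))" for n by simp
  then show ?thesis
  proof (rule rep_incseq_limit[where M = 1])
    fix n and \<phi> assume \<phi>: "\<phi> \<in> spec"
    show "1 - (1 - e \<phi>) ^ n \<le> 1 - (1 - e \<phi>) ^ Suc n"
      using e01[OF \<phi>] power_decreasing[of n "Suc n" "1 - e \<phi>"] by simp
    have "0 \<le> (1 - e \<phi>) ^ n" "(1 - e \<phi>) ^ n \<le> 1" using e01[OF \<phi>] by (auto intro: power_le_one)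
    then show "\<bar>1 - (1 - e \<phi>) ^ n\<bar> \<le> 1" by simp
  next
    fix \<phi> assume \<phi>: "\<phi> \<in> spec"
    have K: "K > 0" by (simp add: K_def)
    show "(\<lambda>n. 1 - (1 - e \<phi>) ^ n) \<longlonglongrightarrow> indicator {\<phi>\<in>spec. t < u \<phi>} \<phi>"
    proof (cases "t < u \<phi>")
      case True
      then have "0 < e \<phi>" using K by (simp add: e_def g_def)
      then have "(\<lambda>n. (1 - e \<phi>) ^ n) \<longlonglongrightarrow> 0" using e01[OF \<phi>] by (intro LIMSEQ_realpow_zero) auto
      from tendsto_diff[OF tendsto_const[of 1] this] show ?thesis using True \<phi> by simp
    next
      case False
      then have "e \<phi> = 0" by (simp add: e_def g_def)
      then show ?thesis using False by simp
    qed
  qed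
qed

definition rep_sets :: "('a \<Rightarrow> complex) set set" where
  "rep_sets = {S. S \<subseteq> spec \<and> rep (\<lambda>\<phi>. complex_of_real (indicator S \<phi>))}"

lemma rep_sets_compl: assumes "S \<in> rep_sets" shows "spec - S \<in> rep_sets"
proof -
  have "rep (\<lambda>\<phi>. 1 - complex_of_real (indicator S \<phi>))"
    using assms by (intro rep_diff rep_const) (simp add: rep_sets_def)
  then have "rep (\<lambda>\<phi>. complex_of_real (indicator (spec - S) \<phi>))"
    by (rule rep_cong) (auto simp: indicator_def)
  then show ?thesis by (simp add: rep_sets_def)
qed

lemma rep_sets_Int: assumes "S \<in> rep_sets" "T \<in> rep_sets" shows "S \<inter> T \<in> rep_sets"
  using assms rep_mult[of "\<lambda>\<phi>. complex_of_real (indicator S \<phi>)" "\<lambda>\<phi>. complex_of_real (indicator T \<phi>)"]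
  by (auto simp: rep_sets_def indicator_inter_arith)

lemma rep_sets_Un: assumes "S \<in> rep_sets" "T \<in> rep_sets" shows "S \<union> T \<in> rep_sets"
proof -
  have "S \<union> T = spec - ((spec - S) \<inter> (spec - T))" using assms by (auto simp: rep_sets_def)
  then show ?thesis using assms rep_sets_compl rep_sets_Int by metis
qed

text \<open>Products and complements give finite unions; a countable union is the increasing limit
  of finite ones.\<close>

lemma sigma_algebra_rep_sets: "sigma_algebra spec rep_sets"
  unfolding sigma_algebra_iff2
proof (intro conjI ballI allI impI)
  show "rep_sets \<subseteq> Pow spec" by (auto simp: rep_sets_def)
  show E: "{} \<in> rep_sets" using rep_const[of 0] by (simp add: rep_sets_def)
  show "spec - S \<in> rep_sets" if "S \<in> rep_sets" for S using rep_sets_compl[OF that] .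
  fix F :: "nat \<Rightarrow> ('a \<Rightarrow> complex) set" assume F: "range F \<subseteq> rep_sets"
  define G where "G n = (\<Union>k\<le>n. F k)" for n
  have G: "G n \<in> rep_sets" for n
  proof (induction n)
    case 0 then show ?case using F by (auto simp: G_def)
  next
    case (Suc n)
    have "G (Suc n) = F (Suc n) \<union> G n" by (auto simp: G_def atMost_Suc)
    then show ?case using Suc F rep_sets_Un by auto
  qed
  have UN: "(\<Union>n. F n) = (\<Union>n. G n)" by (auto simp: G_def)
  have "rep (\<lambda>\<phi>. complex_of_real (indicator (\<Union>n. G n) \<phi>))"
  proof (rule rep_incseq_limit[where M = 1])
    show "rep (\<lambda>\<phi>. complex_of_real (indicator (G n) \<phi>))" for n using G by (simp add: rep_sets_def)
    have inc: "incseq G" by (intro incseq_SucI) (auto simp: G_def atMost_Suc)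
    show "indicator (G n) \<phi> \<le> (indicator (G (Suc n)) \<phi> :: real)" for n \<phi>
      using incseq_SucD[OF inc, of n] by (auto simp: indicator_def)
    show "(\<lambda>n. indicator (G n) \<phi>) \<longlonglongrightarrow> (indicator (\<Union>n. G n) \<phi> :: real)" for \<phi>
      using LIMSEQ_indicator_incseq[OF inc] .
  qed (auto simp: indicator_def)
  then show "(\<Union>n. F n) \<in> rep_sets" unfolding UN using G by (auto simp: rep_sets_def)
qed

text \<open>Superlevel sets of self-adjoint elements make the real and imaginary parts of every
  evaluation measurable for \<open>rep_sets\<close>, and the sigma-algebra of the spectrum is the
  smallest with this property.\<close>

lemma sets_Spec_rep: "sets (Spec A) \<subseteq> rep_sets"
proof -
  interpret sigma_algebra spec rep_sets by (rule sigma_algebra_rep_sets)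
  define N where "N = sigma spec rep_sets"
  have spN: "space N = spec" unfolding N_def by (rule space_measure_of) (auto simp: rep_sets_def)
  have seN: "sets N = rep_sets" unfolding N_def by simp
  have sa_meas: "(\<lambda>\<phi>. Re (\<phi> u)) \<in> borel_measurable N" if u: "sa u" for u
  proof (subst borel_measurable_iff_greater, rule allI)
    fix t
    have "rep (\<lambda>\<phi>. complex_of_real (Re (\<phi> u)))"
      unfolding rep_def using u spec_sa by (intro bexI[of _ u]) (auto simp: complex_eq_iff)
    from rep_superlevel[OF this, of t] show "{\<phi> \<in> space N. t < Re (\<phi> u)} \<in> sets N"
      unfolding spN seN by (auto simp: rep_sets_def)
  qed
  have "{\<phi> \<in> spec. \<phi> a \<in> T} \<in> rep_sets" if a: "a \<in> C" and T: "T \<in> sets borel" for a T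
  proof -
    obtain u v where uv: "sa u" "sa v" "a = u \<^bold>+ \<i> \<^bold>\<cdot> v" using decompose[OF a] by blast
    have ReIm: "Re (\<phi> a) = Re (\<phi> u)" "Im (\<phi> a) = Re (\<phi> v)" if \<phi>: "\<phi> \<in> spec" for \<phi>
      using uv spec_sa[OF \<phi>] by (auto simp: spec_add[OF \<phi>] spec_scale[OF \<phi>])
    have "(\<lambda>\<phi>. Re (\<phi> a)) \<in> borel_measurable N"
      by (rule measurable_cong[THEN iffD2, OF _ sa_meas[OF uv(1)]]) (simp add: spN ReIm)
    moreover have "(\<lambda>\<phi>. Im (\<phi> a)) \<in> borel_measurable N"
      by (rule measurable_cong[THEN iffD2, OF _ sa_meas[OF uv(2)]]) (simp add: spN ReIm)
    ultimately have "(\<lambda>\<phi>. \<phi> a) \<in> borel_measurable N" by (simp add: borel_measurable_complex_iff)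
    from measurable_sets[OF this T] show ?thesis unfolding seN spN
      by (simp add: vimage_def Int_def conj_commute)
  qed
  then show ?thesis unfolding sets_Spec by (intro sigma_sets_subset) auto
qed

text \<open>The induction generalises M because a scalar factor c changes the bound to M / c. By
  nonnegativity the summands inherit the bound of a sum, and increasing approximants lie below their
  limit.\<close>

lemma rep_nonneg_measurable:
  assumes "u \<in> borel_measurable (Spec A)" "\<And>\<phi>. 0 \<le> u \<phi>" "\<And>\<phi>. \<phi> \<in> spec \<Longrightarrow> u \<phi> \<le> M"
  shows "rep (\<lambda>\<phi>. complex_of_real (u \<phi>))"
  using assms
proof (induction u arbitrary: M rule: borel_measurable_induct_real)
  case (set S)
  then show ?case using sets_Spec_rep by (auto simp: rep_sets_def)
next
  case (mult u c)
  show ?case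
  proof (cases "c = 0")
    case True then show ?thesis using rep_const[of 0] by simp
  next
    case False
    then have "u \<phi> \<le> M / c" if "\<phi> \<in> spec" for \<phi>
      using mult.prems[OF that] mult.hyps(1) by (simp add: field_simps)
    from rep_scale[OF mult.IH[OF this]] show ?thesis by simp
  qed
next
  case (add u v)
  have u: "u \<phi> \<le> M" and v: "v \<phi> \<le> M" if "\<phi> \<in> spec" for \<phi>
    using add.prems[OF that] add.hyps(2)[of \<phi>] add.hyps(4)[of \<phi>] by linarith+
  show ?case using rep_add[OF add.IH(2)[OF v] add.IH(1)[OF u]] by simp
next
  case (seq U)
  have le: "U i \<phi> \<le> M" if "\<phi> \<in> spec" for i \<phi>
  proof -
    have "incseq (\<lambda>i. U i \<phi>)" using seq.hyps by (auto simp: incseq_def le_fun_def)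
    from incseq_le[OF this, of _ i] seq.hyps seq.prems[OF that] that show ?thesis by force
  qed
  show ?case
  proof (rule rep_incseq_limit)
    show "rep (\<lambda>\<phi>. complex_of_real (U i \<phi>))" for i using seq.IH[OF le] .
    show "U i \<phi> \<le> U (Suc i) \<phi>" for i \<phi> using seq.hyps by (auto simp: incseq_Suc_iff le_fun_def)
    show "\<bar>U i \<phi>\<bar> \<le> M" if "\<phi> \<in> spec" for i \<phi> using seq.hyps le[OF that] by simp
    show "(\<lambda>i. U i \<phi>) \<longlonglongrightarrow> u \<phi>" if "\<phi> \<in> spec" for \<phi> using seq.hyps that by simp
  qed
qed

text \<open>Real and imaginary parts are differences of bounded nonnegative functions, to which the
  induction applies.\<close>

lemma rep_Linf:
  assumes F: "F \<in> Linf_set (Spec A)" shows "rep F"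
proof -
  obtain M where M: "\<And>\<phi>. cmod (F \<phi>) \<le> M" using Linf_set_bounded[OF F] by blast
  have real: "rep (\<lambda>\<phi>. complex_of_real (u \<phi>))"
    if u: "u \<in> borel_measurable (Spec A)" "\<And>\<phi>. \<bar>u \<phi>\<bar> \<le> M" for u
  proof -
    have "u \<phi> \<le> M" "- u \<phi> \<le> M" "0 \<le> M" for \<phi> using u(2)[of \<phi>] by auto
    then have "rep (\<lambda>\<phi>. complex_of_real (max (u \<phi>) 0))" "rep (\<lambda>\<phi>. complex_of_real (max (- u \<phi>) 0))"
      using u(1) by (auto intro!: rep_nonneg_measurable[where M = M])
    from rep_diff[OF this] show ?thesis
      by (rule rep_cong) (auto simp: max_def simp flip: of_real_diff of_real_minus)
  qed
  have "rep (\<lambda>\<phi>. complex_of_real (Re (F \<phi>)))" "rep (\<lambda>\<phi>. complex_of_real (Im (F \<phi>)))"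
    using Linf_set_measurable[OF F] M order_trans[OF abs_Re_le_cmod M] order_trans[OF abs_Im_le_cmod M]
    by (auto intro!: real)
  from rep_add[OF this(1) rep_scale[OF this(2), of \<i>]] show ?thesis
    by (rule rep_cong) (simp add: complex_eq_iff)
qed

lemma alg_iso_adj_counit: "alg_iso A (Linf (Spec A)) (adj_counit A)"
proof (rule alg_isoI[OF comm_cstar_A comm_cstar_Linf sigma_star_hom_adj_counit[OF comm_cstar_A]])
  have mem: "adj_counit A a \<in> Linf_set (Spec A)" if "a \<in> C" for a
    using star_hom_mem[OF sigma_star_hom_star_hom[OF sigma_star_hom_adj_counit[OF comm_cstar_A]] that] by simp
  show "bij_betw (adj_counit A) C (cs_carrier (Linf (Spec A)))"
  proof (rule bij_betwI')
    fix a b assume ab: "a \<in> C" "b \<in> C"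
    show "(adj_counit A a = adj_counit A b) = (a = b)"
    proof
      assume "adj_counit A a = adj_counit A b"
      then have "\<phi> a = \<phi> b" if "\<phi> \<in> spec" for \<phi>
        using adj_counit_apply[OF ab(1) that] adj_counit_apply[OF ab(2) that] by simp
      then show "a = b" by (rule spec_separates[OF ab])
    qed simp
  next
    fix F assume "F \<in> cs_carrier (Linf (Spec A))"
    then have F: "F \<in> Linf_set (Spec A)" by simp
    obtain a where a: "a \<in> C" "\<And>\<phi>. \<phi> \<in> spec \<Longrightarrow> F \<phi> = \<phi> a" using rep_Linf[OF F] unfolding rep_def by metis
    have "F = adj_counit A a"
    proof
      show "F \<phi> = adj_counit A a \<phi>" for \<phi>
        using a adj_counit_apply[OF a(1)] Linf_set_outside[OF F] Linf_set_outside[OF mem[OF a(1)]]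
        by (cases "\<phi> \<in> spec") auto
    qed
    with a show "\<exists>a\<in>C. F = adj_counit A a" by blast
  qed (use mem in simp)
qed

end

text \<open>The bijection with its two naturality equations encodes the adjunction. Idempotency is
  recorded on both sides, by invertibility of the unit at spectra and of the counit at function
  algebras. As the subcategories are full, the equivalence amounts to the functors landing in them
  and to the unit and counit being isomorphisms there.\<close>

theorem theorem4p22:
  fixes X :: "'x measure" and X' :: "'y measure" and A :: "'a cstar" and B :: "'b cstar"
  shows
  "comm_sigma_cstar (Linf X)
   \<and> (f \<in> measurable X X' \<longrightarrow> sigma_star_hom (Linf X') (Linf X) (Linf_map X X' f))
   \<and> (comm_sigma_cstar A \<and> comm_sigma_cstar B \<and> sigma_star_hom A B h
        \<longrightarrow> Spec_map A B h \<in> measurable (Spec B) (Spec A))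
   \<and> (comm_sigma_cstar A \<longrightarrow> bij_betw (adj_Phi X A) (meas_hom X (Spec A)) (alg_hom A (Linf X)))
   \<and> (comm_sigma_cstar A \<and> g \<in> measurable X' X \<and> k \<in> meas_hom X (Spec A)
        \<longrightarrow> adj_Phi X' A (restrict (k \<circ> g) (space X'))
            = restrict (Linf_map X' X g \<circ> adj_Phi X A k) (cs_carrier A))
   \<and> (comm_sigma_cstar A \<and> comm_sigma_cstar B \<and> sigma_star_hom B A h' \<and> k \<in> meas_hom X (Spec A)
        \<longrightarrow> adj_Phi X B (restrict (Spec_map B A h' \<circ> k) (space X))
            = restrict (adj_Phi X A k \<circ> h') (cs_carrier B))
   \<and> (comm_sigma_cstar A \<longrightarrow> meas_iso (Spec A) (Spec (Linf (Spec A))) (adj_unit (Spec A)))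
   \<and> alg_iso (Linf X) (Linf (Spec (Linf X))) (adj_counit (Linf X))
   \<and> (sober X \<longrightarrow> purely_sigma_rep (Linf X) \<and> meas_iso X (Spec (Linf X)) (adj_unit X))
   \<and> (comm_sigma_cstar A \<and> purely_sigma_rep A
        \<longrightarrow> sober (Spec A) \<and> alg_iso A (Linf (Spec A)) (adj_counit A))"
proof (intro conjI impI; (elim conjE)?)
  show "meas_iso (Spec A) (Spec (Linf (Spec A))) (adj_unit (Spec A))" if "comm_sigma_cstar A"
    using bij_betw_adj_unit_Spec[OF comm_sigma_cstar_imp_comm_cstar[OF that]]
    by (intro meas_iso_adj_unit) simp
  show "alg_iso A (Linf (Spec A)) (adj_counit A)" if "comm_sigma_cstar A" "purely_sigma_rep A"
    using pure_cstar.alg_iso_adj_counit[OF pure_cstar.intro[OF that]] .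
qed (simp_all add: comm_sigma_cstar_Linf sigma_star_hom_Linf_map Spec_map_measurable
    comm_sigma_cstar_imp_comm_cstar bij_betw_adj_Phi adj_Phi_natural_space adj_Phi_natural_alg
    alg_iso_adj_counit_Linf purely_sigma_rep_Linf meas_iso_adj_unit bij_betw_adj_unit_sober sober_Spec)

end
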